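(* For all positive integers $m,n$ and all $z\in\mathfrak{U}$ the following two identities hold: $$\frac{\log^m\frac1z}{m!}-\sum_{i=0}^{m-1}\Big(\operatorname{Li}_{m-i}(z)+(-1)^{m-i}\operatorname{Li}_{m-i}\big(\tfrac1z\big)\Big)\frac{\log^i\frac1z}{i!}=B_m\frac{(2\pi i)^m}{m!},$$ and $$\begin{aligned} &\sum_{i=0}^{m-1}(-1)^{n+i+1}\operatorname{Li}_{m-i,\{1\}^{n}}\big(\tfrac1z\big)\frac{\log^i\frac1z}{i!}+\sum_{i=0}^{m-1}(-1)^{n+i+1}\operatorname{Li}_{m-i+1,\{1\}^{n-1}}\big(\tfrac1z\big)\frac{\log^i\frac1z}{i!}\\ &+\sum_{i=0}^{m-1}\sum_{j=0}^{n}(-1)^{m+n-j-1}\operatorname{Li}_{\{1\}^{n-j}}\big(\tfrac1z\big)\sum_{k=0}^{j}\binom{m-i-1+j-k}{m-i-1}\sum_{s}G_1(m-i+j,\,k+1,\,s;\,z)\,\frac{\log^{i}\frac1z}{i!}\\ &=\sum_{\substack{m_1+m_2+m_3=m\\ n_1+n_2=n}}\binom{m_1+n_1}{m_1}(-1)^{m_1}P_{m_1+n_1}(\boldsymbol{\zeta})\,P_{m_2}(\boldsymbol{\zeta})\,\frac{(-\pi i)^{m_3}}{m_3!}\,P_{n_2}(-\boldsymbol{\zeta}), \end{aligned}$$ where the last sum runs over non-negative integers, and in $(2\pi i)^m$ and $(-\pi i)^{m_3}$ the symbol $i$ is the imaginary unit.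
   Context: $\operatorname{Li}_{k_1,\dots,k_r}(z)=\sum_{m_1>\cdots>m_r>0}\frac{z^{m_1}}{m_1^{k_1}\cdots m_r^{k_r}}$ for $|z|<1$, continued analytically; $\{1\}^n$ means $1$ repeated $n$ times, and $\operatorname{Li}_{\{1\}^0}=1$. For a word $w$ in letters $x,y$: $|w|$ is the number of letters, $d(w)$ the number of $y$'s, and $h(w)$ is (the number of occurrences of $yx$ in $w$) $+1$. For $w=x^{k_1-1}y\cdots x^{k_r-1}y$ put $\operatorname{Li}(w;z)=\operatorname{Li}_{k_1,\dots,k_r}(z)$. For positive integers $k,n,s$, $G_1(k,n,s;z)=\sum\operatorname{Li}(w;z)$, summed over all words $w$ ending in $y$ with $|w|=k$, $d(w)=n$, $h(w)=s$. Thus $\sum_sG_1(k,n,s;z)=\sum_{k_1+\cdots+k_n=k,\ k_i\ge1}\operatorname{Li}_{k_1,\dots,k_n}(z)$. $\mathfrak{U}$ is the universal covering space of $\mathbf{P}^1-\{0,1,\infty\}$. Branches: fix a lift to $\mathfrak{U}$ of the open lower half-plane $\{\operatorname{Im}z<0\}$. On it $\operatorname{Li}_{k_1,\dots,k_r}(z)$ and $\log z$ take principal values (continuation of the power series, resp. of the real logarithm, from $(0,1)$), $\log\frac1z=-\log z$, and $\operatorname{Li}_{k_1,\dots,k_r}(\frac1z)$ is the principal value (continued from $(0,1)$ within the upper half-plane) at the point $\frac1z$ of the upper half-plane. All these functions are then continued analytically to the simply connected surface $\mathfrak{U}$. On the lift of $(0,1)$ adjacent to this half-plane one has, for example, $\operatorname{Li}_1(\frac1z)=\operatorname{Li}_1(z)+\log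 z+\pi i$. $B_m$ are the Bernoulli numbers defined by $\sum_{m\ge0}B_m\frac{t^m}{m!}=\frac{te^t}{e^t-1}$. For a sequence $\boldsymbol{a}=(a_1,a_2,\dots)$, $P_n(\boldsymbol{a})$ is defined by $\exp(\sum_{n\ge1}a_nt^n)=\sum_{n\ge0}P_n(\boldsymbol{a})t^n$. Here $\boldsymbol{\zeta}=(0,\frac{\zeta(2)}2,\frac{\zeta(3)}3,\dots)$ and $-\boldsymbol{\zeta}$ is its termwise negative. *)

theory Defs
  imports "HOL-Analysis.Analysis" "HOL-Computational_Algebra.Formal_Power_Series"
begin

section \<open>Principal branches of multiple polylogarithms\<close>

text \<open>The index list is \<open>[k\<^sub>1, \<dots>, k\<^sub>r]\<close>; summation is over lists \<open>[m\<^sub>1, \<dots>, m\<^sub>r]\<close>.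
  The empty index needs its own clause because \<open>hd []\<close> is unspecified.\<close>

definition Li_series :: "nat list \<Rightarrow> complex \<Rightarrow> complex" where
  "Li_series ks z =
    (if ks = [] then 1
     else \<Sum>\<^sub>\<infinity>ms\<in>{ms. length ms = length ks \<and> sorted_wrt (>) ms \<and> (\<forall>m\<in>set ms. 0 < m)}.
            z ^ hd ms / (\<Prod>i<length ks. of_nat (ms ! i) ^ (ks ! i)))"

text \<open>The slit plane \<open>\<complex> - [1,\<infinity>)\<close> is star-shaped about \<open>0\<close> and contains both open half-planes,
  so this is the continuation of the power series from \<open>(0,1)\<close> into either of them.\<close>

definition Li_principal :: "nat list \<Rightarrow> complex \<Rightarrow> complex" where
  "Li_principal ks =
    (SOME f. f holomorphic_on - (complex_of_real ` {1..}) \<and> (\<forall>z\<in>ball 0 1. f z = Li_series ks z))"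

section \<open>Functions on the universal covering\<close>

text \<open>\<open>\<^bold>P\<^sup>1 - {0,1,\<infinity>}\<close> is \<open>\<complex> - {0,1}\<close>; its universal covering is an arbitrary
  simply connected (in particular path-connected) covering space of it.\<close>

definition universal_cover :: "'a::topological_space set \<Rightarrow> ('a \<Rightarrow> complex) \<Rightarrow> bool" where
  "universal_cover U p \<longleftrightarrow> covering_space U p (- {0, 1}) \<and> simply_connected U"

definition is_lift :: "'a::topological_space set \<Rightarrow> ('a \<Rightarrow> complex) \<Rightarrow> complex set \<Rightarrow> 'a set \<Rightarrow> bool"
  where "is_lift U p S H \<longleftrightarrow> openin (top_of_set U) H \<and> (\<exists>q. homeomorphism H S p q)"

text \<open>Complex structure on \<open>U\<close> pulled back along \<open>p\<close>: covering maps are open, so \<open>p ` V\<close> is open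
  in \<open>\<complex>\<close>.\<close>

definition holomorphic_on_cover ::
  "'a::topological_space set \<Rightarrow> ('a \<Rightarrow> complex) \<Rightarrow> ('a \<Rightarrow> complex) \<Rightarrow> bool" where
  "holomorphic_on_cover U p F \<longleftrightarrow>
    (\<forall>u\<in>U. \<exists>V f. openin (top_of_set U) V \<and> u \<in> V \<and> f holomorphic_on (p ` V) \<and>
                 (\<forall>v\<in>V. F v = f (p v)))"

text \<open>The values outside \<open>U\<close> are irrelevant; on \<open>U\<close> the continuation is unique whenever it exists,
  as \<open>U\<close> is connected and \<open>H\<close> is open and nonempty.\<close>

definition continuation ::
  "'a::topological_space set \<Rightarrow> ('a \<Rightarrow> complex) \<Rightarrow> 'a set \<Rightarrow> (complex \<Rightarrow> complex) \<Rightarrow> 'a \<Rightarrow> complex"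
  where
  "continuation U p H f = (SOME F. holomorphic_on_cover U p F \<and> (\<forall>u\<in>H. F u = f (p u)))"

definition Li :: "'a::topological_space set \<Rightarrow> ('a \<Rightarrow> complex) \<Rightarrow> 'a set \<Rightarrow> nat list \<Rightarrow> 'a \<Rightarrow> complex"
  where "Li U p H ks = continuation U p H (Li_principal ks)"

definition Li_inv ::
  "'a::topological_space set \<Rightarrow> ('a \<Rightarrow> complex) \<Rightarrow> 'a set \<Rightarrow> nat list \<Rightarrow> 'a \<Rightarrow> complex"
  where "Li_inv U p H ks = continuation U p H (\<lambda>z. Li_principal ks (1 / z))"

definition log_cover :: "'a::topological_space set \<Rightarrow> ('a \<Rightarrow> complex) \<Rightarrow> 'a set \<Rightarrow> 'a \<Rightarrow> complex"
  where "log_cover U p H = continuation U p H Ln"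

definition log_inv :: "'a::topological_space set \<Rightarrow> ('a \<Rightarrow> complex) \<Rightarrow> 'a set \<Rightarrow> 'a \<Rightarrow> complex"
  where "log_inv U p H u = - log_cover U p H u"

section \<open>Words\<close>

datatype letter = X | Y

definition word_of_index :: "nat list \<Rightarrow> letter list" where
  "word_of_index ks = concat (map (\<lambda>k. replicate (k - 1) X @ [Y]) ks)"

definition index_of_word :: "letter list \<Rightarrow> nat list" where
  "index_of_word w = (THE ks. (\<forall>k\<in>set ks. 0 < k) \<and> word_of_index ks = w)"

definition word_depth :: "letter list \<Rightarrow> nat" where
  "word_depth w = count_list w Y"

definition word_height :: "letter list \<Rightarrow> nat" where
  "word_height w = card {i. Suc i < length w \<and> w ! i = Y \<and> w ! Suc i = X} + 1"

definition G1 ::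
  "'a::topological_space set \<Rightarrow> ('a \<Rightarrow> complex) \<Rightarrow> 'a set \<Rightarrow> nat \<Rightarrow> nat \<Rightarrow> nat \<Rightarrow> 'a \<Rightarrow> complex" where
  "G1 U p H k n s u =
    (\<Sum>w\<in>{w. w \<noteq> [] \<and> last w = Y \<and> length w = k \<and> word_depth w = n \<and> word_height w = s}.
       Li U p H (index_of_word w) u)"

section \<open>Bernoulli numbers, zeta values and the polynomials \<open>P\<^sub>n\<close>\<close>

text \<open>Normalised by \<open>t e\<^sup>t / (e\<^sup>t - 1)\<close>, so \<open>B\<^sub>1 = + 1/2\<close>.\<close>

definition bernoulli_num :: "nat \<Rightarrow> real" where
  "bernoulli_num m = fact m * fps_nth (fps_X * fps_exp 1 / (fps_exp 1 - 1)) m"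

definition zeta_nat :: "nat \<Rightarrow> real" where
  "zeta_nat s = (\<Sum>k. 1 / real (Suc k) ^ s)"

text \<open>Sequences are indexed from \<open>1\<close>; the value at \<open>0\<close> is ignored.\<close>

definition P_exp :: "nat \<Rightarrow> (nat \<Rightarrow> real) \<Rightarrow> real" where
  "P_exp n a = fps_nth (fps_exp 1 oo Abs_fps (\<lambda>k. if k = 0 then 0 else a k)) n"

definition zeta_seq :: "nat \<Rightarrow> real" where
  "zeta_seq k = (if k \<le> 1 then 0 else zeta_nat k / real k)"

end

theory Submission
  imports Defs "HOL-Complex_Analysis.Complex_Analysis"
begin

text \<open>For \<open>z\<close> in the lower half-plane and small \<open>x\<close>, \<open>y > 0\<close> let
  \<open>I(a,b;z) = z\<^sup>a \<integral> t\<^bsup>-a\<^esup> (1 - t)\<^bsup>b-1\<^esup> dt\<close>, integrated from \<open>0\<close> to \<open>z\<close>. Its coefficients in \<open>a\<close>, \<open>b\<close>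
  are, up to sign, the functions \<open>Li\<close> of index \<open>(q + 1, 1, \<dots>, 1)\<close>, and multiplied by \<open>(1 - z)\<^bsup>-b\<^esup>\<close> it
  generates the sums of \<open>Li(w; z)\<close> over all words of given weight and depth. By differentiation,
  \<open>x z\<^sup>x (1 - 1/z)\<^sup>y (1 - z)\<^bsup>-y\<^esup> I(y - x, y; z) + (y - x) z\<^sup>x I(x, y; 1/z) + z\<^sup>x (1 - 1/z)\<^sup>y\<close>
  does not depend on \<open>z\<close>. Letting \<open>z\<close> tend to \<open>1\<close> along the unit circle, the Beta integral evaluates it as
  \<open>e\<^bsup>-\<pi>ix\<^esup> \<Gamma>(1 + x - y) \<Gamma>(1 - x) / \<Gamma>(1 - y)\<close>. On the unit circle both \<open>I(\<cdot>,\<cdot>; z)\<close> and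
  \<open>I(\<cdot>,\<cdot>; 1/z)\<close> are absolutely convergent double power series, so that coefficients may be compared there:
  those of \<open>x\<^sup>m y\<^sup>0\<close> give the first identity, those of \<open>x\<^sup>m y\<^sup>n\<close> with \<open>n > 0\<close> the second. The identity
  theorem carries both over to the half-plane and then to the covering, on which all the functions
  exist because they are iterated primitives and the covering is simply connected.\<close>


text \<open>Put E = z^x (1 - 1/z)^y. The three terms of the invariant have derivatives E x/(1-z), E
  (y-x)/(z(1-z)) and E (x/z - y/(z(1-z))): the exponent y - x in the first integral is what makes
  them multiples of one function, and they add up to 0 because 1/(z(1-z)) = 1/z + 1/(1-z). The
  powers of pi i come from Ln(1 - 1/z) = Ln(1-z) - Ln z - pi i, valid in the lower half-plane, and
  the binomial coefficients on both sides from expanding powers of y - x. The obstacle is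
  convergence. The beta series are absolutely summable on the unit circle only for b > 0, and z and
  1/z lie in the closed disc together only on that circle. Hence coefficients are compared for y > 0
  and for z on an arc. This loses nothing: zeros of a nonzero power series are isolated, and the arc
  has limit points. At y = 0 the Gamma value is e^(-pi i x) pi x / sin(pi x), the Bernoulli
  generating function at t = -2 pi i x; in general the zeta values enter through log Gamma(1 - t) =
  gamma t + sum of zeta(k) t^k/k.\<close>

section \<open>Gluing local data over a simply connected space\<close>

lemma path_connected_if_simply_connected:
  fixes U :: "'a::topological_space set"
  assumes sc: "simply_connected U"
  shows "path_connected U"
  unfolding path_connected_def
proof (intro ballI)
  fix u0 u assume u0: "u0 \<in> U" and u: "u \<in> U"
  have const: "homotopic_loops U p q" if "path p" "path_image p \<subseteq> U" "pathfinish p = pathstart p"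
     "path q" "path_image q \<subseteq> U" "pathfinish q = pathstart q" for p q
    using sc that unfolding simply_connected_def by blast
  \<comment> \<open>\<open>homotopic_loops\<close> is free homotopy, so the constant loops at any
    two points of \<open>U\<close> are homotopic; the track of the base point during the homotopy is
    the path sought.\<close>
  have *: "homotopic_loops U (\<lambda>_. u0) (\<lambda>_. u)"
    using u u0 by (intro const) (auto simp: path_def path_image_def pathfinish_def pathstart_def)
  obtain h where h: "continuous_on ({0..1::real} \<times> {0..1::real}) h" "h ` ({0..1} \<times> {0..1}) \<subseteq> U"
    "h (0,0) = u0" "h (1,0) = u"
  proof -
    obtain h where "continuous_on ({0..1::real} \<times> {0..1::real}) h" "h \<in> ({0..1} \<times> {0..1}) \<rightarrow> U"
       "\<forall>x \<in> {0..1}. h (0,x) = u0" "\<forall>x \<in> {0..1}. h (1,x) = u"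
      using * unfolding homotopic_loops by metis
    then show ?thesis by (intro that[of h]) (simp_all add: image_subset_iff_funcset)
  qed
  have "path (h \<circ> (\<lambda>t. (t,0)))" unfolding path_def
    by (intro continuous_on_compose continuous_on_subset[OF h(1)] continuous_intros) auto
  moreover have "path_image (h \<circ> (\<lambda>t. (t,0))) \<subseteq> U" using h(2) by (auto simp: path_image_def)
  ultimately show "\<exists>g. path g \<and> path_image g \<subseteq> U \<and> pathstart g = u0 \<and> pathfinish g = u" using h(3,4) by (intro exI[of _ "h \<circ> (\<lambda>t. (t,0))"]) (auto simp: pathfinish_def pathstart_def)
qed

text \<open>Local functions on the sets \<open>V u\<close> that differ by locally constant functions, such as the local
  primitives of a given function. They are continued along paths up to an additive constant.\<close>

locale germ_family =
  fixes U :: "'a::topological_space set" and V :: "'a \<Rightarrow> 'a set" and \<phi> :: "'a \<Rightarrow> 'a \<Rightarrow> complex"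
  assumes V_open: "u \<in> U \<Longrightarrow> openin (top_of_set U) (V u)"
    and V_mem: "u \<in> U \<Longrightarrow> u \<in> V u"
    and compat: "\<lbrakk>u \<in> U; v \<in> U; x \<in> V u \<inter> V v\<rbrakk> \<Longrightarrow>
      \<exists>W. openin (top_of_set U) W \<and> x \<in> W \<and> W \<subseteq> V u \<inter> V v \<and>
          (\<forall>y\<in>W. \<phi> u y - \<phi> v y = \<phi> u x - \<phi> v x)"
begin

text \<open>\<open>\<Phi>\<close> lives on the parameter space \<open>K\<close> rather than on the
  image of \<open>h\<close>, because a path may return to a point with another value.\<close>

definition cont_along :: "('b::topological_space \<Rightarrow> 'a) \<Rightarrow> 'b set \<Rightarrow> ('b \<Rightarrow> complex) \<Rightarrow> bool" where
  "cont_along h K \<Phi> \<longleftrightarrow> (\<forall>x\<in>K. \<exists>T. open T \<and> x \<in> T \<and>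
     (\<forall>y\<in>K \<inter> T. \<Phi> y - \<phi> (h x) (h y) = \<Phi> x - \<phi> (h x) (h x)))"

lemma preimage_open:
  assumes "continuous_on K h" "h ` K \<subseteq> U" "openin (top_of_set U) W" "x \<in> K" "h x \<in> W"
  shows "\<exists>T. open T \<and> x \<in> T \<and> (\<forall>y\<in>K \<inter> T. h y \<in> W)"
proof -
  obtain O' where O': "open O'" "W = U \<inter> O'" using assms(3) by (auto simp: openin_open)
  obtain T where T: "open T" "T \<inter> K = h -` O' \<inter> K"
    using assms(1) O'(1) unfolding continuous_on_open_invariant by blast
  have "x \<in> T" using T(2) assms(4,5) O'(2) by auto
  moreover have "h y \<in> W" if "y \<in> K \<inter> T" for y using T(2) that O'(2) assms(2) by auto
  ultimately show ?thesis using T(1) by blast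
qed

lemma cont_along_unique:
  assumes "cont_along h K \<Phi>" "cont_along h K \<Psi>" "connected K" "x \<in> K" "y \<in> K"
  shows "\<Phi> x - \<Psi> x = \<Phi> y - \<Psi> y"
proof (rule connected_local_const[OF assms(3,4,5), of "\<lambda>x. \<Phi> x - \<Psi> x"], intro ballI)
  fix a assume a: "a \<in> K"
  obtain T1 where T1: "open T1" "a \<in> T1" "\<forall>y\<in>K \<inter> T1. \<Phi> y - \<phi> (h a) (h y) = \<Phi> a - \<phi> (h a) (h a)"
    using assms(1)[unfolded cont_along_def, rule_format, OF a] by blast
  obtain T2 where T2: "open T2" "a \<in> T2" "\<forall>y\<in>K \<inter> T2. \<Psi> y - \<phi> (h a) (h y) = \<Psi> a - \<phi> (h a) (h a)"
    using assms(2)[unfolded cont_along_def, rule_format, OF a] by blast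
  have "\<forall>b\<in>T1 \<inter> T2. b \<noteq> a \<longrightarrow> b \<in> K \<longrightarrow> \<Phi> a - \<Psi> a = \<Phi> b - \<Psi> b"
  proof (intro ballI impI)
    fix b assume b: "b \<in> T1 \<inter> T2" "b \<in> K"
    have "\<Phi> b - \<phi> (h a) (h b) = \<Phi> a - \<phi> (h a) (h a)" by (rule bspec[OF T1(3)]) (use b in simp)
    moreover have "\<Psi> b - \<phi> (h a) (h b) = \<Psi> a - \<phi> (h a) (h a)" by (rule bspec[OF T2(3)]) (use b in simp)
    ultimately show "\<Phi> a - \<Psi> a = \<Phi> b - \<Psi> b" by algebra
  qed
  then show "\<forall>\<^sub>F b in at a within K. \<Phi> a - \<Psi> a = \<Phi> b - \<Psi> b"
    unfolding eventually_at_topological using T1 T2 by (intro exI[of _ "T1 \<inter> T2"]) auto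
qed

lemma cont_along_subset: "cont_along h K \<Phi> \<Longrightarrow> L \<subseteq> K \<Longrightarrow> cont_along h L \<Phi>"
  unfolding cont_along_def
  apply (intro ballI)
  subgoal for x
    apply (drule bspec[of _ _ x], blast)
    apply (elim exE conjE)
    subgoal for T by (rule exI[of _ T]) auto
    done
  done

lemma cont_along_cong:
  "cont_along h K \<Phi> \<Longrightarrow> (\<And>x. x \<in> K \<Longrightarrow> h x = h' x) \<Longrightarrow> cont_along h' K \<Phi>"
  unfolding cont_along_def by (metis IntD1)

lemma cont_along_compose:
  assumes "cont_along h K \<Phi>" "continuous_on L \<sigma>" "\<sigma> ` L \<subseteq> K"
  shows "cont_along (h \<circ> \<sigma>) L (\<Phi> \<circ> \<sigma>)"
  unfolding cont_along_def
proof
  fix x assume x: "x \<in> L"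
  then have "\<sigma> x \<in> K" using assms(3) by auto
  then obtain T where T: "open T" "\<sigma> x \<in> T"
    "\<forall>y\<in>K \<inter> T. \<Phi> y - \<phi> (h (\<sigma> x)) (h y) = \<Phi> (\<sigma> x) - \<phi> (h (\<sigma> x)) (h (\<sigma> x))"
    using assms(1)[unfolded cont_along_def, rule_format, of "\<sigma> x"] by metis
  obtain S where S: "open S" "S \<inter> L = \<sigma> -` T \<inter> L"
    using assms(2) T(1) unfolding continuous_on_open_invariant by blast
  have "x \<in> S \<inter> L" unfolding S(2) using T(2) x by simp
  then have "x \<in> S" by simp
  moreover have "(\<Phi> \<circ> \<sigma>) y - \<phi> ((h \<circ> \<sigma>) x) ((h \<circ> \<sigma>) y) = (\<Phi> \<circ> \<sigma>) x - \<phi> ((h \<circ> \<sigma>) x) ((h \<circ> \<sigma>) x)"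
    if "y \<in> L \<inter> S" for y
  proof -
    have "y \<in> S \<inter> L" using that by simp
    then have "\<sigma> y \<in> T" unfolding S(2) by simp
    moreover have "\<sigma> y \<in> K" using that assms(3) by auto
    ultimately have "\<sigma> y \<in> K \<inter> T" by simp
    then show ?thesis using T(3) by (simp add: o_def)
  qed
  ultimately show "\<exists>S. open S \<and> x \<in> S \<and> (\<forall>y\<in>L \<inter> S. (\<Phi> \<circ> \<sigma>) y - \<phi> ((h \<circ> \<sigma>) x) ((h \<circ> \<sigma>) y) =
      (\<Phi> \<circ> \<sigma>) x - \<phi> ((h \<circ> \<sigma>) x) ((h \<circ> \<sigma>) x))" using S(1) by blast
qed

lemma cont_along_chart:
  assumes "continuous_on K h" "h ` K \<subseteq> V u" "u \<in> U"
  shows "cont_along h K (\<phi> u \<circ> h)"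
  unfolding cont_along_def
proof
  fix x assume x: "x \<in> K"
  have VU: "V u \<subseteq> U" using V_open[OF assms(3)] by (simp add: openin_imp_subset)
  have hKU: "h ` K \<subseteq> U" using assms(2) VU by simp
  have hx: "h x \<in> U" using hKU x by auto
  obtain W where W: "openin (top_of_set U) W" "h x \<in> W" "\<forall>y\<in>W. \<phi> u y - \<phi> (h x) y = \<phi> u (h x) - \<phi> (h x) (h x)"
    using compat[OF assms(3) hx, of "h x"] assms x V_mem[OF hx] by blast
  obtain T1 where T1: "open T1" "x \<in> T1" "\<forall>y\<in>K \<inter> T1. h y \<in> W"
    using preimage_open[OF assms(1) hKU W(1) x W(2)] by blast
  then show "\<exists>T. open T \<and> x \<in> T \<and> (\<forall>y\<in>K \<inter> T. (\<phi> u \<circ> h) y - \<phi> (h x) (h y) = (\<phi> u \<circ> h) x - \<phi> (h x) (h x))"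
    using W(3) by auto
qed

text \<open>On a connected overlap two continuations differ by a constant, so shifting one of them
  makes them agree. Closedness gives a point outside one piece a neighbourhood that avoids this
  piece.\<close>

lemma cont_along_glue:
  assumes A: "cont_along h A \<Phi>" and B: "cont_along h B \<Psi>" and cl: "closed A" "closed B"
    and conn: "connected (A \<inter> B)" and x0: "x0 \<in> A \<inter> B"
  shows "\<exists>\<Xi>. cont_along h (A \<union> B) \<Xi>"
proof -
  define c where "c = \<Phi> x0 - \<Psi> x0"
  define \<Xi> where "\<Xi> = (\<lambda>x. if x \<in> A then \<Phi> x else \<Psi> x + c)"
  have agree: "\<Phi> x = \<Psi> x + c" if "x \<in> A \<inter> B" for x
  proof -
    have "\<Phi> x - \<Psi> x = \<Phi> x0 - \<Psi> x0"
      by (rule cont_along_unique[OF _ _ conn that x0, of h])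
         (rule cont_along_subset[OF A], simp, rule cont_along_subset[OF B], simp)
    then show ?thesis unfolding c_def by (simp add: algebra_simps)
  qed
  have XA: "\<Xi> x = \<Phi> x" if "x \<in> A" for x using that by (simp add: \<Xi>_def)
  have XB: "\<Xi> x = \<Psi> x + c" if "x \<in> B" for x using that agree by (auto simp: \<Xi>_def)
  have "cont_along h (A \<union> B) \<Xi>"
    unfolding cont_along_def
  proof
    fix x assume x: "x \<in> A \<union> B"
    have a: "\<exists>T. open T \<and> x \<in> T \<and> (\<forall>y\<in>A \<inter> T. \<Xi> y - \<phi> (h x) (h y) = \<Xi> x - \<phi> (h x) (h x))"
    proof (cases "x \<in> A")
      case True
      obtain T where T: "open T" "x \<in> T" "\<forall>y\<in>A \<inter> T. \<Phi> y - \<phi> (h x) (h y) = \<Phi> x - \<phi> (h x) (h x)"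
        using A[unfolded cont_along_def, rule_format, OF True] by blast
      have "\<Xi> y - \<phi> (h x) (h y) = \<Xi> x - \<phi> (h x) (h x)" if "y \<in> A \<inter> T" for y
        using bspec[OF T(3) that] XA True that by simp
      then show ?thesis using T by blast
    next
      case False then show ?thesis using cl by (intro exI[of _ "-A"]) auto
    qed
    have b: "\<exists>T. open T \<and> x \<in> T \<and> (\<forall>y\<in>B \<inter> T. \<Xi> y - \<phi> (h x) (h y) = \<Xi> x - \<phi> (h x) (h x))"
    proof (cases "x \<in> B")
      case True
      obtain T where T: "open T" "x \<in> T" "\<forall>y\<in>B \<inter> T. \<Psi> y - \<phi> (h x) (h y) = \<Psi> x - \<phi> (h x) (h x)"
        using B[unfolded cont_along_def, rule_format, OF True] by blast
      have "\<Xi> y - \<phi> (h x) (h y) = \<Xi> x - \<phi> (h x) (h x)" if "y \<in> B \<inter> T" for y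
      proof -
        have "\<Psi> y - \<phi> (h x) (h y) = \<Psi> x - \<phi> (h x) (h x)" by (rule bspec[OF T(3)]) (rule that)
        then show ?thesis using XB True that by (simp add: algebra_simps)
      qed
      then show ?thesis using T by blast
    next
      case False then show ?thesis using cl by (intro exI[of _ "-B"]) auto
    qed
    obtain T1 where T1: "open T1" "x \<in> T1" "\<And>y. y \<in> A \<Longrightarrow> y \<in> T1 \<Longrightarrow> \<Xi> y - \<phi> (h x) (h y) = \<Xi> x - \<phi> (h x) (h x)"
      using a by (metis IntI)
    obtain T2 where T2: "open T2" "x \<in> T2" "\<And>y. y \<in> B \<Longrightarrow> y \<in> T2 \<Longrightarrow> \<Xi> y - \<phi> (h x) (h y) = \<Xi> x - \<phi> (h x) (h x)"
      using b by (metis IntI)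
    show "\<exists>T. open T \<and> x \<in> T \<and> (\<forall>y\<in>(A \<union> B) \<inter> T. \<Xi> y - \<phi> (h x) (h y) = \<Xi> x - \<phi> (h x) (h x))"
      by (intro exI[of _ "T1 \<inter> T2"] conjI ballI open_Int T1(1) T2(1) IntI T1(2) T2(2)) (elim IntE UnE; rule T1(3) T2(3); assumption)
  qed
  then show ?thesis by blast
qed

text \<open>A Lebesgue number for the cover by preimages of the sets \<open>V u\<close> yields a
  grid each of whose cells maps into a single \<open>V u\<close>. Cells are glued to strips and
  strips to the square along segments, which are connected.\<close>

lemma cont_along_square:
  fixes h :: "real \<times> real \<Rightarrow> 'a"
  assumes h: "continuous_on ({0..1} \<times> {0..1}) h" "h ` ({0..1} \<times> {0..1}) \<subseteq> U"
  shows "\<exists>\<Phi>. cont_along h ({0..1} \<times> {0..1}) \<Phi>"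
proof -
  let ?S = "{0..1::real} \<times> {0..1::real}"
  define G where "G = {T. open T \<and> (\<exists>u\<in>U. h ` (?S \<inter> T) \<subseteq> V u)}"
  have cov: "?S \<subseteq> \<Union>G"
  proof
    fix x assume x: "x \<in> ?S"
    then have hx: "h x \<in> U" using h(2) by auto
    obtain T where "open T" "x \<in> T" "\<forall>y\<in>?S \<inter> T. h y \<in> V (h x)"
      using preimage_open[OF h V_open[OF hx] x V_mem[OF hx]] by blast
    then show "x \<in> \<Union>G" unfolding G_def using hx by blast
  qed
  have cS: "compact ?S" by (intro compact_Times) auto
  have "open T" if "T \<in> G" for T using that by (simp add: G_def)
  then obtain e where e: "0 < e" "\<And>x. x \<in> ?S \<Longrightarrow> \<exists>T\<in>G. ball x e \<subseteq> T"
    using Heine_Borel_lemma[OF cS cov] by metis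
  \<comment> \<open>A cell of side 1/N has diameter at most 2/N in the sum norm, hence also in the
    Euclidean norm.\<close>
  obtain N where N: "N > (0::nat)" "2 / real N < e"
  proof -
    obtain N :: nat where N: "2 / e < real N" using reals_Archimedean2 by blast
    have "0 < 2 / e" using e(1) by simp
    with N have "0 < real N" by linarith
    then show ?thesis using e(1) N by (intro that[of N]) (auto simp: field_simps)
  qed
  let ?I = "\<lambda>i. {real i / N .. real (Suc i) / N}"
  have cell: "\<exists>\<Phi>. cont_along h (?I i \<times> ?I j) \<Phi>" if ij: "i < N" "j < N" for i j
  proof -
    have le: "real (Suc i) \<le> N" "real (Suc j) \<le> N" using ij by linarith+
    have ile: "real (Suc i) / N \<le> 1" "real (Suc j) / N \<le> 1"
      using le N(1) by (simp_all add: divide_le_eq)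
    have "0 \<le> real i / N" "0 \<le> real j / N" by simp_all
    then have sub: "?I i \<times> ?I j \<subseteq> ?S" using ile by (intro Sigma_mono) (auto simp del: of_nat_Suc)
    let ?x = "(real i / N, real j / N)"
    have xin: "?x \<in> ?I i \<times> ?I j" by (simp add: divide_right_mono)
    then obtain T where T: "T \<in> G" "ball ?x e \<subseteq> T" using e(2) sub by blast
    have "?I i \<times> ?I j \<subseteq> ball ?x e"
    proof clarify
      fix s t assume st: "s \<in> ?I i" "t \<in> ?I j"
      have "\<bar>real i / N - s\<bar> \<le> 1 / N" "\<bar>real j / N - t\<bar> \<le> 1 / N"
        using st by (simp_all add: abs_le_iff add_divide_distrib)
      then have "dist ?x (s,t) \<le> 2 / N"
        using sqrt_sum_squares_le_sum_abs[of "real i / N - s" "real j / N - t"]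
        by (simp add: dist_Pair_Pair dist_real_def)
      then show "(s,t) \<in> ball ?x e" using N(2) by simp
    qed
    then have "?I i \<times> ?I j \<subseteq> ?S \<inter> T" using T(2) sub by blast
    moreover obtain u where "u \<in> U" "h ` (?S \<inter> T) \<subseteq> V u" using T(1) unfolding G_def by blast
    ultimately have "h ` (?I i \<times> ?I j) \<subseteq> V u" by blast
    then show ?thesis using cont_along_chart[OF continuous_on_subset[OF h(1) sub]] \<open>u \<in> U\<close> by blast
  qed
  have strip: "\<exists>\<Phi>. cont_along h ({0..real (Suc i) / N} \<times> ?I j) \<Phi>" if ij: "i < N" "j < N" for i j
    using ij(1)
  proof (induction i)
    case 0 then show ?case using cell[of 0 j] ij by auto
  next
    case (Suc i)
    obtain \<Phi> where \<Phi>: "cont_along h ({0..real (Suc i) / N} \<times> ?I j) \<Phi>" using Suc by auto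
    obtain \<Psi> where \<Psi>: "cont_along h (?I (Suc i) \<times> ?I j) \<Psi>" using cell[of "Suc i" j] ij(2) Suc.prems by blast
    have int: "({0..real (Suc i) / N} \<times> ?I j) \<inter> (?I (Suc i) \<times> ?I j) = {real (Suc i) / N} \<times> ?I j"
      using N(1) by (auto simp: divide_right_mono)
    have un: "({0..real (Suc i) / N} \<times> ?I j) \<union> (?I (Suc i) \<times> ?I j) = {0..real (Suc (Suc i)) / N} \<times> ?I j"
    proof -
      have "{0..real (Suc i) / N} \<union> {real (Suc i) / N..real (Suc (Suc i)) / N} = {0..real (Suc (Suc i)) / N}"
        by (rule ivl_disj_un_two_touch(4)) (auto simp: divide_right_mono)
      then show ?thesis by (simp only: Sigma_Un_distrib1 [symmetric])
    qed
    have "\<exists>\<Xi>. cont_along h (({0..real (Suc i) / N} \<times> ?I j) \<union> (?I (Suc i) \<times> ?I j)) \<Xi>"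
      proof (rule cont_along_glue[OF \<Phi> \<Psi>, of "(real (Suc i) / N, real j / N)"], unfold int)
      show "closed ({0..real (Suc i) / N} \<times> ?I j)" "closed (?I (Suc i) \<times> ?I j)" by (intro closed_Times closed_atLeastAtMost)+
      show "connected ({real (Suc i) / N} \<times> ?I j)" by (intro connected_Times connected_Icc connected_sing)
      show "(real (Suc i) / N, real j / N) \<in> {real (Suc i) / N} \<times> ?I j" by (simp add: divide_right_mono)
    qed
    then show ?case unfolding un .
  qed
  have SN: "real (Suc (N - 1)) / N = 1" using N(1) by simp
  have strip': "\<exists>\<Phi>. cont_along h ({0..1} \<times> ?I j) \<Phi>" if "j < N" for j
    using strip[OF diff_less[OF zero_less_one N(1)] that, unfolded SN] .
  have "\<exists>\<Phi>. cont_along h ({0..1} \<times> {0..real (Suc j) / N}) \<Phi>" if "j < N" for j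
    using that
  proof (induction j)
    case 0
    have "real 0 / N = 0" by simp
    from strip'[OF 0, unfolded this] show ?case .
  next
    case (Suc j)
    obtain \<Phi> where \<Phi>: "cont_along h ({0..1} \<times> {0..real (Suc j) / N}) \<Phi>" using Suc by auto
    obtain \<Psi> where \<Psi>: "cont_along h ({0..1} \<times> ?I (Suc j)) \<Psi>"
      using strip'[OF Suc.prems] by blast
    have int: "({0..1} \<times> {0..real (Suc j) / N}) \<inter> ({0..1} \<times> ?I (Suc j)) = {0..1} \<times> {real (Suc j) / N}"
      using N(1) by (auto simp: divide_right_mono)
    have un: "({0..1} \<times> {0..real (Suc j) / N}) \<union> ({0..1} \<times> ?I (Suc j)) = {0..1} \<times> {0..real (Suc (Suc j)) / N}"
    proof -
      have "{0..real (Suc j) / N} \<union> {real (Suc j) / N..real (Suc (Suc j)) / N} = {0..real (Suc (Suc j)) / N}"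
        by (rule ivl_disj_un_two_touch(4)) (auto simp: divide_right_mono)
      then show ?thesis by (simp only: Sigma_Un_distrib2 [symmetric])
    qed
    have "\<exists>\<Xi>. cont_along h (({0..1} \<times> {0..real (Suc j) / N}) \<union> ({0..1} \<times> ?I (Suc j))) \<Xi>"
      proof (rule cont_along_glue[OF \<Phi> \<Psi>, of "(0, real (Suc j) / N)"], unfold int)
      show "closed ({0..1::real} \<times> {0..real (Suc j) / N})" "closed ({0..1::real} \<times> ?I (Suc j))" by (intro closed_Times closed_atLeastAtMost)+
      show "connected ({0..1::real} \<times> {real (Suc j) / N})" by (intro connected_Times connected_Icc connected_sing)
      show "(0::real, real (Suc j) / N) \<in> {0..1} \<times> {real (Suc j) / N}" by (simp add: divide_right_mono)
    qed
    then show ?case unfolding un .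
  qed
  from this[OF diff_less[OF zero_less_one N(1)], unfolded SN] show ?thesis .
qed

text \<open>A path is treated as a map of the square that ignores the first coordinate.\<close>

lemma cont_along_path:
  fixes \<gamma> :: "real \<Rightarrow> 'a"
  assumes "path \<gamma>" "path_image \<gamma> \<subseteq> U"
  shows "\<exists>\<Phi>. cont_along \<gamma> {0..1} \<Phi>"
proof -
  have "continuous_on ({0..1} \<times> {0..1}) (\<gamma> \<circ> (snd :: real \<times> real \<Rightarrow> real))"
    using assms(1) unfolding path_def by (intro continuous_on_compose continuous_intros) (auto elim: continuous_on_subset)
  then obtain \<Phi> where \<Phi>: "cont_along (\<gamma> \<circ> snd) ({0..1::real} \<times> {0..1}) \<Phi>"
    using cont_along_square[of "\<gamma> \<circ> snd"] assms(2) unfolding path_image_def by fastforce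
  have "cont_along ((\<gamma> \<circ> snd) \<circ> (\<lambda>t. (0::real,t))) {0..1} (\<Phi> \<circ> (\<lambda>t. (0,t)))"
    by (rule cont_along_compose[OF \<Phi>], intro continuous_intros) auto
  then show ?thesis by (auto simp: o_def)
qed

text \<open>The counterpart of a contour integral: for germs of primitives of a function this is the
  integral of that function along \<open>\<gamma>\<close>. Continuations are unique up to a
  constant, so the choice does not matter.\<close>

definition variation :: "(real \<Rightarrow> 'a) \<Rightarrow> complex" where
  "variation \<gamma> = (let \<Phi> = (SOME \<Phi>. cont_along \<gamma> {0..1} \<Phi>) in \<Phi> 1 - \<Phi> 0)"

lemma variation_eq:
  assumes "cont_along \<gamma> {0..1} \<Phi>"
  shows "variation \<gamma> = \<Phi> 1 - \<Phi> 0"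
proof -
  let ?\<Psi> = "SOME \<Phi>. cont_along \<gamma> {0..1} \<Phi>"
  have "cont_along \<gamma> {0..1} ?\<Psi>" using someI_ex[of "cont_along \<gamma> {0..1}"] assms by blast
  from cont_along_unique[OF this assms, of 1 0] show ?thesis
    unfolding variation_def Let_def by (simp add: algebra_simps)
qed

lemma variation_chart:
  assumes "path \<gamma>" "path_image \<gamma> \<subseteq> V u" "u \<in> U"
  shows "variation \<gamma> = \<phi> u (pathfinish \<gamma>) - \<phi> u (pathstart \<gamma>)"
  using variation_eq[OF cont_along_chart[of "{0..1}" \<gamma> u]] assms
  by (simp add: path_def path_image_def pathfinish_def pathstart_def)

lemma variation_join:
  assumes "path \<gamma>" "path_image \<gamma> \<subseteq> U" "path \<delta>" "path_image \<delta> \<subseteq> U" "pathfinish \<gamma> = pathstart \<delta>"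
  shows "variation (\<gamma> +++ \<delta>) = variation \<gamma> + variation \<delta>"
proof -
  have "path_image (\<gamma> +++ \<delta>) \<subseteq> U" using assms path_image_join_subset[of \<gamma> \<delta>] by blast
  moreover have "path (\<gamma> +++ \<delta>)" using assms by simp
  ultimately obtain \<Phi> where \<Phi>: "cont_along (\<gamma> +++ \<delta>) {0..1} \<Phi>" using cont_along_path by blast
  have c: "continuous_on {0..1} (\<lambda>t::real. t / 2)" "continuous_on {0..1} (\<lambda>t::real. (t + 1) / 2)"
    by (intro continuous_intros; simp)+
  have "cont_along ((\<gamma> +++ \<delta>) \<circ> (\<lambda>t. t / 2)) {0..1} (\<Phi> \<circ> (\<lambda>t. t / 2))"
    by (rule cont_along_compose[OF \<Phi> c(1)]) auto
  then have 1: "cont_along \<gamma> {0..1} (\<Phi> \<circ> (\<lambda>t. t / 2))"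
    by (rule cont_along_cong) (simp add: joinpaths_def)
  have "cont_along ((\<gamma> +++ \<delta>) \<circ> (\<lambda>t. (t + 1) / 2)) {0..1} (\<Phi> \<circ> (\<lambda>t. (t + 1) / 2))"
    by (rule cont_along_compose[OF \<Phi> c(2)]) auto
  then have 2: "cont_along \<delta> {0..1} (\<Phi> \<circ> (\<lambda>t. (t + 1) / 2))"
  proof (rule cont_along_cong)
    fix t :: real assume t: "t \<in> {0..1}"
    show "((\<gamma> +++ \<delta>) \<circ> (\<lambda>t. (t + 1) / 2)) t = \<delta> t"
    proof (cases "t = 0")
      case True
      then show ?thesis using assms(5) by (simp add: joinpaths_def pathfinish_def pathstart_def)
    next
      case False
      then have "\<not> (t + 1) / 2 \<le> 1 / 2" "2 * ((t + 1) / 2) - 1 = t" using t by (auto simp: field_simps)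
      then show ?thesis by (simp only: joinpaths_def o_def if_False)
    qed
  qed
  show ?thesis unfolding variation_eq[OF \<Phi>] variation_eq[OF 1] variation_eq[OF 2] by simp
qed

lemma variation_reverse:
  assumes "path \<gamma>" "path_image \<gamma> \<subseteq> U"
  shows "variation (reversepath \<gamma>) = - variation \<gamma>"
proof -
  obtain \<Phi> where \<Phi>: "cont_along \<gamma> {0..1} \<Phi>" using cont_along_path assms by blast
  have "cont_along (\<gamma> \<circ> (\<lambda>t. 1 - t)) {0..1} (\<Phi> \<circ> (\<lambda>t. 1 - t))"
    by (rule cont_along_compose[OF \<Phi>], intro continuous_intros) auto
  then have 1: "cont_along (reversepath \<gamma>) {0..1} (\<Phi> \<circ> (\<lambda>t. 1 - t))"
    by (simp add: reversepath_def o_def)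
  show ?thesis unfolding variation_eq[OF \<Phi>] variation_eq[OF 1] by simp
qed

text \<open>One continuation over the whole square restricts to both loops. Every stage of the
  homotopy is a loop, so the edges x = 0 and x = 1 carry the same path. The values along these two
  edges therefore differ by a constant, and the increments over the first and the last loop
  agree.\<close>

lemma variation_homotopic_loops:
  assumes "homotopic_loops U p q"
  shows "variation p = variation q"
proof -
  obtain h where h: "continuous_on ({0..1::real} \<times> {0..1::real}) h" "h ` ({0..1} \<times> {0..1}) \<subseteq> U"
    and p: "\<And>x. x \<in> {0..1} \<Longrightarrow> h (0,x) = p x" and q: "\<And>x. x \<in> {0..1} \<Longrightarrow> h (1,x) = q x"
    and l: "\<And>t. t \<in> {0..1} \<Longrightarrow> h (t,1) = h (t,0)"
  proof -
    obtain h where "continuous_on ({0..1::real} \<times> {0..1::real}) h" "h \<in> ({0..1} \<times> {0..1}) \<rightarrow> U"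
       "\<forall>x \<in> {0..1}. h (0,x) = p x" "\<forall>x \<in> {0..1}. h (1,x) = q x"
       "\<forall>t \<in> {0..1}. pathfinish (h \<circ> Pair t) = pathstart (h \<circ> Pair t)"
      using assms unfolding homotopic_loops by metis
    then show ?thesis
      by (intro that[of h]) (simp_all add: pathfinish_def pathstart_def image_subset_iff_funcset del: split_paired_All)
  qed
  obtain \<Phi> where \<Phi>: "cont_along h ({0..1} \<times> {0..1}) \<Phi>" using cont_along_square[OF h] by blast
  have sec: "cont_along (h \<circ> (\<lambda>x. (t,x))) {0..1} (\<Phi> \<circ> (\<lambda>x. (t,x)))" if "t \<in> {0..1}" for t
    by (rule cont_along_compose[OF \<Phi>], intro continuous_intros) (use that in auto)
  have p': "variation p = \<Phi> (0,1) - \<Phi> (0,0)"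
    using variation_eq[OF cont_along_cong[OF sec[of 0], of p]] p by (simp add: o_def)
  have q': "variation q = \<Phi> (1,1) - \<Phi> (1,0)"
    using variation_eq[OF cont_along_cong[OF sec[of 1], of q]] q by (simp add: o_def)
  have side: "cont_along (h \<circ> (\<lambda>x. (x,t))) {0..1} (\<Phi> \<circ> (\<lambda>x. (x,t)))" if "t \<in> {0..1}" for t
    by (rule cont_along_compose[OF \<Phi>], intro continuous_intros) (use that in auto)
  have s1: "cont_along (h \<circ> (\<lambda>x. (x,0))) {0..1} (\<Phi> \<circ> (\<lambda>x. (x,1)))"
    by (rule cont_along_cong[OF side[of 1]]) (use l in auto)
  have "(\<Phi> \<circ> (\<lambda>x. (x,1))) 0 - (\<Phi> \<circ> (\<lambda>x. (x,0))) 0 = (\<Phi> \<circ> (\<lambda>x. (x,1))) 1 - (\<Phi> \<circ> (\<lambda>x. (x,0))) (1::real)"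
    by (rule cont_along_unique[OF s1 side[of 0]]) auto
  then show ?thesis unfolding p' q' o_def .
qed

lemma variation_const: "a \<in> U \<Longrightarrow> variation (\<lambda>_. a) = 0"
  using variation_chart[of "\<lambda>_. a" a] V_mem[of a]
  by (simp add: path_def path_image_def pathfinish_def pathstart_def image_subset_iff)

text \<open>\<open>F u\<close> is the variation along a chosen path from a base point. Going out to
  \<open>u\<close>, moving inside \<open>V u\<close> to \<open>v\<close> and returning is a
  null-homotopic loop, so the variation of the short piece is the difference of the two values of
  \<open>F\<close>.\<close>

theorem monodromy:
  assumes sc: "simply_connected U"
    and pc: "\<And>u v. \<lbrakk>u \<in> U; v \<in> V u\<rbrakk> \<Longrightarrow> \<exists>\<gamma>. path \<gamma> \<and> path_image \<gamma> \<subseteq> V u \<and> pathstart \<gamma> = u \<and> pathfinish \<gamma> = v"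
  shows "\<exists>F. \<forall>u\<in>U. \<forall>v\<in>V u. F v - \<phi> u v = F u - \<phi> u u"
proof (cases "U = {}")
  case False
  then obtain u0 where u0: "u0 \<in> U" by blast
  have VU: "V u \<subseteq> U" if "u \<in> U" for u using V_open[OF that] by (simp add: openin_imp_subset)
  have const: "homotopic_loops U p q" if "path p" "path_image p \<subseteq> U" "pathfinish p = pathstart p"
     "path q" "path_image q \<subseteq> U" "pathfinish q = pathstart q" for p q
    using sc that unfolding simply_connected_def by blast
  have ex: "\<exists>\<gamma>. path \<gamma> \<and> path_image \<gamma> \<subseteq> U \<and> pathstart \<gamma> = u0 \<and> pathfinish \<gamma> = u" if u: "u \<in> U" for u
    using path_connected_if_simply_connected[OF sc] u u0 unfolding path_connected_def by metis
  define \<Gamma> where "\<Gamma> = (\<lambda>u. SOME \<gamma>. path \<gamma> \<and> path_image \<gamma> \<subseteq> U \<and> pathstart \<gamma> = u0 \<and> pathfinish \<gamma> = u)"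
  have \<Gamma>: "path (\<Gamma> u)" "path_image (\<Gamma> u) \<subseteq> U" "pathstart (\<Gamma> u) = u0" "pathfinish (\<Gamma> u) = u" if "u \<in> U" for u
    using someI_ex[OF ex[OF that]] unfolding \<Gamma>_def by auto
  have "variation (\<Gamma> v) - \<phi> u v = variation (\<Gamma> u) - \<phi> u u" if uv: "u \<in> U" "v \<in> V u" for u v
  proof -
    have v: "v \<in> U" using uv VU by auto
    obtain \<gamma> where \<gamma>: "path \<gamma>" "path_image \<gamma> \<subseteq> V u" "pathstart \<gamma> = u" "pathfinish \<gamma> = v" using pc[OF uv] by metis
    have \<gamma>U: "path_image \<gamma> \<subseteq> U" using \<gamma>(2) VU[OF uv(1)] by simp
    let ?\<delta> = "(\<Gamma> u +++ \<gamma>) +++ reversepath (\<Gamma> v)"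
    have img: "path_image (\<Gamma> u +++ \<gamma>) \<subseteq> U"
      using \<Gamma>[OF uv(1)] \<gamma> \<gamma>U by (auto simp: path_image_join)
    have "homotopic_loops U ?\<delta> (\<lambda>_. u0)"
      by (rule const) (use \<Gamma>[OF uv(1)] \<Gamma>[OF v] \<gamma> \<gamma>U img u0 in \<open>auto simp: path_image_join\<close>,
        auto simp: path_def path_image_def pathfinish_def pathstart_def)
    then have "variation ?\<delta> = 0" using variation_homotopic_loops variation_const[OF u0] by fastforce
    moreover have "variation ?\<delta> = variation (\<Gamma> u) + variation \<gamma> - variation (\<Gamma> v)"
      using \<Gamma>[OF uv(1)] \<Gamma>[OF v] \<gamma> \<gamma>U img by (simp add: variation_join variation_reverse)
    moreover have "variation \<gamma> = \<phi> u v - \<phi> u u" using variation_chart[OF \<gamma>(1,2) uv(1)] \<gamma> by simp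
    ultimately show ?thesis by (simp add: algebra_simps)
  qed
  then show ?thesis by (intro exI[of _ "\<lambda>v. variation (\<Gamma> v)"]) simp
qed auto

end

section \<open>Charts, primitives and the identity theorem on the covering\<close>

section \<open>Holomorphic functions on the universal cover\<close>

text \<open>An evenly covered sheet is shrunk until its image is a ball: convexity of the ball then
  gives primitives, and constancy of functions with zero derivative.\<close>

lemma cover_chart:
  fixes U :: "'a::topological_space set" and p :: "'a \<Rightarrow> complex"
  assumes cov: "covering_space U p S" and S: "open S" and N: "openin (top_of_set U) N" "u \<in> N"
  obtains W r q where "openin (top_of_set U) W" "u \<in> W" "W \<subseteq> N" "0 < r" "p ` W = ball (p u) r"
    "homeomorphism W (ball (p u) r) p q"
proof -
  have u: "u \<in> U" using N openin_imp_subset by blast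
  have pU: "p ` U = S" and cp: "continuous_on U p" using cov by (auto simp: covering_space_def)
  obtain T v where T: "p u \<in> T" "openin (top_of_set S) T" "\<Union>v = U \<inter> p -` T"
    "\<forall>w\<in>v. openin (top_of_set U) w" "\<forall>w\<in>v. \<exists>q. homeomorphism w T p q"
    using cov u pU unfolding covering_space_def by (metis (no_types, lifting) imageI)
  obtain w where w: "w \<in> v" "u \<in> w" using T(1,3) u by blast
  obtain q where q: "homeomorphism w T p q" using T(5) w(1) by blast
  have ow: "openin (top_of_set U) w" using T(4) w(1) by blast
  have oT: "open T" using T(2) S openin_open_trans by blast
  have "openin (top_of_set U) (w \<inter> N)" using ow N by blast
  then have "openin (top_of_set w) (w \<inter> N)"
    by (metis Int_lower1 openin_subset_trans ow openin_imp_subset)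
  then have "openin (top_of_set T) (p ` (w \<inter> N))" using homeomorphism_imp_open_map[OF q] by blast
  then have "open (p ` (w \<inter> N))" using oT openin_open_trans by blast
  then obtain r where r: "0 < r" "ball (p u) r \<subseteq> p ` (w \<inter> N)"
    using w N(2) unfolding open_contains_ball by blast
  define W where "W = (w \<inter> N) \<inter> (U \<inter> p -` ball (p u) r)"
  have wU: "w \<subseteq> U" using ow openin_imp_subset by blast
  have 1: "openin (top_of_set U) W"
    unfolding W_def using ow N(1) continuous_openin_preimage_gen[OF cp open_ball] by blast
  have 2: "p ` W = ball (p u) r" unfolding W_def using r(2) wU by blast
  have 3: "homeomorphism W (ball (p u) r) p q"
    by (rule homeomorphism_of_subsets[OF q]) (use 2 in \<open>auto simp: W_def\<close>)
  show ?thesis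
    by (rule that[OF 1 _ _ r(1) 2 3]) (use w N u r(1) in \<open>auto simp: W_def\<close>)
qed

context
  fixes U :: "'a::topological_space set" and p :: "'a \<Rightarrow> complex"
begin

lemma holomorphic_on_cover_const: "holomorphic_on_cover U p (\<lambda>_. c)"
  unfolding holomorphic_on_cover_def
  by (intro ballI exI[of _ U] exI[of _ "\<lambda>_. c"]) auto

lemma holomorphic_on_cover_compose:
  assumes "covering_space U p S" "f holomorphic_on S"
  shows "holomorphic_on_cover U p (\<lambda>u. f (p u))"
  unfolding holomorphic_on_cover_def
  using assms by (intro ballI exI[of _ U] exI[of _ f]) (auto simp: covering_space_def)

lemma holomorphic_on_cover_binary:
  assumes "holomorphic_on_cover U p F" "holomorphic_on_cover U p G"
    and op: "\<And>f g S. f holomorphic_on S \<Longrightarrow> g holomorphic_on S \<Longrightarrow> (\<lambda>z. h (f z) (g z)) holomorphic_on S"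
  shows "holomorphic_on_cover U p (\<lambda>u. h (F u) (G u))"
  unfolding holomorphic_on_cover_def
proof
  fix u assume u: "u \<in> U"
  obtain V f where V: "openin (top_of_set U) V" "u \<in> V" "f holomorphic_on (p ` V)" "\<forall>v\<in>V. F v = f (p v)"
    using assms(1) u unfolding holomorphic_on_cover_def by metis
  obtain W g where W: "openin (top_of_set U) W" "u \<in> W" "g holomorphic_on (p ` W)" "\<forall>v\<in>W. G v = g (p v)"
    using assms(2) u unfolding holomorphic_on_cover_def by metis
  have "f holomorphic_on p ` (V \<inter> W)" "g holomorphic_on p ` (V \<inter> W)"
    using V(3) W(3) by (auto elim: holomorphic_on_subset)
  then have "(\<lambda>z. h (f z) (g z)) holomorphic_on p ` (V \<inter> W)" by (rule op)
  then show "\<exists>V f. openin (top_of_set U) V \<and> u \<in> V \<and> f holomorphic_on p ` V \<and> (\<forall>v\<in>V. h (F v) (G v) = f (p v))"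
    using V W by (intro exI[of _ "V \<inter> W"] exI[of _ "\<lambda>z. h (f z) (g z)"]) auto
qed

lemma holomorphic_on_cover_add:
  "holomorphic_on_cover U p F \<Longrightarrow> holomorphic_on_cover U p G \<Longrightarrow> holomorphic_on_cover U p (\<lambda>u. F u + G u)"
  by (rule holomorphic_on_cover_binary) (auto intro: holomorphic_on_add)

lemma holomorphic_on_cover_diff:
  "holomorphic_on_cover U p F \<Longrightarrow> holomorphic_on_cover U p G \<Longrightarrow> holomorphic_on_cover U p (\<lambda>u. F u - G u)"
  by (rule holomorphic_on_cover_binary) (auto intro: holomorphic_on_diff)

lemma holomorphic_on_cover_mult:
  "holomorphic_on_cover U p F \<Longrightarrow> holomorphic_on_cover U p G \<Longrightarrow> holomorphic_on_cover U p (\<lambda>u. F u * G u)"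
  by (rule holomorphic_on_cover_binary) (auto intro: holomorphic_on_mult)

lemma holomorphic_on_cover_minus:
  "holomorphic_on_cover U p F \<Longrightarrow> holomorphic_on_cover U p (\<lambda>u. - F u)"
  using holomorphic_on_cover_diff[OF holomorphic_on_cover_const[of 0]] by simp

lemma holomorphic_on_cover_divide_const:
  "holomorphic_on_cover U p F \<Longrightarrow> holomorphic_on_cover U p (\<lambda>u. F u / c)"
  using holomorphic_on_cover_mult[OF _ holomorphic_on_cover_const[of "1 / c"], of F] by simp

lemma holomorphic_on_cover_power:
  "holomorphic_on_cover U p F \<Longrightarrow> holomorphic_on_cover U p (\<lambda>u. F u ^ k)"
  by (induction k) (auto intro: holomorphic_on_cover_const holomorphic_on_cover_mult)

lemma holomorphic_on_cover_sum:
  "(\<And>i. i \<in> I \<Longrightarrow> holomorphic_on_cover U p (F i)) \<Longrightarrow> holomorphic_on_cover U p (\<lambda>u. \<Sum>i\<in>I. F i u)"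
  by (induction I rule: infinite_finite_induct)
     (auto intro: holomorphic_on_cover_const holomorphic_on_cover_add)

context
  assumes univ: "universal_cover U p"
begin

lemma covering_base: "covering_space U p (- {0, 1})" and simply_connected_cover: "simply_connected U"
  using univ by (auto simp: universal_cover_def)

lemma open_base: "open (- {0, 1 :: complex})"
  by (intro open_Compl finite_imp_closed) auto

text \<open>Primitives on charts differ by locally constant functions, so monodromy joins them. The
  conclusion keeps the chart together with the local function \<open>f\<close>, because the
  derivative is taken downstairs, at \<open>p v\<close>.\<close>

lemma primitive_on_cover:
  assumes G: "holomorphic_on_cover U p G"
  obtains F where "\<And>u. u \<in> U \<Longrightarrow> \<exists>W f r. openin (top_of_set U) W \<and> u \<in> W \<and> p ` W = ball (p u) r \<and>
    (\<forall>v\<in>W. F v = f (p v)) \<and> (\<forall>v\<in>W. (f has_field_derivative G v) (at (p v)))"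
proof -
  have ex: "\<exists>W r q f. openin (top_of_set U) W \<and> u \<in> W \<and> p ` W = ball (p u) r \<and>
      homeomorphism W (ball (p u) r) p q \<and> (\<forall>v\<in>W. (f has_field_derivative G v) (at (p v)))" if u: "u \<in> U" for u
  proof -
    obtain N g where N: "openin (top_of_set U) N" "u \<in> N" "g holomorphic_on (p ` N)" "\<forall>v\<in>N. G v = g (p v)"
      using G u unfolding holomorphic_on_cover_def by metis
    obtain W r q where W: "openin (top_of_set U) W" "u \<in> W" "W \<subseteq> N" "0 < r" "p ` W = ball (p u) r"
      "homeomorphism W (ball (p u) r) p q"
      using cover_chart[OF covering_base open_base N(1,2)] by metis
    have "g holomorphic_on ball (p u) r" using N(3) W(3,5) by (metis holomorphic_on_subset image_mono)
    then obtain f where f: "\<And>x. x \<in> ball (p u) r \<Longrightarrow> (f has_field_derivative g x) (at x within ball (p u) r)"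
      using holomorphic_convex_primitive'[OF convex_ball open_ball] by metis
    have "(f has_field_derivative G v) (at (p v))" if v: "v \<in> W" for v
    proof -
      have pv: "p v \<in> ball (p u) r" using W(5) v by blast
      have "G v = g (p v)" using N(4) W(3) v by auto
      then show ?thesis using f[OF pv] at_within_open[OF pv open_ball] by simp
    qed
    then show ?thesis using W by metis
  qed
  \<comment> \<open>All data of a chart are packed into one tuple, so that a single choice per point
    keeps them consistent.\<close>
  define Q where "Q = (\<lambda>u (W, r, q, f). openin (top_of_set U) W \<and> u \<in> W \<and> p ` W = ball (p u) r \<and>
      homeomorphism W (ball (p u) r) p q \<and> (\<forall>v\<in>W. (f has_field_derivative G v) (at (p v))))"
  have "\<forall>u\<in>U. \<exists>D. Q u D" using ex unfolding Q_def by fastforce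
  then obtain D where D: "\<And>u. u \<in> U \<Longrightarrow> Q u (D u)" by metis
  define V where "V = (\<lambda>u. fst (D u))"
  define r where "r = (\<lambda>u. fst (snd (D u)))"
  define q where "q = (\<lambda>u. fst (snd (snd (D u))))"
  define f where "f = (\<lambda>u. snd (snd (snd (D u))))"
  have V: "openin (top_of_set U) (V u)" "u \<in> V u" "p ` (V u) = ball (p u) (r u)"
      "homeomorphism (V u) (ball (p u) (r u)) p (q u)"
      "\<And>v. v \<in> V u \<Longrightarrow> (f u has_field_derivative G v) (at (p v))" if "u \<in> U" for u
    using D[OF that] unfolding Q_def V_def r_def q_def f_def by (auto split: prod.splits)
  interpret germ_family U V "\<lambda>u v. f u (p v)"
  proof
    fix u assume u: "u \<in> U"
    show "openin (top_of_set U) (V u)" "u \<in> V u" using V[OF u] by auto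
  next
    fix u v x assume u: "u \<in> U" and v: "v \<in> U" and x: "x \<in> V u \<inter> V v"
    have "openin (top_of_set U) (V u \<inter> V v)" using V(1) u v by blast
    then obtain W \<rho> q where W: "openin (top_of_set U) W" "x \<in> W" "W \<subseteq> V u \<inter> V v" "0 < \<rho>"
      "p ` W = ball (p x) \<rho>" "homeomorphism W (ball (p x) \<rho>) p q"
      using cover_chart[OF covering_base open_base _ x] by metis
    have "((\<lambda>z. f u z - f v z) has_field_derivative 0) (at z within ball (p x) \<rho>)" if z: "z \<in> ball (p x) \<rho>" for z
    proof -
      obtain y where y: "y \<in> W" "z = p y" using W(5) z by (metis imageE)
      have "(f u has_field_derivative G y) (at z)" "(f v has_field_derivative G y) (at z)"
        using V(5)[OF u, of y] V(5)[OF v, of y] y W(3) by auto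
      from DERIV_diff[OF this] show ?thesis by (simp add: has_field_derivative_at_within)
    qed
    then have "\<exists>c. \<forall>z\<in>ball (p x) \<rho>. f u z - f v z = c"
      by (intro has_field_derivative_zero_constant[OF convex_ball])
    then obtain c where c: "\<And>z. z \<in> ball (p x) \<rho> \<Longrightarrow> f u z - f v z = c" by auto
    have "f u (p y) - f v (p y) = c" if "y \<in> W" for y using c W(5) that by blast
    then show "\<exists>W. openin (top_of_set U) W \<and> x \<in> W \<and> W \<subseteq> V u \<inter> V v \<and>
       (\<forall>y\<in>W. f u (p y) - f v (p y) = f u (p x) - f v (p x))"
      using W(1-3) by (intro exI[of _ W]) simp
  qed
  \<comment> \<open>Straight segments in the ball lift through \<open>q u\<close>.\<close>
  have pc: "\<exists>\<gamma>. path \<gamma> \<and> path_image \<gamma> \<subseteq> V u \<and> pathstart \<gamma> = u \<and> pathfinish \<gamma> = v" if u: "u \<in> U" and v: "v \<in> V u" for u v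
  proof -
    have seg: "path_image (linepath (p u) (p v)) \<subseteq> ball (p u) (r u)"
    proof -
      have "p u \<in> ball (p u) (r u)" "p v \<in> ball (p u) (r u)" using V(2,3)[OF u] v by blast+
      then show ?thesis unfolding path_image_linepath by (rule closed_segment_subset[OF _ _ convex_ball])
    qed
    have cq: "continuous_on (ball (p u) (r u)) (q u)" and qi: "q u ` ball (p u) (r u) = V u"
      and qp: "\<And>y. y \<in> V u \<Longrightarrow> q u (p y) = y"
      using V(4)[OF u] by (auto simp: homeomorphism_def)
    have "path (q u \<circ> linepath (p u) (p v))"
      by (rule path_continuous_image[OF path_linepath continuous_on_subset[OF cq seg]])
    moreover have "path_image (q u \<circ> linepath (p u) (p v)) \<subseteq> V u"
      unfolding path_image_compose using seg qi by blast
    ultimately show ?thesis using qp V(2)[OF u] v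
      by (intro exI[of _ "q u \<circ> linepath (p u) (p v)"]) (simp add: pathstart_compose pathfinish_compose)
  qed
  obtain F where F: "\<And>u v. u \<in> U \<Longrightarrow> v \<in> V u \<Longrightarrow> F v - f u (p v) = F u - f u (p u)"
    using monodromy[OF simply_connected_cover pc] by metis
  show ?thesis
  proof (rule that[of F])
    fix u assume u: "u \<in> U"
    let ?f = "\<lambda>z. f u z + (F u - f u (p u))"
    have 1: "F v = ?f (p v)" if "v \<in> V u" for v using F[OF u that] by (simp add: algebra_simps)
    have 2: "(?f has_field_derivative G v) (at (p v))" if "v \<in> V u" for v
      using DERIV_add[OF V(5)[OF u that] DERIV_const] by simp
    show "\<exists>W f r. openin (top_of_set U) W \<and> u \<in> W \<and> p ` W = ball (p u) r \<and>
        (\<forall>v\<in>W. F v = f (p v)) \<and> (\<forall>v\<in>W. (f has_field_derivative G v) (at (p v)))"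
      by (intro exI[of _ "V u"] exI[of _ ?f] exI[of _ "r u"] conjI ballI V(1-3)[OF u] 1 2)
  qed
qed

text \<open>The set \<open>Z\<close> near whose points \<open>D\<close> vanishes is open by
  construction. It is also closed: in a chart that meets \<open>Z\<close> the identity theorem on
  the ball forces \<open>D\<close> to vanish on the whole chart.\<close>

lemma identity_on_cover:
  assumes D: "holomorphic_on_cover U p D" and H: "openin (top_of_set U) H" "H \<noteq> {}"
    and 0: "\<And>u. u \<in> H \<Longrightarrow> D u = 0" and z: "z \<in> U"
  shows "D z = 0"
proof -
  define Z where "Z = {u\<in>U. \<exists>W. openin (top_of_set U) W \<and> u \<in> W \<and> (\<forall>v\<in>W. D v = 0)}"
  have "connected U" using path_connected_if_simply_connected[OF simply_connected_cover] path_connected_imp_connected by blast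
  moreover have "openin (top_of_set U) Z"
  proof (subst openin_subopen, intro ballI)
    fix u assume "u \<in> Z"
    then obtain W where W: "openin (top_of_set U) W" "u \<in> W" "\<forall>v\<in>W. D v = 0" unfolding Z_def by blast
    then have "W \<subseteq> Z" unfolding Z_def using openin_imp_subset by blast
    then show "\<exists>T. openin (top_of_set U) T \<and> u \<in> T \<and> T \<subseteq> Z" using W by blast
  qed
  moreover have "openin (top_of_set U) (U - Z)"
  proof (subst openin_subopen, intro ballI)
    fix u assume u: "u \<in> U - Z"
    obtain N f where N: "openin (top_of_set U) N" "u \<in> N" "f holomorphic_on (p ` N)" "\<forall>v\<in>N. D v = f (p v)"
      using D u unfolding holomorphic_on_cover_def by (metis DiffE)
    obtain W r q where W: "openin (top_of_set U) W" "u \<in> W" "W \<subseteq> N" "0 < r" "p ` W = ball (p u) r"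
      "homeomorphism W (ball (p u) r) p q"
      using cover_chart[OF covering_base open_base N(1,2)] by metis
    have hf: "f holomorphic_on ball (p u) r" using N(3) W(3,5) by (metis holomorphic_on_subset image_mono)
    have Df: "D v = f (p v)" if "v \<in> W" for v using N(4) W(3) that by auto
    have "W \<inter> Z = {}"
    proof (rule ccontr)
      assume "W \<inter> Z \<noteq> {}"
      then obtain w T where w: "w \<in> W" and T: "openin (top_of_set U) T" "w \<in> T" "\<forall>v\<in>T. D v = 0"
        unfolding Z_def by blast
      have "openin (top_of_set U) (W \<inter> T)" "w \<in> W \<inter> T" using W(1) T w by auto
      then obtain W' r' q' where W': "openin (top_of_set U) W'" "w \<in> W'" "W' \<subseteq> W \<inter> T" "0 < r'" "p ` W' = ball (p w) r'"
        "homeomorphism W' (ball (p w) r') p q'"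
        using cover_chart[OF covering_base open_base] by metis
      have sub: "ball (p w) r' \<subseteq> ball (p u) r" using W'(3,5) W(5) by blast
      have z0: "f x = 0" if "x \<in> ball (p w) r'" for x
      proof -
        have "x \<in> p ` W'" using that W'(5) by simp
        then obtain y where y: "y \<in> W'" "x = p y" by (rule imageE)
        have "y \<in> W" "y \<in> T" using y(1) W'(3) by auto
        then have "f (p y) = 0" using Df[of y] T(3) by simp
        then show ?thesis using y(2) by simp
      qed
      have f0: "f x = 0" if "x \<in> ball (p u) r" for x
      proof (rule analytic_continuation_open[OF open_ball open_ball _ _ sub hf _ _ that, of "\<lambda>_. 0"])
        show "ball (p w) r' \<noteq> {}" using W'(4) by simp
      qed (use z0 in simp_all)
      have "D v = 0" if "v \<in> W" for v
      proof -
        have "p v \<in> ball (p u) r" using W(5) that by blast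
        then show ?thesis using Df[OF that] f0 by simp
      qed
      then have "u \<in> Z" using W(1,2) u unfolding Z_def by blast
      then show False using u by simp
    qed
    then have "W \<subseteq> U - Z" using W(1) openin_imp_subset by blast
    then show "\<exists>T. openin (top_of_set U) T \<and> u \<in> T \<and> T \<subseteq> U - Z" using W(1,2) by blast
  qed
  then have "closedin (top_of_set U) Z" unfolding closedin_def Z_def by auto
  ultimately have "Z = {} \<or> Z = U" unfolding connected_clopen by blast
  moreover have "H \<subseteq> Z" using H 0 openin_imp_subset unfolding Z_def by blast
  ultimately have "z \<in> Z" using H z by blast
  then show ?thesis unfolding Z_def by blast
qed

section \<open>Extension of functions from the lifted half-plane\<close>

context
  fixes H :: "'a set"
  assumes lift: "is_lift U p {w. Im w < 0} H"
begin

lemma lift_open: "openin (top_of_set U) H" and lift_image: "p ` H = {w. Im w < 0}"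
  and lift_subset: "H \<subseteq> U"
proof -
  show 1: "openin (top_of_set U) H" using lift by (simp add: is_lift_def)
  show "p ` H = {w. Im w < 0}" using lift by (auto simp: is_lift_def homeomorphism_def)
  show "H \<subseteq> U" by (rule openin_imp_subset[OF 1])
qed

lemma lift_nonempty: "H \<noteq> {}"
proof
  assume "H = {}"
  then have "{w :: complex. Im w < 0} = {}" using lift_image by simp
  moreover have "-\<i> \<in> {w :: complex. Im w < 0}" by simp
  ultimately show False by blast
qed

lemma lift_connected: "connected H"
proof -
  obtain q where q: "homeomorphism H {w. Im w < 0} p q" using lift by (auto simp: is_lift_def)
  have "connected (q ` {w. Im w < 0})"
    using q by (intro connected_continuous_image convex_connected convex_halfspace_Im_lt)
               (auto simp: homeomorphism_def)
  then show ?thesis using q by (simp add: homeomorphism_def)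
qed

text \<open>\<open>continuation\<close> is a choice and can be used only once some extension exists;
  this predicate records such witnesses, so that existence can be built up through products and
  primitives.\<close>

definition extends :: "(complex \<Rightarrow> complex) \<Rightarrow> ('a \<Rightarrow> complex) \<Rightarrow> bool" where
  "extends f F \<longleftrightarrow> holomorphic_on_cover U p F \<and> (\<forall>u\<in>H. F u = f (p u))"

lemma continuation_extends: "extends f F \<Longrightarrow> extends f (continuation U p H f)"
  unfolding extends_def continuation_def
  using someI[of "\<lambda>F. holomorphic_on_cover U p F \<and> (\<forall>u\<in>H. F u = f (p u))" F] by simp

lemma extends_compose: "f holomorphic_on - {0, 1} \<Longrightarrow> extends f (\<lambda>u. f (p u))"
  using holomorphic_on_cover_compose[OF covering_base] by (auto simp: extends_def)

lemma extends_mult: "extends f F \<Longrightarrow> extends g G \<Longrightarrow> extends (\<lambda>z. f z * g z) (\<lambda>u. F u * G u)"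
  by (auto simp: extends_def intro: holomorphic_on_cover_mult)

text \<open>On the lift, \<open>F\<close> and \<open>f (p u)\<close> have the same derivative. The
  lift is connected, so they differ there by a constant, and subtracting it yields the
  extension.\<close>

lemma extends_primitive:
  assumes G: "extends g G" and f: "\<And>z. Im z < 0 \<Longrightarrow> (f has_field_derivative g z) (at z)"
  shows "\<exists>F. extends f F"
proof -
  obtain F where F: "\<And>u. u \<in> U \<Longrightarrow> \<exists>W f r. openin (top_of_set U) W \<and> u \<in> W \<and> p ` W = ball (p u) r \<and>
    (\<forall>v\<in>W. F v = f (p v)) \<and> (\<forall>v\<in>W. (f has_field_derivative G v) (at (p v)))"
    using primitive_on_cover G unfolding extends_def by metis
  obtain u0 where u0: "u0 \<in> H" using lift_nonempty by blast
  have const: "F u - f (p u) = F u0 - f (p u0)" if u: "u \<in> H" for u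
  proof (rule connected_local_const[OF lift_connected u u0, of "\<lambda>u. F u - f (p u)"], intro ballI)
    fix a assume a: "a \<in> H"
    obtain W k r where W: "openin (top_of_set U) W" "a \<in> W"
      "\<forall>v\<in>W. F v = k (p v)" "\<forall>v\<in>W. (k has_field_derivative G v) (at (p v))"
      using F[of a] a lift_subset by (metis subsetD)
    have "openin (top_of_set U) (W \<inter> H)" "a \<in> W \<inter> H" using W lift_open a by auto
    then obtain T \<rho> q where T: "openin (top_of_set U) T" "a \<in> T" "T \<subseteq> W \<inter> H" "0 < \<rho>"
      "p ` T = ball (p a) \<rho>" "homeomorphism T (ball (p a) \<rho>) p q"
      using cover_chart[OF covering_base open_base] by metis
    have "((\<lambda>z. k z - f z) has_field_derivative 0) (at z within ball (p a) \<rho>)" if z: "z \<in> ball (p a) \<rho>" for z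
    proof -
      obtain y where y: "y \<in> T" "z = p y" using T(5) z by (metis imageE)
      then have yH: "y \<in> H" "y \<in> W" using T(3) by auto
      have "Im (p y) < 0" using yH(1) lift_image by blast
      moreover have "G y = g (p y)" using yH(1) G by (simp add: extends_def)
      ultimately have "(k has_field_derivative G y) (at z)" "(f has_field_derivative G y) (at z)"
        using W(4) yH(2) f[of z] y(2) by auto
      from DERIV_diff[OF this] show ?thesis by (simp add: has_field_derivative_at_within)
    qed
    then have "\<exists>c. \<forall>z\<in>ball (p a) \<rho>. k z - f z = c"
      by (intro has_field_derivative_zero_constant[OF convex_ball])
    then obtain c where c: "\<And>z. z \<in> ball (p a) \<rho> \<Longrightarrow> k z - f z = c" by auto
    have Fc: "F y - f (p y) = c" if "y \<in> T" for y
    proof -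
      have "p y \<in> ball (p a) \<rho>" using T(5) that by blast
      moreover have "F y = k (p y)" using W(3) T(3) that by auto
      ultimately show ?thesis using c by simp
    qed
    obtain T' where T': "open T'" "T = U \<inter> T'" using T(1) by (auto simp: openin_open)
    have "F a - f (p a) = F y - f (p y)" if "y \<in> T'" "y \<in> H" for y
    proof -
      have "y \<in> T" using that T' lift_subset by auto
      then show ?thesis using Fc[OF T(2)] Fc[of y] by simp
    qed
    then show "\<forall>\<^sub>F y in at a within H. F a - f (p a) = F y - f (p y)"
      unfolding eventually_at_topological using T' T(2) by (intro exI[of _ T']) simp
  qed
  have hF: "holomorphic_on_cover U p F"
    unfolding holomorphic_on_cover_def
  proof
    fix u assume "u \<in> U"
    then obtain W k r where W: "openin (top_of_set U) W" "u \<in> W" "p ` W = ball (p u) r"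
      "\<forall>v\<in>W. F v = k (p v)" "\<forall>v\<in>W. (k has_field_derivative G v) (at (p v))"
      using F by metis
    have "k field_differentiable at x within p ` W" if "x \<in> p ` W" for x
      using that W(5) by (auto simp: field_differentiable_def intro: has_field_derivative_at_within)
    then have "k holomorphic_on p ` W" by (simp add: holomorphic_on_def)
    then show "\<exists>V f. openin (top_of_set U) V \<and> u \<in> V \<and> f holomorphic_on p ` V \<and> (\<forall>v\<in>V. F v = f (p v))"
      using W by metis
  qed
  have "extends f (\<lambda>u. F u - (F u0 - f (p u0)))"
    unfolding extends_def
  proof (intro conjI ballI)
    show "holomorphic_on_cover U p (\<lambda>u. F u - (F u0 - f (p u0)))"
      by (intro holomorphic_on_cover_diff[OF hF] holomorphic_on_cover_const)
    fix u assume "u \<in> H"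
    show "F u - (F u0 - f (p u0)) = f (p u)" unfolding const[OF \<open>u \<in> H\<close>, symmetric] by simp
  qed
  then show ?thesis by blast
qed

end
end
end

section \<open>Coefficients and derivatives of the defining series\<close>

section \<open>Power series of multiple polylogarithms\<close>

text \<open>The coefficient of z^m, by recursion on the depth. The value 1 at \<open>m = 0\<close>
  for the empty index makes the inner sum equal to 1 at depth one, for every positive
  \<open>m\<close>.\<close>

fun mpl_coeff :: "nat list \<Rightarrow> nat \<Rightarrow> real" where
  "mpl_coeff [] m = (if m = 0 then 1 else 0)"
| "mpl_coeff (k # ks) m = (if m = 0 then 0 else (\<Sum>j<m. mpl_coeff ks j) / real m ^ k)"

lemma mpl_coeff_nonneg: "0 \<le> mpl_coeff ks m"
  by (induction ks arbitrary: m) (auto intro!: divide_nonneg_nonneg sum_nonneg)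

lemma mpl_coeff_le_1: "(\<forall>k\<in>set ks. 0 < k) \<Longrightarrow> mpl_coeff ks m \<le> 1"
proof (induction ks arbitrary: m)
  case (Cons k ks)
  show ?case
  proof (cases "m = 0")
    case False
    have "(\<Sum>j<m. mpl_coeff ks j) \<le> (\<Sum>j<m. 1)" using Cons by (intro sum_mono) simp
    also have "\<dots> \<le> real m ^ k" using False Cons.prems self_le_power[of "real m" k] by simp
    finally show ?thesis using False by (simp add: divide_le_eq)
  qed simp
qed simp

definition decreasing_lists :: "nat \<Rightarrow> nat list set" where
  "decreasing_lists r = {ms. length ms = r \<and> sorted_wrt (>) ms \<and> (\<forall>m\<in>set ms. 0 < m)}"

text \<open>The value 0 for the empty list matches the only exponent that occurs in
  \<open>mpl_coeff []\<close>.\<close>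

definition lead :: "nat list \<Rightarrow> nat" where "lead ms = (if ms = [] then 0 else hd ms)"

definition mpl_weight :: "nat list \<Rightarrow> nat list \<Rightarrow> real" where
  "mpl_weight ks ms = 1 / (\<Prod>i<length ks. real (ms ! i) ^ (ks ! i))"

lemma decreasing_lists_Suc:
  assumes "0 < m"
  shows "{ms \<in> decreasing_lists (Suc r). lead ms = m} = (\<Union>j<m. (#) m ` {ms \<in> decreasing_lists r. lead ms = j})"
proof (intro set_eqI iffI)
  fix ms assume "ms \<in> {ms \<in> decreasing_lists (Suc r). lead ms = m}"
  then obtain ms' where ms': "ms = m # ms'" "length ms' = r" "sorted_wrt (>) ms'" "\<forall>x\<in>set ms'. x < m" "\<forall>x\<in>set ms'. 0 < x"
    by (cases ms) (auto simp: decreasing_lists_def lead_def)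
  then have "lead ms' < m" using assms by (cases ms') (auto simp: lead_def)
  then show "ms \<in> (\<Union>j<m. (#) m ` {ms \<in> decreasing_lists r. lead ms = j})"
    using ms' by (auto simp: decreasing_lists_def)
next
  fix ms assume "ms \<in> (\<Union>j<m. (#) m ` {ms \<in> decreasing_lists r. lead ms = j})"
  then obtain ms' where ms': "ms = m # ms'" "ms' \<in> decreasing_lists r" "lead ms' < m" by auto
  then have "\<forall>x\<in>set ms'. x < m"
    by (cases ms') (auto simp: decreasing_lists_def lead_def)
  then show "ms \<in> {ms \<in> decreasing_lists (Suc r). lead ms = m}"
    using ms' assms by (auto simp: decreasing_lists_def lead_def)
qed

lemma decreasing_lists_Suc_0: "{ms \<in> decreasing_lists (Suc r). lead ms = 0} = {}"
  by (auto simp: decreasing_lists_def lead_def length_Suc_conv)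

lemma decreasing_lists_0: "{ms \<in> decreasing_lists 0. lead ms = m} = (if m = 0 then {[]} else {})"
  by (auto simp: decreasing_lists_def lead_def)

lemma finite_decreasing_lists: "finite {ms \<in> decreasing_lists r. lead ms = m}"
proof (induction r arbitrary: m)
  case (Suc r)
  then show ?case by (cases "m = 0") (auto simp: decreasing_lists_Suc_0 decreasing_lists_Suc)
qed (simp add: decreasing_lists_0)

lemma mpl_weight_Cons: "mpl_weight (k # ks) (m # ms) = mpl_weight ks ms / real m ^ k"
  by (simp add: mpl_weight_def prod.lessThan_Suc_shift del: prod.lessThan_Suc)

lemma mpl_coeff_eq_sum: "mpl_coeff ks m = (\<Sum>ms\<in>{ms \<in> decreasing_lists (length ks). lead ms = m}. mpl_weight ks ms)"
proof (induction ks arbitrary: m)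
  case Nil
  show ?case by (simp add: decreasing_lists_0 mpl_weight_def)
next
  case (Cons k ks)
  show ?case
  proof (cases "m = 0")
    case True then show ?thesis by (simp add: decreasing_lists_Suc_0)
  next
    case False
    let ?F = "\<lambda>j. {ms \<in> decreasing_lists (length ks). lead ms = j}"
    have re: "(\<Sum>ms\<in>(#) m ` ?F j. mpl_weight (k # ks) ms) = (\<Sum>ms\<in>?F j. mpl_weight ks ms / real m ^ k)" for j
      by (subst sum.reindex) (auto simp: mpl_weight_Cons)
    have "(\<Sum>ms\<in>{ms \<in> decreasing_lists (length (k # ks)). lead ms = m}. mpl_weight (k # ks) ms) =
        (\<Sum>ms\<in>(\<Union>j<m. (#) m ` ?F j). mpl_weight (k # ks) ms)"
      using False by (simp add: decreasing_lists_Suc)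
    also have "\<dots> = (\<Sum>j<m. \<Sum>ms\<in>(#) m ` ?F j. mpl_weight (k # ks) ms)"
      by (intro sum.UNION_disjoint) (auto simp: finite_decreasing_lists)
    also have "\<dots> = (\<Sum>j<m. \<Sum>ms\<in>?F j. mpl_weight ks ms / real m ^ k)"
      by (simp only: re)
    also have "\<dots> = (\<Sum>j<m. mpl_coeff ks j) / real m ^ k"
      by (simp add: Cons.IH sum_divide_distrib)
    finally show ?thesis using False by simp
  qed
qed

lemma norm_summable_mpl:
  assumes pos: "\<forall>k\<in>set ks. 0 < k" and z: "norm (z::complex) < 1"
  shows "summable (\<lambda>m. norm (of_real (mpl_coeff ks m) * z ^ m))"
proof (rule summable_comparison_test')
  show "summable (\<lambda>m::nat. norm z ^ m)" using z by (simp add: summable_geometric)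
  fix m :: nat
  show "norm (norm (of_real (mpl_coeff ks m) * z ^ m)) \<le> norm z ^ m"
    using mpl_coeff_nonneg[of ks m] mpl_coeff_le_1[OF pos, where m=m]
    by (simp add: norm_mult norm_power mult_left_le_one_le)
qed

text \<open>Grouping decreasing lists by their largest entry turns the unordered sum into a power
  series: each group is finite and sums to \<open>mpl_coeff ks m\<close> times z^m. Absolute
  convergence of the grouped family justifies the regrouping.\<close>

lemma Li_series_sums:
  assumes pos: "\<forall>k\<in>set ks. 0 < k" and z: "norm z < 1"
  shows "(\<lambda>m. of_real (mpl_coeff ks m) * z ^ m) sums Li_series ks z"
proof (cases "ks = []")
  case True
  have "(\<lambda>m. of_real (mpl_coeff [] m) * z ^ m) = (\<lambda>m. if m = 0 then 1 else 0)" by auto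
  then show ?thesis using True sums_If_finite_set[of "{0::nat}" "\<lambda>_. 1::complex"] by (simp add: Li_series_def)
next
  case False
  let ?A = "decreasing_lists (length ks)"
  define F where "F = (\<lambda>m. {ms \<in> ?A. lead ms = m})"
  define f where "f = (\<lambda>m ms. of_real (mpl_weight ks ms) * z ^ m)"
  have fin: "finite (F m)" for m unfolding F_def by (rule finite_decreasing_lists)
  have wn: "0 \<le> mpl_weight ks ms" for ms by (simp add: mpl_weight_def prod_nonneg)
  have inner: "(\<Sum>ms\<in>F m. norm (f m ms)) = norm (of_real (mpl_coeff ks m) * z ^ m)" for m
  proof -
    have "(\<Sum>ms\<in>F m. norm (f m ms)) = (\<Sum>ms\<in>F m. mpl_weight ks ms) * norm z ^ m"
      using wn by (simp add: f_def norm_mult norm_power sum_distrib_right)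
    also have "(\<Sum>ms\<in>F m. mpl_weight ks ms) = mpl_coeff ks m" by (simp add: F_def mpl_coeff_eq_sum)
    finally show ?thesis using mpl_coeff_nonneg[of ks m] by (simp add: norm_mult norm_power)
  qed
  have "(\<lambda>x. norm (case x of (m, ms) \<Rightarrow> f m ms)) summable_on Sigma UNIV F"
    unfolding Infinite_Sum.abs_summable_on_Sigma_iff
  proof (intro conjI ballI)
    show "(\<lambda>y. norm (case (m, y) of (m, ms) \<Rightarrow> f m ms)) summable_on F m" for m using fin by simp
    have "(\<lambda>m. norm (of_real (mpl_coeff ks m) * z ^ m)) summable_on UNIV"
      by (rule norm_summable_imp_summable_on) (use norm_summable_mpl[OF pos z] in simp)
    then show "(\<lambda>x. norm (infsum (\<lambda>y. norm (case (x, y) of (m, ms) \<Rightarrow> f m ms)) (F x))) summable_on UNIV"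
      using fin by (simp add: inner)
  qed
  then have summ: "(\<lambda>(m, ms). f m ms) summable_on Sigma UNIV F" by (rule abs_summable_summable)
  have "Li_series ks z = (\<Sum>\<^sub>\<infinity>ms\<in>?A. f (lead ms) ms)"
    unfolding Li_series_def decreasing_lists_def using False
    by (auto intro!: infsum_cong simp: lead_def f_def mpl_weight_def)
  also have "\<dots> = (\<Sum>\<^sub>\<infinity>ms\<in>?A. (\<lambda>(m, ms). f m ms) ((\<lambda>ms. (lead ms, ms)) ms))" by simp
  also have "\<dots> = infsum (\<lambda>(m, ms). f m ms) (Sigma UNIV F)"
    by (rule infsum_reindex_bij_betw) (auto simp: bij_betw_def inj_on_def F_def image_def)
  also have "\<dots> = (\<Sum>\<^sub>\<infinity>m. \<Sum>\<^sub>\<infinity>ms\<in>F m. f m ms)"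
    using infsum_Sigma'_banach[OF summ] by simp
  also have "\<dots> = (\<Sum>\<^sub>\<infinity>m. of_real (mpl_coeff ks m) * z ^ m)"
  proof (rule infsum_cong)
    fix m
    show "(\<Sum>\<^sub>\<infinity>ms\<in>F m. f m ms) = of_real (mpl_coeff ks m) * z ^ m"
      using fin by (simp add: f_def mpl_coeff_eq_sum F_def sum_distrib_right)
  qed
  also have "\<dots> = (\<Sum>m. of_real (mpl_coeff ks m) * z ^ m)"
    by (intro infsumI norm_summable_imp_has_sum norm_summable_mpl[OF pos z]
        summable_sums[OF summable_norm_cancel[OF norm_summable_mpl[OF pos z]]])
  finally show ?thesis
    using summable_sums[OF summable_norm_cancel[OF norm_summable_mpl[OF pos z]]] by simp
qed

lemma Li_series_0: "ks \<noteq> [] \<Longrightarrow> (\<forall>k\<in>set ks. 0 < k) \<Longrightarrow> Li_series ks 0 = 0"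
proof -
  assume a: "ks \<noteq> []" "\<forall>k\<in>set ks. 0 < k"
  have "(\<lambda>m. of_real (mpl_coeff ks m) * (0::complex) ^ m) = (\<lambda>m. 0)"
    using a(1) by (cases ks) (auto simp: power_0_left)
  then have "(\<lambda>_. 0) sums Li_series ks 0" using Li_series_sums[where ks = ks and z = 0] a(2) by simp
  then show ?thesis using sums_unique2[OF _ sums_zero] by blast
qed

lemma Li_series_Nil: "Li_series [] z = 1" by (simp add: Li_series_def)

lemma Li_series_deriv:
  assumes pos: "\<forall>k\<in>set ks. 0 < k" and z: "norm z < 1"
  obtains d where "(Li_series ks has_field_derivative d) (at z)"
    "(\<lambda>n. of_real (real (Suc n) * mpl_coeff ks (Suc n)) * z ^ n) sums d"
proof -
  obtain r where r: "norm z < r" "r < 1" using z dense by blast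
  have r0: "0 < r" using r(1) norm_ge_zero[of z] by linarith
  let ?c = "\<lambda>m. of_real (mpl_coeff ks m) :: complex"
  have s: "summable (\<lambda>m. ?c m * of_real r ^ m)"
    using summable_norm_cancel[OF norm_summable_mpl[OF pos, of "of_real r"]] r r0 by simp
  have "((\<lambda>z. \<Sum>m. ?c m * z ^ m) has_field_derivative (\<Sum>n. diffs ?c n * z ^ n)) (at z)"
    by (rule termdiffs_strong[OF s]) (use r r0 in simp)
  then have 1: "(Li_series ks has_field_derivative (\<Sum>n. diffs ?c n * z ^ n)) (at z)"
  proof (rule has_field_derivative_transform_within[where d = "1 - norm z"])
    show "0 < 1 - norm z" using z by simp
    fix x assume "dist x z < 1 - norm z"
    then have "norm x < 1" using norm_triangle_ineq[of "x - z" z] by (simp add: dist_norm)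
    from sums_unique[OF Li_series_sums[OF pos this]] show "(\<Sum>m. ?c m * x ^ m) = Li_series ks x" by simp
  qed simp
  have "summable (\<lambda>n. diffs ?c n * z ^ n)"
    by (rule termdiff_converges[where K = r])
       (use r r0 in \<open>auto intro!: summable_norm_cancel[OF norm_summable_mpl[OF pos]]\<close>)
  then have "(\<lambda>n. diffs ?c n * z ^ n) sums (\<Sum>n. diffs ?c n * z ^ n)" by (rule summable_sums)
  moreover have "diffs ?c n = of_real (real (Suc n) * mpl_coeff ks (Suc n))" for n
    unfolding diffs_def by (simp only: of_real_mult of_real_of_nat_eq)
  ultimately show ?thesis using that[OF 1] by simp
qed

text \<open>The factor \<open>z\<close> stays on the left so that the relation also holds at 0 and
  can be continued analytically from the whole disc.\<close>

lemma Li_series_deriv_ge2: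
  assumes "\<forall>k\<in>set ks. 0 < k" and "0 < k" and z: "norm z < 1"
  obtains d where "(Li_series (Suc k # ks) has_field_derivative d) (at z)" "z * d = Li_series (k # ks) z"
proof -
  obtain d where d: "(Li_series (Suc k # ks) has_field_derivative d) (at z)"
    "(\<lambda>n. of_real (real (Suc n) * mpl_coeff (Suc k # ks) (Suc n)) * z ^ n) sums d"
    using Li_series_deriv[where ks = "Suc k # ks" and z = z] assms by auto
  have e: "real (Suc n) * mpl_coeff (Suc k # ks) (Suc n) = mpl_coeff (k # ks) (Suc n)" for n by simp
  have "(\<lambda>n. z * (of_real (mpl_coeff (k # ks) (Suc n)) * z ^ n)) sums (z * d)"
    using sums_mult[OF d(2)] unfolding e .
  then have "(\<lambda>n. of_real (mpl_coeff (k # ks) (Suc n)) * z ^ Suc n) sums (z * d)"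
    by (simp only: power_Suc mult.left_commute mult.assoc)
  then have "(\<lambda>n. of_real (mpl_coeff (k # ks) n) * z ^ n) sums (z * d)"
    by (subst (asm) sums_Suc_iff) simp
  moreover have "(\<lambda>n. of_real (mpl_coeff (k # ks) n) * z ^ n) sums Li_series (k # ks) z"
    using assms by (intro Li_series_sums) auto
  ultimately show ?thesis using that[OF d(1)] sums_unique2 by blast
qed

text \<open>Differentiation cancels the outer denominator; the partial sums that remain are the
  coefficients of the Cauchy product with the geometric series.\<close>

lemma Li_series_deriv_1:
  assumes pos: "\<forall>k\<in>set ks. 0 < k" and z: "norm z < 1"
  obtains d where "(Li_series (1 # ks) has_field_derivative d) (at z)" "(1 - z) * d = Li_series ks z"
proof -
  obtain d where d: "(Li_series (1 # ks) has_field_derivative d) (at z)"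
    "(\<lambda>n. of_real (real (Suc n) * mpl_coeff (1 # ks) (Suc n)) * z ^ n) sums d"
    using Li_series_deriv[where ks = "1 # ks" and z = z] assms by auto
  have e: "real (Suc n) * mpl_coeff (1 # ks) (Suc n) = (\<Sum>j\<le>n. mpl_coeff ks j)" for n
    by (simp add: lessThan_Suc_atMost)
  let ?a = "\<lambda>n. of_real (mpl_coeff ks n) * z ^ n"
  have "(\<lambda>n. \<Sum>i\<le>n. ?a i * z ^ (n - i)) sums ((\<Sum>n. ?a n) * (\<Sum>n. z ^ n))"
    using norm_summable_mpl[OF pos z] z by (intro Cauchy_product_sums) (auto simp: norm_power)
  moreover have "(\<Sum>i\<le>n. ?a i * z ^ (n - i)) = of_real (\<Sum>j\<le>n. mpl_coeff ks j) * z ^ n" for n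
    by (simp add: sum_distrib_right mult.assoc flip: power_add)
  ultimately have "d = (\<Sum>n. ?a n) * (\<Sum>n. z ^ n)"
    using sums_unique2[OF d(2)] unfolding e by simp
  also have "\<dots> = Li_series ks z * (1 / (1 - z))"
    using sums_unique[OF Li_series_sums[OF pos z]] suminf_geometric[OF z] by simp
  finally have "(1 - z) * d = Li_series ks z" using z by auto
  then show ?thesis using that[OF d(1)] by blast
qed

section \<open>Analytic continuation to the plane cut along [1, infinity)\<close>

section \<open>Principal branches on the slit plane\<close>

definition slit :: "complex set" where "slit = - (complex_of_real ` {1..})"

lemma slit_iff: "z \<in> slit \<longleftrightarrow> Im z \<noteq> 0 \<or> Re z < 1"
  by (auto simp: slit_def image_iff complex_eq_iff not_le)

lemma slit_open: "open slit"
  unfolding slit_def by (intro open_Compl closed_injective_linear_image closed_real_atLeast bounded_linear.linear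
      bounded_linear_of_real inj_of_real)

lemma slit_segment:
  assumes "z \<in> slit" shows "closed_segment 0 z \<subseteq> slit"
proof
  fix w assume "w \<in> closed_segment 0 z"
  then obtain u where u: "0 \<le> u" "u \<le> 1" "w = of_real u * z" by (auto simp: closed_segment_def scaleR_conv_of_real)
  show "w \<in> slit"
  proof (cases "Im z = 0")
    case True
    then have "Re z < 1" using assms by (simp add: slit_iff)
    moreover have "u * Re z \<le> max 0 (Re z)" using u by (cases "0 \<le> Re z") (auto simp: mult_left_le_one_le mult_nonneg_nonpos)
    ultimately have "u * Re z < 1" using \<open>Re z < 1\<close> by linarith
    then show ?thesis using u by (simp add: slit_iff)
  next
    case False then show ?thesis using u by (cases "u = 0") (auto simp: slit_iff)
  qed
qed

lemma slit_0: "0 \<in> slit" by (simp add: slit_iff)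

lemma slit_starlike: "starlike slit"
  unfolding starlike_def using slit_segment slit_0 by blast

lemma slit_connected: "connected slit"
  using slit_starlike starlike_imp_connected by blast

lemma ball_slit: "ball 0 1 \<subseteq> slit"
proof
  fix z :: complex assume "z \<in> ball 0 1"
  then have "Re z < 1" using complex_Re_le_cmod[of z] by simp
  then show "z \<in> slit" by (simp add: slit_iff)
qed

text \<open>The derivatives are compared away from 0 only, as the formulas divide by
  \<open>z\<close>; continuity at the one exceptional point is enough.\<close>

lemma slit_eqI:
  assumes f: "\<And>z. z \<in> slit \<Longrightarrow> (f has_field_derivative f' z) (at z)"
    and g: "\<And>z. z \<in> slit \<Longrightarrow> (g has_field_derivative g' z) (at z)"
    and eq: "\<And>z. z \<in> slit \<Longrightarrow> z \<noteq> 0 \<Longrightarrow> f' z = g' z" and 0: "f 0 = g 0" and z: "z \<in> slit"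
  shows "f z = g z"
proof -
  have d: "((\<lambda>z. f z - g z) has_field_derivative (f' z - g' z)) (at z)" if "z \<in> slit" for z
    using DERIV_diff[OF f[OF that] g[OF that]] .
  obtain c where c: "\<And>x. x \<in> slit \<Longrightarrow> f x - g x = c"
  proof (rule DERIV_zero_connected_constant[OF slit_connected slit_open, of "{0}" "\<lambda>z. f z - g z"])
    show "continuous_on slit (\<lambda>z. f z - g z)"
      using d by (meson DERIV_isCont continuous_at_imp_continuous_on)
    show "\<forall>x\<in>slit - {0}. ((\<lambda>z. f z - g z) has_field_derivative 0) (at x)"
      using d eq by (metis DiffE eq_iff_diff_eq_0 insertCI)
  qed auto
  have "f z - g z = f 0 - g 0" using c[OF z] c[OF slit_0] by simp
  then show ?thesis using 0 by simp
qed

definition is_principal :: "nat list \<Rightarrow> (complex \<Rightarrow> complex) \<Rightarrow> bool" where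
  "is_principal ks f \<longleftrightarrow> f holomorphic_on slit \<and> (\<forall>z\<in>ball 0 1. f z = Li_series ks z)"

lemma is_principal_primitive:
  assumes h: "h holomorphic_on slit"
    and d: "\<And>z. norm z < 1 \<Longrightarrow> z \<noteq> 0 \<Longrightarrow> (Li_series ks has_field_derivative h z) (at z)"
    and ks: "ks \<noteq> []" "\<forall>k\<in>set ks. 0 < k"
  shows "\<exists>f. is_principal ks f"
proof -
  obtain g where g: "\<And>x. x \<in> slit \<Longrightarrow> (g has_field_derivative h x) (at x)"
    using holomorphic_starlike_primitive[OF holomorphic_on_imp_continuous_on[OF h] slit_starlike slit_open finite.emptyI]
      holomorphic_on_imp_differentiable_at[OF h slit_open] by auto
  define f where "f = (\<lambda>z. g z - g 0)"
  have f: "(f has_field_derivative h x) (at x)" if "x \<in> slit" for x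
    using DERIV_diff[OF g[OF that] DERIV_const] by (simp add: f_def)
  have "f holomorphic_on slit"
    using f slit_open by (auto simp: holomorphic_on_open)
  moreover have "f z = Li_series ks z" if z: "z \<in> ball 0 1" for z
  proof -
    have cont: "isCont (Li_series ks) x" if "norm x < 1" for x
      by (rule Li_series_deriv[where ks = ks and z = x]) (use ks that DERIV_isCont in auto)
    obtain c where c: "\<And>x. x \<in> ball 0 1 \<Longrightarrow> f x - Li_series ks x = c"
    proof (rule DERIV_zero_connected_constant[of "ball 0 1" "{0}" "\<lambda>z. f z - Li_series ks z"])
      have "continuous_on (ball 0 1) (Li_series ks)" using cont by (auto intro!: continuous_at_imp_continuous_on)
      moreover have "continuous_on (ball 0 1) f"
        using f ball_slit by (meson DERIV_isCont continuous_at_imp_continuous_on subsetD)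
      ultimately show "continuous_on (ball 0 1) (\<lambda>z. f z - Li_series ks z)" by (intro continuous_on_diff)
      show "\<forall>x\<in>ball 0 1 - {0}. ((\<lambda>z. f z - Li_series ks z) has_field_derivative 0) (at x)"
      proof
        fix x :: complex assume x: "x \<in> ball 0 1 - {0}"
        then have "x \<in> slit" using ball_slit by blast
        from DERIV_diff[OF f[OF this] d[of x]] x
        show "((\<lambda>z. f z - Li_series ks z) has_field_derivative 0) (at x)" by simp
      qed
    qed auto
    have "f z - Li_series ks z = f 0 - Li_series ks 0" using c[OF z] c[of 0] by simp
    then show ?thesis using Li_series_0[OF ks] by (simp add: f_def)
  qed
  ultimately show ?thesis unfolding is_principal_def by blast
qed

text \<open>Induction on the weight: the series is a primitive of a branch of smaller weight,
  divided by 1 - z if a leading 1 is removed and by z if the leading entry is lowered.\<close>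

lemma is_principal_exists: "(\<forall>k\<in>set ks. 0 < k) \<Longrightarrow> \<exists>f. is_principal ks f"
proof (induction "sum_list ks" arbitrary: ks rule: less_induct)
  case less
  show ?case
  proof (cases ks)
    case Nil
    then show ?thesis by (intro exI[of _ "\<lambda>_. 1"]) (simp add: is_principal_def Li_series_Nil)
  next
    case (Cons k ks')
    show ?thesis
    proof (cases "k = 1")
      case True
      have p': "\<forall>k\<in>set ks'. 0 < k" using less.prems Cons by simp
      then obtain g where g: "g holomorphic_on slit" "\<And>z. z \<in> ball 0 1 \<Longrightarrow> g z = Li_series ks' z"
        using less.hyps[of ks'] Cons True unfolding is_principal_def by auto
      show ?thesis
      proof (rule is_principal_primitive[where h = "\<lambda>z. g z / (1 - z)"])
        show "(\<lambda>z. g z / (1 - z)) holomorphic_on slit"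
          by (intro holomorphic_intros g) (auto simp: slit_iff)
        fix z :: complex assume z: "norm z < 1"
        obtain d where d: "(Li_series (1 # ks') has_field_derivative d) (at z)" "(1 - z) * d = Li_series ks' z"
          using Li_series_deriv_1[OF p' z] by metis
        have "1 - z \<noteq> 0" using z by auto
        then have "d = g z / (1 - z)" using d(2) g(2)[of z] z by (simp add: field_simps)
        then show "(Li_series ks has_field_derivative g z / (1 - z)) (at z)" using d(1) Cons True by simp
      qed (use Cons less.prems in auto)
    next
      case False
      then obtain j where j: "k = Suc j" "0 < j" using less.prems Cons by (cases k) auto
      have p': "\<forall>k\<in>set ks'. 0 < k" using less.prems Cons by simp
      obtain g where g: "g holomorphic_on slit" "\<And>z. z \<in> ball 0 1 \<Longrightarrow> g z = Li_series (j # ks') z"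
        using less.hyps[of "j # ks'"] Cons j p' unfolding is_principal_def by auto
      have g0: "g 0 = 0" using g(2)[of 0] Li_series_0[of "j # ks'"] p' j by auto
      \<comment> \<open>As \<open>g\<close> vanishes at 0, the quotient g(z)/z has a removable
        singularity there, filled in by \<open>deriv g 0\<close>.\<close>
      show ?thesis
      proof (rule is_principal_primitive[where h = "\<lambda>z. if z = 0 then deriv g 0 else (g z - g 0) / (z - 0)"])
        show "(\<lambda>z. if z = 0 then deriv g 0 else (g z - g 0) / (z - 0)) holomorphic_on slit"
          by (rule pole_lemma_open[OF g(1) slit_open])
        fix z :: complex assume z: "norm z < 1" "z \<noteq> 0"
        obtain d where d: "(Li_series (Suc j # ks') has_field_derivative d) (at z)" "z * d = Li_series (j # ks') z"
          using Li_series_deriv_ge2[OF p' j(2) z(1)] by metis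
        have "d = g z / z" using d(2) g(2)[of z] z by (simp add: field_simps)
        then show "(Li_series ks has_field_derivative (if z = 0 then deriv g 0 else (g z - g 0) / (z - 0))) (at z)"
          using d(1) Cons j z g0 by simp
      qed (use Cons less.prems in auto)
    qed
  qed
qed

lemma Li_principal:
  assumes "\<forall>k\<in>set ks. 0 < k"
  shows Li_principal_holomorphic: "Li_principal ks holomorphic_on slit"
    and Li_principal_ball: "norm z < 1 \<Longrightarrow> Li_principal ks z = Li_series ks z"
proof -
  have "is_principal ks (Li_principal ks)"
    using someI_ex[OF is_principal_exists[OF assms]] unfolding Li_principal_def is_principal_def slit_def by simp
  then show "Li_principal ks holomorphic_on slit" "norm z < 1 \<Longrightarrow> Li_principal ks z = Li_series ks z"
    by (auto simp: is_principal_def)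
qed

lemma Li_principal_0: "ks \<noteq> [] \<Longrightarrow> (\<forall>k\<in>set ks. 0 < k) \<Longrightarrow> Li_principal ks 0 = 0"
  using Li_principal_ball[where ks = ks and z = 0] Li_series_0[of ks] by simp

lemma slit_continuation:
  assumes "f holomorphic_on slit" "g holomorphic_on slit" "\<And>z. norm z < 1 \<Longrightarrow> f z = g z" "z \<in> slit"
  shows "f z = g z"
  by (rule analytic_continuation_open[of "ball 0 1" slit f g])
     (use assms slit_open slit_connected ball_slit in auto)

lemma Li_principal_Nil: "z \<in> slit \<Longrightarrow> Li_principal [] z = 1"
  by (rule slit_continuation[where g = "\<lambda>_. 1"]) (simp_all add: Li_principal_holomorphic Li_principal_ball Li_series_Nil)

lemma Li_principal_deriv_ge2:
  assumes pos: "\<forall>k\<in>set ks. 0 < k" "0 < k" and z: "z \<in> slit" "z \<noteq> 0"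
  shows "(Li_principal (Suc k # ks) has_field_derivative Li_principal (k # ks) z / z) (at z)"
proof -
  have h: "Li_principal (Suc k # ks) holomorphic_on slit" "Li_principal (k # ks) holomorphic_on slit"
    using pos by (auto intro!: Li_principal_holomorphic)
  have "z * deriv (Li_principal (Suc k # ks)) z = Li_principal (k # ks) z"
  proof (rule slit_continuation[OF _ h(2) _ z(1)])
    show "(\<lambda>z. z * deriv (Li_principal (Suc k # ks)) z) holomorphic_on slit"
      by (intro holomorphic_intros holomorphic_deriv[OF h(1) slit_open])
    fix w :: complex assume w: "norm w < 1"
    obtain d where d: "(Li_series (Suc k # ks) has_field_derivative d) (at w)" "w * d = Li_series (k # ks) w"
      using Li_series_deriv_ge2[OF pos w] by metis
    have "(Li_principal (Suc k # ks) has_field_derivative d) (at w)"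
      by (rule has_field_derivative_transform_within_open[OF d(1) open_ball[of 0 1]])
         (use w pos in \<open>auto intro!: Li_principal_ball[symmetric]\<close>)
    then have "deriv (Li_principal (Suc k # ks)) w = d" by (rule DERIV_imp_deriv)
    then show "w * deriv (Li_principal (Suc k # ks)) w = Li_principal (k # ks) w"
      using d(2) Li_principal_ball[where ks = "k # ks" and z = w] w pos by auto
  qed
  then have "deriv (Li_principal (Suc k # ks)) z = Li_principal (k # ks) z / z" using z(2) by (simp add: field_simps)
  then show ?thesis using holomorphic_derivI[OF h(1) slit_open z(1)] by simp
qed

lemma Li_principal_deriv_1:
  assumes pos: "\<forall>k\<in>set ks. 0 < k" and z: "z \<in> slit"
  shows "(Li_principal (1 # ks) has_field_derivative Li_principal ks z / (1 - z)) (at z)"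
proof -
  have h: "Li_principal (1 # ks) holomorphic_on slit" "Li_principal ks holomorphic_on slit"
    using pos by (auto intro!: Li_principal_holomorphic)
  have "(1 - z) * deriv (Li_principal (1 # ks)) z = Li_principal ks z"
  proof (rule slit_continuation[OF _ h(2) _ z(1)])
    show "(\<lambda>z. (1 - z) * deriv (Li_principal (1 # ks)) z) holomorphic_on slit"
      by (intro holomorphic_intros holomorphic_deriv[OF h(1) slit_open])
    fix w :: complex assume w: "norm w < 1"
    obtain d where d: "(Li_series (1 # ks) has_field_derivative d) (at w)" "(1 - w) * d = Li_series ks w"
      using Li_series_deriv_1[OF pos w] by metis
    have "(Li_principal (1 # ks) has_field_derivative d) (at w)"
      by (rule has_field_derivative_transform_within_open[OF d(1) open_ball[of 0 1]])
         (use w pos in \<open>auto intro!: Li_principal_ball[symmetric]\<close>)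
    then have "deriv (Li_principal (1 # ks)) w = d" by (rule DERIV_imp_deriv)
    then show "(1 - w) * deriv (Li_principal (1 # ks)) w = Li_principal ks w"
      using d(2) Li_principal_ball[where ks = ks and z = w] w pos by auto
  qed
  moreover have "1 - z \<noteq> 0" using z by (auto simp: slit_iff)
  ultimately have "deriv (Li_principal (1 # ks)) z = Li_principal ks z / (1 - z)" by (simp add: field_simps)
  then show ?thesis using holomorphic_derivI[OF h(1) slit_open z] by simp
qed

lemma Li_1_deriv:
  assumes "z \<in> slit"
  shows "((\<lambda>z. (- Ln (1 - z)) ^ n / fact n) has_field_derivative
     (if n = 0 then 0 else (- Ln (1 - z)) ^ (n - 1) / fact (n - 1) / (1 - z))) (at z)"
proof -
  have "1 - z \<notin> \<real>\<^sub>\<le>\<^sub>0" using assms by (auto simp: slit_iff complex_nonpos_Reals_iff)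
  then have D: "((\<lambda>z. - Ln (1 - z)) has_field_derivative 1 / (1 - z)) (at z)"
    by (auto intro!: derivative_eq_intros simp: divide_inverse)
  show ?thesis
  proof (cases n)
    case (Suc k)
    have "((\<lambda>z. (- Ln (1 - z)) ^ Suc k / fact (Suc k)) has_field_derivative
        of_nat (Suc k) * (1 / (1 - z) * (- Ln (1 - z)) ^ k) / fact (Suc k)) (at z)"
      using DERIV_cdivide[OF DERIV_power[OF D, of "Suc k"], of "fact (Suc k)"] by (simp add: mult.assoc)
    also have "of_nat (Suc k) * (1 / (1 - z) * (- Ln (1 - z)) ^ k) / fact (Suc k) = (- Ln (1 - z)) ^ k / fact k / (1 - z)"
      unfolding fact_Suc by (subst nonzero_mult_divide_mult_cancel_left) (simp_all del: of_nat_Suc)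
    finally show ?thesis using Suc by simp
  qed simp
qed

text \<open>For positive \<open>n\<close> both sides vanish at 0, and both satisfy the recursion
  f_n' = f_(n-1)/(1 - z).\<close>

lemma Li_principal_ones:
  assumes "z \<in> slit"
  shows "Li_principal (replicate n 1) z = (- Ln (1 - z)) ^ n / fact n"
  using assms
proof (induction n arbitrary: z)
  case 0 then show ?case by (simp add: Li_principal_Nil)
next
  case (Suc n)
  show ?case
  proof (rule slit_eqI[OF _ Li_1_deriv _ _ Suc.prems])
    show "(Li_principal (replicate (Suc n) 1) has_field_derivative Li_principal (replicate n 1) z / (1 - z)) (at z)"
      if "z \<in> slit" for z using Li_principal_deriv_1[of "replicate n 1" z] that by simp
    show "Li_principal (replicate (Suc n) 1) 0 = (- Ln (1 - 0)) ^ Suc n / fact (Suc n)"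
      using Li_principal_0[of "replicate (Suc n) 1"] by simp
  qed (use Suc.IH in simp_all)
qed

section \<open>Words ending in Y and their index lists\<close>

section \<open>Words and compositions\<close>

definition comps :: "nat \<Rightarrow> nat \<Rightarrow> nat list set" where
  "comps k n = {ks. length ks = n \<and> sum_list ks = k \<and> (\<forall>x\<in>set ks. 0 < x)}"

lemma comps_pos: "ks \<in> comps k n \<Longrightarrow> \<forall>x\<in>set ks. 0 < x"
  by (simp add: comps_def)

lemma finite_comps: "finite (comps k n)"
  by (rule finite_subset[OF _ finite_lists_length_eq[of "{..k}" n]])
     (use member_le_sum_list in \<open>fastforce simp: comps_def\<close>)+

lemma word_of_index_Nil: "word_of_index [] = []"
  by (simp add: word_of_index_def)

lemma word_of_index_Cons: "word_of_index (k # ks) = replicate (k - 1) X @ Y # word_of_index ks"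
  by (simp add: word_of_index_def)

lemma word_of_index_eq_Nil_iff: "word_of_index ks = [] \<longleftrightarrow> ks = []"
  by (cases ks) (auto simp: word_of_index_Nil word_of_index_Cons)

lemma length_word_of_index: "\<forall>k\<in>set ks. 0 < k \<Longrightarrow> length (word_of_index ks) = sum_list ks"
  by (induction ks) (auto simp: word_of_index_Nil word_of_index_Cons)

lemma word_depth_word_of_index: "word_depth (word_of_index ks) = length ks"
proof -
  have "count_list (replicate a X) Y = 0" for a by (induction a) auto
  then show ?thesis
    by (induction ks) (auto simp: word_of_index_Nil word_of_index_Cons word_depth_def)
qed

lemma last_word_of_index: "ks \<noteq> [] \<Longrightarrow> last (word_of_index ks) = Y"
  by (induction ks) (auto simp: word_of_index_Nil word_of_index_Cons word_of_index_eq_Nil_iff)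

lemma replicate_X_Y_eqD: "replicate a X @ Y # u = replicate b X @ Y # v \<Longrightarrow> a = b \<and> u = v"
proof (induction a arbitrary: b)
  case 0 then show ?case by (cases b) auto
next
  case (Suc a) then show ?case by (cases b) auto
qed

lemma word_of_index_inject:
  "\<lbrakk>\<forall>k\<in>set ks. 0 < k; \<forall>k\<in>set js. 0 < k; word_of_index ks = word_of_index js\<rbrakk> \<Longrightarrow> ks = js"
proof (induction ks arbitrary: js)
  case Nil then show ?case using word_of_index_eq_Nil_iff[of js] by (simp add: word_of_index_Nil)
next
  case (Cons k ks)
  then obtain j js' where js: "js = j # js'" using word_of_index_eq_Nil_iff[of "k # ks"]
    by (cases js) (auto simp: word_of_index_Nil)
  then have "k - 1 = j - 1 \<and> word_of_index ks = word_of_index js'"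
    using replicate_X_Y_eqD Cons.prems(3) unfolding js word_of_index_Cons by blast
  then have "k - 1 = j - 1" "ks = js'" using Cons js by auto
  then show ?case using Cons.prems js by (simp add: js) linarith
qed

lemma word_of_index_surj: "w = [] \<or> last w = Y \<Longrightarrow> \<exists>ks. (\<forall>k\<in>set ks. 0 < k) \<and> word_of_index ks = w"
proof (induction w)
  case Nil then show ?case by (intro exI[of _ "[]"]) (simp add: word_of_index_Nil)
next
  case (Cons a w)
  then have "w = [] \<or> last w = Y" by (auto split: if_splits)
  then obtain ks where ks: "\<forall>k\<in>set ks. 0 < k" "word_of_index ks = w" using Cons.IH by blast
  show ?case
  proof (cases a)
    case Y
    then show ?thesis using ks by (intro exI[of _ "1 # ks"]) (simp add: word_of_index_Cons)
  next
    case X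
    then have "w \<noteq> []" using Cons.prems by auto
    then obtain k ks' where "ks = k # ks'" using ks(2) by (cases ks) (auto simp: word_of_index_Nil)
    then show ?thesis using ks X
      by (intro exI[of _ "Suc k # ks'"]) (cases k, auto simp: word_of_index_Cons)
  qed
qed

lemma index_of_word_of_index: "\<forall>k\<in>set ks. 0 < k \<Longrightarrow> index_of_word (word_of_index ks) = ks"
  unfolding index_of_word_def by (rule the_equality) (auto dest: word_of_index_inject)

text \<open>Words of fixed length and depth that end in \<open>Y\<close> are the images of
  compositions. The height only splits this finite set into classes, and it is at least 1, so
  summing over all heights restores the set.\<close>

lemma sum_G1:
  assumes n: "0 < n"
  shows "(\<Sum>\<^sub>\<infinity>s\<in>{1..}. G1 U p H k n s u) = (\<Sum>ks\<in>comps k n. Li U p H ks u)"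
proof -
  define W where "W = {w. w \<noteq> [] \<and> last w = Y \<and> length w = k \<and> word_depth w = n}"
  have im: "word_of_index ` comps k n = W"
  proof (intro set_eqI iffI)
    fix w assume "w \<in> word_of_index ` comps k n"
    then show "w \<in> W" using n
      by (auto simp: W_def comps_def length_word_of_index word_depth_word_of_index last_word_of_index word_of_index_eq_Nil_iff)
  next
    fix w assume w: "w \<in> W"
    then obtain ks where "\<forall>k\<in>set ks. 0 < k" "word_of_index ks = w"
      using word_of_index_surj[of w] by (auto simp: W_def)
    then show "w \<in> word_of_index ` comps k n" using w length_word_of_index[of ks] word_depth_word_of_index[of ks]
      by (auto simp: W_def comps_def)
  qed
  have inj: "inj_on word_of_index (comps k n)"
    by (rule inj_onI) (auto simp: comps_def intro: word_of_index_inject)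
  have fin: "finite W" using im finite_comps by (metis finite_imageI)
  let ?f = "\<lambda>w. Li U p H (index_of_word w) u"
  have G1: "G1 U p H k n s u = (\<Sum>w\<in>{w\<in>W. word_height w = s}. ?f w)" for s
    unfolding G1_def W_def by (intro sum.cong) auto
  have "(\<Sum>\<^sub>\<infinity>s\<in>{1..}. G1 U p H k n s u) = (\<Sum>\<^sub>\<infinity>s\<in>word_height ` W. G1 U p H k n s u)"
  proof (rule infsum_cong_neutral)
    fix s assume "s \<in> {1..} - word_height ` W"
    then have "{w\<in>W. word_height w = s} = {}" by blast
    then show "G1 U p H k n s u = 0" by (simp only: G1 sum.empty)
  qed (auto simp: word_height_def)
  also have "\<dots> = (\<Sum>s\<in>word_height ` W. \<Sum>w\<in>{w\<in>W. word_height w = s}. ?f w)"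
    using fin by (simp add: G1)
  also have "\<dots> = (\<Sum>w\<in>W. ?f w)" by (rule sum.group) (use fin in auto)
  also have "\<dots> = (\<Sum>ks\<in>comps k n. ?f (word_of_index ks))"
    unfolding im[symmetric] using sum.reindex[OF inj] by simp
  also have "\<dots> = (\<Sum>ks\<in>comps k n. Li U p H ks u)"
    by (intro sum.cong refl) (simp add: index_of_word_of_index comps_pos)
  finally show ?thesis .
qed

section \<open>Full sums of polylogarithms through indices (q+1, 1, ..., 1) and logarithms\<close>

section \<open>Sums over all indices of given weight and depth\<close>

text \<open>The first entry is either 1, and is removed, or larger, and is lowered by 1. These are
  the two cases of the derivative of a polylogarithm.\<close>

lemma comps_Suc_Suc:
  "comps (Suc e + Suc N) (Suc N) =
     (#) 1 ` comps (Suc e + N) N \<union> (\<lambda>ks. Suc (hd ks) # tl ks) ` comps (e + Suc N) (Suc N)"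
proof (intro set_eqI iffI)
  fix ks assume "ks \<in> comps (Suc e + Suc N) (Suc N)"
  then obtain k ks' where ks: "ks = k # ks'" "length ks' = N" "k + sum_list ks' = Suc e + Suc N" "0 < k" "\<forall>x\<in>set ks'. 0 < x"
    by (cases ks) (auto simp: comps_def)
  show "ks \<in> (#) 1 ` comps (Suc e + N) N \<union> (\<lambda>ks. Suc (hd ks) # tl ks) ` comps (e + Suc N) (Suc N)"
  proof (cases "k = 1")
    case True
    then have "ks' \<in> comps (Suc e + N) N" using ks by (simp add: comps_def)
    then show ?thesis using ks True by blast
  next
    case False
    then obtain j where j: "k = Suc j" "0 < j" using ks(4) by (cases k) auto
    then have "j # ks' \<in> comps (e + Suc N) (Suc N)" using ks by (simp add: comps_def)
    then have "(\<lambda>ks. Suc (hd ks) # tl ks) (j # ks') \<in> (\<lambda>ks. Suc (hd ks) # tl ks) ` comps (e + Suc N) (Suc N)"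
      by (rule imageI)
    then show ?thesis using ks j by simp
  qed
next
  fix ks assume "ks \<in> (#) 1 ` comps (Suc e + N) N \<union> (\<lambda>ks. Suc (hd ks) # tl ks) ` comps (e + Suc N) (Suc N)"
  then show "ks \<in> comps (Suc e + Suc N) (Suc N)"
  proof
    assume "ks \<in> (#) 1 ` comps (Suc e + N) N" then show ?thesis by (auto simp: comps_def)
  next
    assume "ks \<in> (\<lambda>ks. Suc (hd ks) # tl ks) ` comps (e + Suc N) (Suc N)"
    then obtain js where js: "js \<in> comps (e + Suc N) (Suc N)" "ks = Suc (hd js) # tl js" by blast
    then show ?thesis by (cases js) (auto simp: comps_def)
  qed
qed

lemma comps_0_right: "comps k 0 = (if k = 0 then {[]} else {})"
  by (auto simp: comps_def)

lemma comps_diag: "comps N N = {replicate N 1}"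
proof -
  have ge: "length ks \<le> sum_list ks" if "\<forall>x\<in>set ks. 0 < (x::nat)" for ks
    using that by (induction ks) auto
  have "ks = replicate (length ks) 1" if "\<forall>x\<in>set ks. 0 < (x::nat)" "sum_list ks = length ks" for ks
    using that
  proof (induction ks)
    case (Cons k ks)
    then have "k = 1" "sum_list ks = length ks" using ge[of ks] by auto
    then show ?case using Cons by simp
  qed simp
  then show ?thesis by (fastforce simp: comps_def sum_list_replicate)
qed

text \<open>\<open>e\<close> is the weight minus the depth \<open>N\<close>; it becomes the exponent
  of the first variable in the generating series.\<close>

definition mpl_sum :: "nat \<Rightarrow> nat \<Rightarrow> complex \<Rightarrow> complex" where
  "mpl_sum e N z = (\<Sum>ks\<in>comps (e + N) N. Li_principal ks z)"

lemma mpl_sum_holomorphic: "mpl_sum e N holomorphic_on slit"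
proof -
  have "(\<lambda>z. \<Sum>ks\<in>comps (e + N) N. Li_principal ks z) holomorphic_on slit"
    by (intro holomorphic_on_sum Li_principal_holomorphic) (simp add: comps_pos)
  then show ?thesis by (simp add: mpl_sum_def[abs_def])
qed

lemma mpl_sum_at_0: "mpl_sum e (Suc N) 0 = 0"
  unfolding mpl_sum_def
proof (intro sum.neutral ballI)
  fix ks assume "ks \<in> comps (e + Suc N) (Suc N)"
  then show "Li_principal ks 0 = 0" by (intro Li_principal_0) (auto simp: comps_def)
qed

lemma mpl_sum_Suc_Suc:
  "mpl_sum (Suc e) (Suc N) z = (\<Sum>ks\<in>comps (Suc e + N) N. Li_principal (1 # ks) z)
     + (\<Sum>ks\<in>comps (e + Suc N) (Suc N). Li_principal (Suc (hd ks) # tl ks) z)"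
proof -
  have inj: "inj_on (\<lambda>ks. Suc (hd ks) # tl ks) (comps (e + Suc N) (Suc N))"
  proof (rule inj_onI)
    fix x y assume "x \<in> comps (e + Suc N) (Suc N)" "y \<in> comps (e + Suc N) (Suc N)" "Suc (hd x) # tl x = Suc (hd y) # tl y"
    then show "x = y" by (cases x; cases y) (auto simp: comps_def)
  qed
  have disj: "(#) 1 ` comps (Suc e + N) N \<inter> (\<lambda>ks. Suc (hd ks) # tl ks) ` comps (e + Suc N) (Suc N) = {}"
  proof -
    have "hd ks \<noteq> 0" if "ks \<in> comps (e + Suc N) (Suc N)" for ks using that by (cases ks) (auto simp: comps_def)
    then show ?thesis by fastforce
  qed
  have "mpl_sum (Suc e) (Suc N) z = (\<Sum>ks\<in>(#) 1 ` comps (Suc e + N) N. Li_principal ks z)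
     + (\<Sum>ks\<in>(\<lambda>ks. Suc (hd ks) # tl ks) ` comps (e + Suc N) (Suc N). Li_principal ks z)"
    unfolding mpl_sum_def comps_Suc_Suc by (rule sum.union_disjoint) (use disj finite_comps in auto)
  then show ?thesis using sum.reindex[OF inj] by (simp add: sum.reindex)
qed

text \<open>Summing over all indices makes the derivatives close up within the family: removing a
  leading 1 lowers \<open>N\<close>, lowering the first entry lowers \<open>e\<close>.\<close>

lemma mpl_sum_deriv:
  assumes z: "z \<in> slit" "z \<noteq> 0"
  shows "(mpl_sum (Suc e) (Suc N) has_field_derivative mpl_sum (Suc e) N z / (1 - z) + mpl_sum e (Suc N) z / z) (at z)"
proof -
  have "((\<lambda>z. (\<Sum>ks\<in>comps (Suc e + N) N. Li_principal (1 # ks) z)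
     + (\<Sum>ks\<in>comps (e + Suc N) (Suc N). Li_principal (Suc (hd ks) # tl ks) z)) has_field_derivative
     (\<Sum>ks\<in>comps (Suc e + N) N. Li_principal ks z / (1 - z)) + (\<Sum>ks\<in>comps (e + Suc N) (Suc N). Li_principal ks z / z)) (at z)"
  proof (intro DERIV_add DERIV_sum)
    fix ks assume "ks \<in> comps (Suc e + N) N"
    then show "(Li_principal (1 # ks) has_field_derivative Li_principal ks z / (1 - z)) (at z)"
      by (intro Li_principal_deriv_1 comps_pos z)
  next
    fix ks assume "ks \<in> comps (e + Suc N) (Suc N)"
    then obtain k ks' where "ks = k # ks'" "0 < k" "\<forall>x\<in>set ks'. 0 < x" by (cases ks) (auto simp: comps_def)
    then show "(Li_principal (Suc (hd ks) # tl ks) has_field_derivative Li_principal ks z / z) (at z)"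
      using Li_principal_deriv_ge2[of ks' k z] z by simp
  qed
  then show ?thesis unfolding mpl_sum_Suc_Suc[abs_def]
    by (simp only: mpl_sum_def sum_divide_distrib)
qed

lemma slit_eqI':
  assumes "f holomorphic_on slit" "g holomorphic_on slit" "f 0 = g 0"
    and "\<And>z. z \<in> slit \<Longrightarrow> z \<noteq> 0 \<Longrightarrow> (f has_field_derivative d z) (at z)"
    and "\<And>z. z \<in> slit \<Longrightarrow> z \<noteq> 0 \<Longrightarrow> (g has_field_derivative d z) (at z)"
    and "z \<in> slit"
  shows "f z = g z"
proof (rule slit_eqI[of f "deriv f" g "deriv g"])
  show "deriv f x = deriv g x" if "x \<in> slit" "x \<noteq> 0" for x
    using DERIV_imp_deriv[OF assms(4)[OF that]] DERIV_imp_deriv[OF assms(5)[OF that]] by simp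
qed (use assms holomorphic_derivI[OF _ slit_open] in auto)

definition log_pow :: "nat \<Rightarrow> complex \<Rightarrow> complex" where
  "log_pow r z = (- Ln (1 - z)) ^ r / fact r"

lemma log_pow_deriv:
  assumes "z \<in> slit"
  shows "(log_pow (Suc r) has_field_derivative log_pow r z / (1 - z)) (at z)"
  using Li_1_deriv[OF assms, of "Suc r"] by (simp add: log_pow_def[abs_def])

lemma log_pow_0: "log_pow 0 z = 1" by (simp add: log_pow_def)

lemma log_pow_holomorphic: "log_pow r holomorphic_on slit"
proof (cases r)
  case 0 then show ?thesis by (simp add: log_pow_def[abs_def])
next
  case (Suc k)
  show ?thesis unfolding Suc by (rule holomorphic_onI) (metis log_pow_deriv field_differentiable_def has_field_derivative_at_within)
qed

lemma Li_principal_ones': "z \<in> slit \<Longrightarrow> Li_principal (replicate n (Suc 0)) z = log_pow n z"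
  using Li_principal_ones[of z n] by (simp add: log_pow_def)

text \<open>Up to the sign (-1)^n this is the coefficient of a^q b^n in \<open>ibeta a b z\<close>,
  as \<open>dps_hook_fps\<close> shows on the unit circle.\<close>

definition Li_hook :: "nat \<Rightarrow> nat \<Rightarrow> complex \<Rightarrow> complex" where
  "Li_hook q n = Li_principal (Suc q # replicate n 1)"

lemma Li_hook_holomorphic: "Li_hook q n holomorphic_on slit"
  unfolding Li_hook_def by (intro Li_principal_holomorphic) auto

lemma Li_hook_0: "z \<in> slit \<Longrightarrow> Li_hook 0 n z = log_pow (Suc n) z"
  unfolding Li_hook_def using Li_principal_ones'[of z "Suc n"] by simp

lemma Li_hook_at_0: "Li_hook q n 0 = 0"
  unfolding Li_hook_def by (rule Li_principal_0) auto

lemma Li_hook_deriv: "z \<in> slit \<Longrightarrow> z \<noteq> 0 \<Longrightarrow> (Li_hook (Suc q) n has_field_derivative Li_hook q n z / z) (at z)"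
  unfolding Li_hook_def by (rule Li_principal_deriv_ge2) auto

text \<open>The coefficient of a^e b^(N-1) in (1 - z)^(-b) times the series with coefficients (-1)^n
  \<open>Li_hook q n z\<close>.\<close>

definition hook_sum :: "nat \<Rightarrow> nat \<Rightarrow> complex \<Rightarrow> complex" where
  "hook_sum e N z = (\<Sum>r<N. (- 1) ^ (N - 1 - r) * Li_hook e (N - 1 - r) z * log_pow r z)"

lemma hook_sum_holomorphic: "hook_sum e N holomorphic_on slit"
  unfolding hook_sum_def[abs_def] by (intro holomorphic_intros Li_hook_holomorphic log_pow_holomorphic)

text \<open>Derivatives of the factors \<open>Li_hook\<close> lower \<open>e\<close> and produce
  1/z; derivatives of the logarithmic powers shift \<open>r\<close> and produce 1/(1 - z). This is
  the recursion of \<open>mpl_sum_deriv\<close>.\<close>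

lemma hook_sum_deriv:
  assumes z: "z \<in> slit" "z \<noteq> 0"
  shows "(hook_sum (Suc e) (Suc N) has_field_derivative hook_sum (Suc e) N z / (1 - z) + hook_sum e (Suc N) z / z) (at z)"
proof -
  let ?c = "\<lambda>r. (- 1) ^ (N - r) :: complex"
  have d: "((\<lambda>z. ?c r * Li_hook (Suc e) (N - r) z * log_pow r z) has_field_derivative
     (?c r * (Li_hook e (N - r) z / z) * log_pow r z +
      ?c r * Li_hook (Suc e) (N - r) z * (if r = 0 then 0 else log_pow (r - 1) z / (1 - z)))) (at z)" for r
  proof -
    have l: "(log_pow r has_field_derivative (if r = 0 then 0 else log_pow (r - 1) z / (1 - z))) (at z)"
      using log_pow_deriv[OF z(1), of "r - 1"] by (cases r) (simp_all add: log_pow_def[abs_def])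
    show ?thesis
      by (rule DERIV_cong[OF DERIV_mult'[OF DERIV_cmult[OF Li_hook_deriv[OF z, of e "N - r"], of "?c r"] l]])
         (simp add: ac_simps)
  qed
  have "((\<lambda>z. \<Sum>r<Suc N. ?c r * Li_hook (Suc e) (N - r) z * log_pow r z) has_field_derivative
     (\<Sum>r<Suc N. ?c r * (Li_hook e (N - r) z / z) * log_pow r z +
      ?c r * Li_hook (Suc e) (N - r) z * (if r = 0 then 0 else log_pow (r - 1) z / (1 - z)))) (at z)"
    by (intro DERIV_sum d)
  also have "(\<Sum>r<Suc N. ?c r * (Li_hook e (N - r) z / z) * log_pow r z +
      ?c r * Li_hook (Suc e) (N - r) z * (if r = 0 then 0 else log_pow (r - 1) z / (1 - z))) =
      hook_sum e (Suc N) z / z + (\<Sum>r<Suc N. ?c r * Li_hook (Suc e) (N - r) z * (if r = 0 then 0 else log_pow (r - 1) z / (1 - z)))"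
    unfolding hook_sum_def sum.distrib sum_divide_distrib by (simp del: sum.lessThan_Suc)
  also have "(\<Sum>r<Suc N. ?c r * Li_hook (Suc e) (N - r) z * (if r = 0 then 0 else log_pow (r - 1) z / (1 - z))) =
      hook_sum (Suc e) N z / (1 - z)"
    unfolding hook_sum_def sum.lessThan_Suc_shift sum_divide_distrib by simp
  finally show ?thesis unfolding hook_sum_def[abs_def] by (simp add: add.commute del: sum.lessThan_Suc)
qed

lemma hook_sum_0:
  assumes "z \<in> slit" shows "hook_sum 0 (Suc N) z = log_pow (Suc N) z"
proof -
  let ?l = "- Ln (1 - z)"
  have "hook_sum 0 (Suc N) z = (\<Sum>r<Suc N. (- 1) ^ (N - r) * log_pow (Suc N - r) z * log_pow r z)"
    unfolding hook_sum_def
    by (intro sum.cong refl) (simp add: Li_hook_0 assms Suc_diff_le less_Suc_eq_le)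
  also have "\<dots> = (\<Sum>r<Suc N. (- 1) ^ (N - r) * (of_nat (Suc N choose r) * log_pow (Suc N) z))"
  proof (intro sum.cong refl)
    fix r assume "r \<in> {..<Suc N}"
    then have r: "r \<le> Suc N" by simp
    have "log_pow (Suc N - r) z * log_pow r z = ?l ^ Suc N / (fact (Suc N - r) * fact r)"
      using r by (simp add: log_pow_def flip: power_add)
    also have "\<dots> = of_nat (Suc N choose r) * log_pow (Suc N) z"
      unfolding log_pow_def binomial_fact[OF r] by (simp add: mult.commute del: fact_Suc)
    finally show "(- 1) ^ (N - r) * log_pow (Suc N - r) z * log_pow r z = (- 1) ^ (N - r) * (of_nat (Suc N choose r) * log_pow (Suc N) z)"
      by (simp only: mult.assoc)
  qed
  also have "\<dots> = (\<Sum>r<Suc N. (- 1) ^ (N - r) * of_nat (Suc N choose r)) * log_pow (Suc N) z"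
    by (simp only: sum_distrib_right mult.assoc)
  \<comment> \<open>Binomial expansion of (1 - 1)^(N+1) = 0, with the term r = N + 1 split
    off.\<close>
  also have "(\<Sum>r<Suc N. (- 1) ^ (N - r) * of_nat (Suc N choose r)) = (1::complex)"
  proof -
    have "0 = (1 + (- 1 :: complex)) ^ Suc N" by simp
    also have "\<dots> = (\<Sum>r\<le>Suc N. of_nat (Suc N choose r) * (- 1) ^ (Suc N - r))"
      by (subst binomial_ring) simp
    also have "\<dots> = (\<Sum>r<Suc N. of_nat (Suc N choose r) * (- 1) ^ (Suc N - r)) + 1"
      by (simp add: lessThan_Suc_atMost[symmetric])
    also have "(\<Sum>r<Suc N. of_nat (Suc N choose r) * (- 1) ^ (Suc N - r)) =
        - (\<Sum>r<Suc N. (- 1 :: complex) ^ (N - r) * of_nat (Suc N choose r))"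
      unfolding sum_negf[symmetric] by (intro sum.cong refl) (simp add: Suc_diff_le less_Suc_eq_le)
    finally show ?thesis by (simp add: algebra_simps)
  qed
  finally show ?thesis by simp
qed

lemma hook_sum_at_0: "hook_sum e N 0 = 0"
  unfolding hook_sum_def by (intro sum.neutral ballI) (simp add: Li_hook_at_0)

text \<open>In terms of generating series, \<open>mpl_sum\<close> is \<open>(1 - z)\<^bsup>-b\<^esup>\<close> times the series of the \<open>Li_hook\<close>.\<close>

lemma mpl_sum_eq_hook_sum:
  "z \<in> slit \<Longrightarrow> mpl_sum e (Suc N) z = hook_sum e (Suc N) z"
proof (induction e arbitrary: N z)
  case 0
  then show ?case using comps_diag[of "Suc N"] Li_principal_ones'[of z "Suc N"]
    by (simp add: mpl_sum_def hook_sum_0)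
next
  case (Suc e)
  \<comment> \<open>The induction on the depth runs inside the one on \<open>e\<close>, since the
    derivative lowers one or the other; both sides vanish at 0.\<close>
  show ?case using Suc.prems
  proof (induction N arbitrary: z)
    case 0
    show ?case
    proof (rule slit_eqI'[OF mpl_sum_holomorphic hook_sum_holomorphic _ mpl_sum_deriv _ 0])
      show "(hook_sum (Suc e) (Suc 0) has_field_derivative mpl_sum (Suc e) 0 x / (1 - x) + mpl_sum e (Suc 0) x / x) (at x)"
        if "x \<in> slit" "x \<noteq> 0" for x
        using hook_sum_deriv[OF that, of e 0] Suc.IH[OF that(1), of 0]
        by (simp add: mpl_sum_def comps_0_right hook_sum_def)
    qed (simp_all add: mpl_sum_at_0 hook_sum_at_0)
  next
    case (Suc N)
    show ?case
    proof (rule slit_eqI'[OF mpl_sum_holomorphic hook_sum_holomorphic _ mpl_sum_deriv _ Suc.prems])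
      show "(hook_sum (Suc e) (Suc (Suc N)) has_field_derivative
         mpl_sum (Suc e) (Suc N) x / (1 - x) + mpl_sum e (Suc (Suc N)) x / x) (at x)"
        if "x \<in> slit" "x \<noteq> 0" for x
        using hook_sum_deriv[OF that, of e "Suc N"] Suc.IH[OF that(1)] \<open>\<And>N z. z \<in> slit \<Longrightarrow> mpl_sum e (Suc N) z = hook_sum e (Suc N) z\<close>[OF that(1)]
        by simp
    qed (simp_all add: mpl_sum_at_0 hook_sum_at_0)
  qed
qed

section \<open>Arithmetic, substitution and uniqueness for convergent double series\<close>

section \<open>Double power series\<close>

abbreviation cf :: "complex fps fps \<Rightarrow> nat \<Rightarrow> nat \<Rightarrow> complex" where
  "cf C m n \<equiv> fps_nth (fps_nth C m) n"

definition dps_term :: "complex fps fps \<Rightarrow> real \<Rightarrow> real \<Rightarrow> nat \<times> nat \<Rightarrow> complex" where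
  "dps_term C x y = (\<lambda>(m, n). cf C m n * of_real x ^ m * of_real y ^ n)"

text \<open>Only positive values of the second variable are tested: for \<open>y \<le> 0\<close> the functions below
  are not given by convergent integrals, and one quadrant suffices to determine the coefficients.\<close>

definition dps :: "complex fps fps \<Rightarrow> (real \<Rightarrow> real \<Rightarrow> complex) \<Rightarrow> bool" where
  "dps C f \<longleftrightarrow> (\<exists>r>0. \<forall>x y. \<bar>x\<bar> < r \<longrightarrow> 0 < y \<longrightarrow> y < r \<longrightarrow> (dps_term C x y has_sum f x y) UNIV)"

lemma dpsI:
  assumes "0 < r" "\<And>x y. \<bar>x\<bar> < r \<Longrightarrow> 0 < y \<Longrightarrow> y < r \<Longrightarrow> (dps_term C x y has_sum f x y) UNIV"
  shows "dps C f"
  using assms unfolding dps_def by blast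

lemma dpsE:
  assumes "dps C f"
  obtains r where "0 < r" "\<And>x y. \<bar>x\<bar> < r \<Longrightarrow> 0 < y \<Longrightarrow> y < r \<Longrightarrow> (dps_term C x y has_sum f x y) UNIV"
  using assms unfolding dps_def by metis

lemma dpsE2:
  assumes "dps C f" "dps D g"
  obtains r where "0 < r" "\<And>x y. \<bar>x\<bar> < r \<Longrightarrow> 0 < y \<Longrightarrow> y < r \<Longrightarrow> (dps_term C x y has_sum f x y) UNIV"
    "\<And>x y. \<bar>x\<bar> < r \<Longrightarrow> 0 < y \<Longrightarrow> y < r \<Longrightarrow> (dps_term D x y has_sum g x y) UNIV"
proof -
  obtain r s where r: "0 < r" "\<And>x y. \<bar>x\<bar> < r \<Longrightarrow> 0 < y \<Longrightarrow> y < r \<Longrightarrow> (dps_term C x y has_sum f x y) UNIV"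
    and s: "0 < s" "\<And>x y. \<bar>x\<bar> < s \<Longrightarrow> 0 < y \<Longrightarrow> y < s \<Longrightarrow> (dps_term D x y has_sum g x y) UNIV"
    using dpsE[OF assms(1)] dpsE[OF assms(2)] by metis
  show ?thesis by (rule that[of "min r s"]) (use r s in auto)
qed

lemma dps_cong:
  assumes "dps C f" "0 < s" "\<And>x y. \<bar>x\<bar> < s \<Longrightarrow> 0 < y \<Longrightarrow> y < s \<Longrightarrow> f x y = g x y"
  shows "dps C g"
proof -
  obtain r where r: "0 < r" "\<And>x y. \<bar>x\<bar> < r \<Longrightarrow> 0 < y \<Longrightarrow> y < r \<Longrightarrow> (dps_term C x y has_sum f x y) UNIV"
    using dpsE[OF assms(1)] by metis
  show ?thesis
  proof (rule dpsI[of "min r s"])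
    fix x y assume "\<bar>x\<bar> < min r s" "0 < y" "y < min r s"
    then show "(dps_term C x y has_sum g x y) UNIV" using r(2)[of x y] assms(3)[of x y] by simp
  qed (use r assms in simp)
qed

lemma dps_add:
  assumes "dps C f" "dps D g" shows "dps (C + D) (\<lambda>x y. f x y + g x y)"
proof -
  obtain r where r: "0 < r" "\<And>x y. \<bar>x\<bar> < r \<Longrightarrow> 0 < y \<Longrightarrow> y < r \<Longrightarrow> (dps_term C x y has_sum f x y) UNIV"
    "\<And>x y. \<bar>x\<bar> < r \<Longrightarrow> 0 < y \<Longrightarrow> y < r \<Longrightarrow> (dps_term D x y has_sum g x y) UNIV"
    using dpsE2[OF assms] by metis
  show ?thesis
  proof (rule dpsI[OF r(1)])
    fix x y assume "\<bar>x\<bar> < r" "0 < y" "y < r"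
    from has_sum_add[OF r(2,3)[OF this]]
    show "(dps_term (C + D) x y has_sum f x y + g x y) UNIV"
      by (simp add: dps_term_def case_prod_unfold ring_distribs)
  qed
qed

lemma dps_minus:
  assumes "dps C f" shows "dps (- C) (\<lambda>x y. - f x y)"
proof -
  obtain r where r: "0 < r" "\<And>x y. \<bar>x\<bar> < r \<Longrightarrow> 0 < y \<Longrightarrow> y < r \<Longrightarrow> (dps_term C x y has_sum f x y) UNIV"
    using dpsE[OF assms(1)] by metis
  show ?thesis
  proof (rule dpsI[OF r(1)])
    fix x y assume "\<bar>x\<bar> < r" "0 < y" "y < r"
    then have "((\<lambda>p. - 1 * dps_term C x y p) has_sum - 1 * f x y) UNIV" by (intro has_sum_cmult_right r(2))
    then show "(dps_term (- C) x y has_sum - f x y) UNIV"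
      by (simp add: dps_term_def case_prod_unfold)
  qed
qed

lemma dps_diff: "dps C f \<Longrightarrow> dps D g \<Longrightarrow> dps (C - D) (\<lambda>x y. f x y - g x y)"
  using dps_add[OF _ dps_minus, of C f D g] by simp

lemma has_sum_complex_norm_summable:
  fixes f :: "'a \<Rightarrow> complex"
  shows "(f has_sum S) A \<Longrightarrow> (\<lambda>x. norm (f x)) summable_on A"
  using has_sum_imp_summable summable_on_iff_abs_summable_on_complex by blast

text \<open>Splitting every term of a sum into finitely many summands is legitimate once the sums of
  their norms converge; convergence of the original series alone does not give this.\<close>

lemma has_sum_Sigma_expand:
  fixes g :: "'a \<times> 'b \<Rightarrow> complex"
  assumes fin: "\<And>a. a \<in> A \<Longrightarrow> finite (B a)"
    and norms: "(\<lambda>a. \<Sum>b\<in>B a. norm (g (a, b))) summable_on A"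
    and sums: "((\<lambda>a. \<Sum>b\<in>B a. g (a, b)) has_sum S) A"
  shows "(g has_sum S) (Sigma A B)"
proof (rule has_sum_SigmaI[OF _ sums])
  show "((\<lambda>b. g (a, b)) has_sum (\<Sum>b\<in>B a. g (a, b))) (B a)" if "a \<in> A" for a
    using fin[OF that] by simp
  have "(\<lambda>p. norm (g p)) summable_on Sigma A B"
    by (rule summable_on_SigmaI[OF _ norms]) (use fin in auto)
  then show "g summable_on Sigma A B" by (rule abs_summable_summable)
qed

lemma has_sum_Sigma_collapse:
  fixes g :: "'a \<times> 'b \<Rightarrow> complex"
  assumes "\<And>a. a \<in> A \<Longrightarrow> finite (B a)" "(g has_sum S) (Sigma A B)"
  shows "((\<lambda>a. \<Sum>b\<in>B a. g (a, b)) has_sum S) A"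
  by (rule has_sum_SigmaD[OF assms(2)]) (use assms(1) in simp)

lemma has_sum_mult_complex:
  fixes f :: "'a \<Rightarrow> complex" and g :: "'b \<Rightarrow> complex"
  assumes f: "(f has_sum S) A" and g: "(g has_sum T) B"
  shows "((\<lambda>(a, b). f a * g b) has_sum (S * T)) (A \<times> B)"
proof (rule has_sum_SigmaI)
  show "((\<lambda>b. (\<lambda>(a, b). f a * g b) (a, b)) has_sum f a * T) B" for a
    using has_sum_cmult_right[OF g] by simp
  show "((\<lambda>a. f a * T) has_sum S * T) A" by (rule has_sum_cmult_left[OF f])
  have ng: "((\<lambda>b. norm (g b)) has_sum infsum (\<lambda>b. norm (g b)) B) B"
    using has_sum_complex_norm_summable[OF g] by simp
  have "(\<lambda>p. norm ((\<lambda>(a, b). f a * g b) p)) summable_on A \<times> B"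
  proof (rule summable_on_SigmaI[where g = "\<lambda>a. norm (f a) * infsum (\<lambda>b. norm (g b)) B"])
    show "((\<lambda>b. norm ((\<lambda>(a, b). f a * g b) (a, b))) has_sum norm (f a) * infsum (\<lambda>b. norm (g b)) B) B" for a
      using has_sum_cmult_right[OF ng] by (simp add: norm_mult)
    show "(\<lambda>a. norm (f a) * infsum (\<lambda>b. norm (g b)) B) summable_on A"
      by (rule summable_on_cmult_left[OF has_sum_complex_norm_summable[OF f]])
  qed simp
  then show "(\<lambda>(a, b). f a * g b) summable_on A \<times> B" by (rule abs_summable_summable)
qed

lemma cf_mult: "cf (C * D) m n = (\<Sum>i=0..m. \<Sum>j=0..n. cf C i j * cf D (m - i) (n - j))"
  by (simp add: fps_mult_nth fps_sum_nth)

text \<open>The product over pairs of exponents is reindexed by their sum; the fibres are finite and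
  are the terms of the Cauchy product.\<close>

lemma dps_mult:
  assumes "dps C f" "dps D g" shows "dps (C * D) (\<lambda>x y. f x y * g x y)"
proof -
  obtain r where r: "0 < r" "\<And>x y. \<bar>x\<bar> < r \<Longrightarrow> 0 < y \<Longrightarrow> y < r \<Longrightarrow> (dps_term C x y has_sum f x y) UNIV"
    "\<And>x y. \<bar>x\<bar> < r \<Longrightarrow> 0 < y \<Longrightarrow> y < r \<Longrightarrow> (dps_term D x y has_sum g x y) UNIV"
    using dpsE2[OF assms] by metis
  show ?thesis
  proof (rule dpsI[OF r(1)])
    fix x y assume xy: "\<bar>x\<bar> < r" "0 < y" "y < r"
    let ?B = "\<lambda>(m, n). {0..m} \<times> {0..n::nat}"
    let ?u = "dps_term C x y" and ?v = "dps_term D x y"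
    let ?h = "\<lambda>((m, n), (i, j)). ?u (i, j) * ?v (m - i, n - j)"
    have "((\<lambda>(p, q). ?u p * ?v q) has_sum f x y * g x y) (UNIV \<times> UNIV)"
      by (rule has_sum_mult_complex[OF r(2,3)[OF xy]])
    also have "?this \<longleftrightarrow> (?h has_sum f x y * g x y) (Sigma UNIV ?B)"
      by (rule has_sum_reindex_bij_witness
          [where i = "\<lambda>((m, n), (i, j)). ((i, j), (m - i, n - j))" and j = "\<lambda>((i, j), (k, l)). ((i + k, j + l), (i, j))"])
         auto
    finally have "((\<lambda>p. \<Sum>q\<in>?B p. ?h (p, q)) has_sum f x y * g x y) UNIV"
      by (intro has_sum_Sigma_collapse) auto
    moreover have "(\<Sum>q\<in>?B p. ?h (p, q)) = dps_term (C * D) x y p" for p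
    proof (cases p)
      case (Pair m n)
      have "(\<Sum>q\<in>?B p. ?h (p, q)) = (\<Sum>i=0..m. \<Sum>j=0..n. ?u (i, j) * ?v (m - i, n - j))"
        unfolding Pair by (simp add: sum.cartesian_product)
      also have "\<dots> = (\<Sum>i=0..m. \<Sum>j=0..n. cf C i j * cf D (m - i) (n - j) * of_real x ^ m * of_real y ^ n)"
      proof (intro sum.cong refl)
        fix i j assume "i \<in> {0..m}" "j \<in> {0..n}"
        then have "(of_real x ^ m :: complex) = of_real x ^ i * of_real x ^ (m - i)"
          "(of_real y ^ n :: complex) = of_real y ^ j * of_real y ^ (n - j)" by (simp_all flip: power_add)
        then show "?u (i, j) * ?v (m - i, n - j) = cf C i j * cf D (m - i) (n - j) * of_real x ^ m * of_real y ^ n"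
          by (simp add: dps_term_def mult_ac)
      qed
      also have "\<dots> = cf (C * D) m n * of_real x ^ m * of_real y ^ n"
        unfolding cf_mult by (simp add: sum_distrib_right mult.assoc)
      finally show ?thesis using Pair by (simp add: dps_term_def)
    qed
    ultimately show "(dps_term (C * D) x y has_sum f x y * g x y) UNIV" by simp
  qed
qed

definition Xs :: "complex fps \<Rightarrow> complex fps fps" where "Xs F = Abs_fps (\<lambda>m. fps_const (fps_nth F m))"

definition Ys :: "complex fps \<Rightarrow> complex fps fps" where "Ys F = fps_const F"

lemma cf_Xs: "cf (Xs F) m n = (if n = 0 then fps_nth F m else 0)"
  by (simp add: Xs_def)

lemma cf_Ys: "cf (Ys F) m n = (if m = 0 then fps_nth F n else 0)"
  by (simp add: Ys_def)

lemma eval_fps_has_sum: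
  assumes "ereal (norm (z::complex)) < fps_conv_radius F"
  shows "((\<lambda>n. fps_nth F n * z ^ n) has_sum eval_fps F z) UNIV"
proof (rule norm_summable_imp_has_sum)
  show "summable (\<lambda>n. norm (fps_nth F n * z ^ n))"
    by (rule abs_summable_in_conv_radius) (use assms in \<open>simp add: fps_conv_radius_def\<close>)
  show "(\<lambda>n. fps_nth F n * z ^ n) sums eval_fps F z"
    by (rule sums_eval_fps[OF assms])
qed

lemma has_fps_expansionE:
  fixes F :: "complex fps"
  assumes "f has_fps_expansion F"
  obtains r where "0 < r" "\<And>z. norm z < r \<Longrightarrow> ((\<lambda>n. fps_nth F n * z ^ n) has_sum f z) UNIV"
proof -
  have "eventually (\<lambda>z. eval_fps F z = f z) (nhds 0)" "0 < fps_conv_radius F"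
    using assms by (auto simp: has_fps_expansion_def)
  then obtain s where s: "0 < s" "\<And>z. dist z 0 < s \<Longrightarrow> eval_fps F z = f z"
    unfolding eventually_nhds_metric by auto
  obtain t where t: "0 < t" "ereal t < fps_conv_radius F"
    using \<open>0 < fps_conv_radius F\<close> ereal_dense2[of 0 "fps_conv_radius F"] by (auto simp: zero_ereal_def)
  show ?thesis
  proof (rule that[of "min s t"])
    fix z :: complex assume z: "norm z < min s t"
    then have "ereal (norm z) < fps_conv_radius F" using t by (meson less_ereal.simps(1) less_trans min_less_iff_conj)
    then show "((\<lambda>n. fps_nth F n * z ^ n) has_sum f z) UNIV"
      using eval_fps_has_sum[of z F] s(2)[of z] z by simp
  qed (use s t in simp)
qed

lemma dps_Xs:
  assumes "f has_fps_expansion F" shows "dps (Xs F) (\<lambda>x y. f (of_real x))"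
proof -
  obtain r where r: "0 < r" "\<And>z. norm z < r \<Longrightarrow> ((\<lambda>n. fps_nth F n * z ^ n) has_sum f z) UNIV"
    using has_fps_expansionE[OF assms] by metis
  show ?thesis
  proof (rule dpsI[OF r(1)])
    fix x y :: real assume "\<bar>x\<bar> < r"
    then have "((\<lambda>n. fps_nth F n * of_real x ^ n) has_sum f (of_real x)) UNIV" by (intro r(2)) simp
    also have "?this \<longleftrightarrow> (dps_term (Xs F) x y has_sum f (of_real x)) (UNIV \<times> {0})"
      by (rule has_sum_reindex_bij_witness[where i = fst and j = "\<lambda>n. (n, 0)"])
         (auto simp: dps_term_def cf_Xs)
    also have "\<dots> \<longleftrightarrow> (dps_term (Xs F) x y has_sum f (of_real x)) UNIV"
      by (rule has_sum_cong_neutral) (auto simp: dps_term_def cf_Xs split: if_splits)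
    finally show "(dps_term (Xs F) x y has_sum f (of_real x)) UNIV" .
  qed
qed

lemma dps_Ys:
  assumes "f has_fps_expansion F" shows "dps (Ys F) (\<lambda>x y. f (of_real y))"
proof -
  obtain r where r: "0 < r" "\<And>z. norm z < r \<Longrightarrow> ((\<lambda>n. fps_nth F n * z ^ n) has_sum f z) UNIV"
    using has_fps_expansionE[OF assms] by metis
  show ?thesis
  proof (rule dpsI[OF r(1)])
    fix x y :: real assume "0 < y" "y < r"
    then have "((\<lambda>n. fps_nth F n * of_real y ^ n) has_sum f (of_real y)) UNIV" by (intro r(2)) simp
    also have "?this \<longleftrightarrow> (dps_term (Ys F) x y has_sum f (of_real y)) ({0} \<times> UNIV)"
      by (rule has_sum_reindex_bij_witness[where i = snd and j = "\<lambda>n. (0, n)"])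
         (auto simp: dps_term_def cf_Ys)
    also have "\<dots> \<longleftrightarrow> (dps_term (Ys F) x y has_sum f (of_real y)) UNIV"
      by (rule has_sum_cong_neutral) (auto simp: dps_term_def cf_Ys split: if_splits)
    finally show "(dps_term (Ys F) x y has_sum f (of_real y)) UNIV" .
  qed
qed

subsection \<open>Substituting \<open>y - x\<close> for the first variable\<close>

text \<open>Expands (y - x)^e: \<open>m\<close> counts the factors -x and \<open>j\<close> the
  factors y, so that e = m + j.\<close>

definition subst_diff :: "complex fps fps \<Rightarrow> complex fps fps" where
  "subst_diff C = Abs_fps (\<lambda>m. Abs_fps (\<lambda>n. \<Sum>j=0..n. of_nat ((m + j) choose m) * (- 1) ^ m * cf C (m + j) (n - j)))"

lemma cf_subst_diff: "cf (subst_diff C) m n = (\<Sum>j=0..n. of_nat ((m + j) choose m) * (- 1) ^ m * cf C (m + j) (n - j))"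
  by (simp add: subst_diff_def)

lemma dps_subst_diff:
  assumes "dps C f" shows "dps (subst_diff C) (\<lambda>x y. f (y - x) y)"
proof -
  obtain r where r: "0 < r" "\<And>x y. \<bar>x\<bar> < r \<Longrightarrow> 0 < y \<Longrightarrow> y < r \<Longrightarrow> (dps_term C x y has_sum f x y) UNIV"
    using dpsE[OF assms(1)] by metis
  show ?thesis
  \<comment> \<open>Halving the radius keeps |x| + y below \<open>r\<close>, and the norms of the
    expanded terms add up to the norm of the term at |x| + y.\<close>
  proof (rule dpsI[of "r / 2"])
    fix x y assume xy: "\<bar>x\<bar> < r / 2" "0 < y" "y < r / 2"
    let ?B = "\<lambda>(e, n::nat). {..e::nat}"
    let ?g = "\<lambda>((e, n), m). cf C e n * (of_nat (e choose m) * of_real (- x) ^ m * of_real y ^ (e - m)) * of_real y ^ n"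
    let ?h = "\<lambda>((m, n), j). of_nat ((m + j) choose m) * (- 1) ^ m * cf C (m + j) (n - j) * of_real x ^ m * of_real y ^ n"
    have bin: "(\<Sum>m\<le>e. of_nat (e choose m) * a ^ m * b ^ (e - m)) = (a + b) ^ e" for a b :: "'c::comm_ring_1" and e
      by (simp add: binomial_ring)
    have 1: "(\<Sum>m\<in>?B p. ?g (p, m)) = dps_term C (y - x) y p" for p
    proof (cases p)
      case (Pair e n)
      have "(\<Sum>m\<in>?B p. ?g (p, m)) = cf C e n * (\<Sum>m\<le>e. of_nat (e choose m) * of_real (- x) ^ m * of_real y ^ (e - m)) * of_real y ^ n"
        unfolding Pair by (simp add: sum_distrib_left sum_distrib_right)
      then show ?thesis unfolding bin Pair by (simp add: dps_term_def algebra_simps)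
    qed
    have 2: "(\<Sum>m\<in>?B p. norm (?g (p, m))) = norm (dps_term C (\<bar>x\<bar> + y) y p)" for p
    proof (cases p)
      case (Pair e n)
      have "(\<Sum>m\<in>?B p. norm (?g (p, m))) = norm (cf C e n) * (\<Sum>m\<le>e. of_nat (e choose m) * \<bar>x\<bar> ^ m * y ^ (e - m)) * y ^ n"
        unfolding Pair using xy by (simp add: sum_distrib_left sum_distrib_right norm_mult norm_power)
      moreover have "norm (complex_of_real (\<bar>x\<bar> + y)) = \<bar>x\<bar> + y" using xy by (simp only: norm_of_real)
      ultimately show ?thesis unfolding bin Pair using xy
        by (simp add: dps_term_def norm_mult norm_power del: of_real_add)
    qed
    have "(?g has_sum f (y - x) y) (Sigma UNIV ?B)"
    proof (rule has_sum_Sigma_expand)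
      show "(\<lambda>p. \<Sum>m\<in>?B p. norm (?g (p, m))) summable_on UNIV"
        unfolding 2 by (rule has_sum_complex_norm_summable[OF r(2)]) (use xy in auto)
      show "((\<lambda>p. \<Sum>m\<in>?B p. ?g (p, m)) has_sum f (y - x) y) UNIV"
        unfolding 1 by (rule r(2)) (use xy in auto)
    qed auto
    also have "?this \<longleftrightarrow> (?h has_sum f (y - x) y) (Sigma UNIV (\<lambda>(m, n). {0..n}))"
    proof (rule has_sum_reindex_bij_witness
          [where j = "\<lambda>((e, n), m). ((m, n + (e - m)), e - m)" and i = "\<lambda>((m, n), j). ((m + j, n - j), m)"])
      fix a assume a: "a \<in> Sigma UNIV ?B"
      obtain e n m where p: "a = ((e, n), m)" "m \<le> e" using a by (cases a) auto
      have "(of_real y ^ (n + (e - m)) :: complex) = of_real y ^ (e - m) * of_real y ^ n"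
        "(of_real (- x) ^ m :: complex) = (- 1) ^ m * of_real x ^ m"
        by (simp_all add: power_add power_minus[of "of_real x"])
      then show "?h ((\<lambda>((e, n), m). ((m, n + (e - m)), e - m)) a) = ?g a"
        using p(2) unfolding p(1) by (simp add: mult_ac)
    qed auto
    finally have "((\<lambda>p. \<Sum>j\<in>(\<lambda>(m, n). {0..n}) p. (\<lambda>((m, n), j). of_nat ((m + j) choose m) * (- 1) ^ m * cf C (m + j) (n - j) * of_real x ^ m * of_real y ^ n) (p, j))
        has_sum f (y - x) y) UNIV"
      by (intro has_sum_Sigma_collapse) auto
    also have "?this \<longleftrightarrow> (dps_term (subst_diff C) x y has_sum f (y - x) y) UNIV"
      by (rule has_sum_cong) (auto simp: dps_term_def cf_subst_diff sum_distrib_right)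
    finally show "(dps_term (subst_diff C) x y has_sum f (y - x) y) UNIV" .
  qed (use r in simp)
qed

subsection \<open>Uniqueness of the coefficients\<close>

text \<open>Zeros of a nonzero power series are isolated, so a right neighbourhood of 0 is
  enough.\<close>

lemma powser_zero_right:
  fixes a :: "nat \<Rightarrow> complex"
  assumes r: "0 < r" and 0: "\<And>t. 0 < t \<Longrightarrow> t < r \<Longrightarrow> (\<lambda>n. a n * of_real t ^ n) sums 0"
  shows "a n = 0"
proof (rule ccontr)
  assume n: "a n \<noteq> 0"
  \<comment> \<open>\<open>powser_0_nonzero\<close> concerns series that vanish at their centre; the
    factor \<open>z\<close> brings this about without adding zeros elsewhere.\<close>
  define b where "b = (\<lambda>n. if n = 0 then 0 else a (n - 1))"
  define F where "F = (\<lambda>z. z * (\<Sum>n. a n * z ^ n))"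
  have s: "summable (\<lambda>n. a n * z ^ n)" if "norm z < r / 2" for z
    by (rule powser_inside[where x = "of_real (r / 2)"])
       (use 0[of "r / 2"] that r in \<open>auto simp: sums_iff\<close>)
  have sums: "(\<lambda>n. b n * (z - 0) ^ n) sums F z" if z: "norm (z - 0) < r / 2" for z
  proof -
    have "(\<lambda>n. z * (a n * z ^ n)) sums F z" unfolding F_def using s[of z] z by (intro sums_mult summable_sums) simp
    then have "(\<lambda>n. b (Suc n) * z ^ Suc n) sums F z" by (simp add: b_def mult_ac)
    then show ?thesis using sums_Suc[of "\<lambda>n. b n * z ^ n" "F z"] by (simp add: b_def)
  qed
  obtain s where s: "0 < s" "\<And>z. z \<in> cball 0 s - {0} \<Longrightarrow> F z \<noteq> 0"
    by (rule powser_0_nonzero[where a = b and \<xi> = 0 and f = F and m = "Suc n" and r = "r / 2"])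
       (use r sums n in \<open>auto simp: b_def F_def\<close>)
  let ?t = "min s (r / 2)"
  have t: "0 < ?t" "?t < r" using s r by auto
  have "F (of_real ?t) = 0" using sums_unique[OF 0[OF t]] by (simp add: F_def)
  moreover have "of_real ?t \<in> cball 0 s - {0 :: complex}" using t s by auto
  ultimately show False using s(2) by blast
qed

text \<open>One variable at a time: for fixed small y > 0 the row sums are the coefficients of a
  power series in x that vanishes for small x > 0, so each row sum is 0; each row is in turn a
  vanishing power series in y.\<close>

lemma dps_unique_0:
  assumes "dps C f" "0 < s" "\<And>x y. \<bar>x\<bar> < s \<Longrightarrow> 0 < y \<Longrightarrow> y < s \<Longrightarrow> f x y = 0"
  shows "C = 0"
proof -
  have "dps C (\<lambda>_ _. 0)" using dps_cong[OF assms] by simp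
  then obtain r where r: "0 < r" "\<And>x y. \<bar>x\<bar> < r \<Longrightarrow> 0 < y \<Longrightarrow> y < r \<Longrightarrow> (dps_term C x y has_sum 0) UNIV"
    using dpsE by metis
  have row: "(\<lambda>n. cf C m n * of_real y ^ n) summable_on UNIV" and row0: "(\<Sum>\<^sub>\<infinity>n. cf C m n * of_real y ^ n) = 0"
    if y: "0 < y" "y < r" for y m
  proof -
    have summ: "(\<lambda>n. cf C m n * of_real x ^ m * of_real y ^ n) summable_on UNIV" if x: "0 < x" "x < r" for x m
    proof -
      have "dps_term C x y summable_on (\<lambda>n. (m, n)) ` UNIV"
        by (rule summable_on_subset_banach[OF has_sum_imp_summable[OF r(2)]]) (use x y in auto)
      then show ?thesis by (subst (asm) summable_on_reindex) (auto simp: inj_on_def dps_term_def o_def)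
    qed
    \<comment> \<open>The double series controls a row only together with the factor
      \<open>x ^ m\<close>; at x = r/2 this factor can be divided away.\<close>
    have "0 < r / 2" "r / 2 < r" using r(1) by auto
    from summ[OF this, of m] have "(\<lambda>n. cf C m n * of_real (r / 2) ^ m * of_real y ^ n * (1 / of_real (r / 2) ^ m)) summable_on UNIV"
      by (rule summable_on_cmult_left)
    moreover have "cf C m n * of_real (r / 2) ^ m * of_real y ^ n * (1 / of_real (r / 2) ^ m) = cf C m n * of_real y ^ n" for n m
    proof -
      have "(of_real (r / 2) ^ m :: complex) \<noteq> 0" using r(1) by simp
      then show ?thesis by (simp add: field_simps)
    qed
    ultimately have row: "(\<lambda>n. cf C m n * of_real y ^ n) summable_on UNIV" for m
      using summ[OF \<open>0 < r / 2\<close> \<open>r / 2 < r\<close>, THEN summable_on_cmult_left, of m "1 / of_real (r / 2) ^ m"] by simp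
    then show "(\<lambda>n. cf C m n * of_real y ^ n) summable_on UNIV" .
    have "(\<lambda>m. (\<Sum>\<^sub>\<infinity>n. cf C m n * of_real y ^ n) * of_real x ^ m) sums 0" if x: "0 < x" "x < r" for x
    proof -
      have "(dps_term C x y has_sum 0) (UNIV \<times> UNIV)" using r(2)[of x y] x y by simp
      moreover have "((\<lambda>n. dps_term C x y (m, n)) has_sum (\<Sum>\<^sub>\<infinity>n. cf C m n * of_real y ^ n) * of_real x ^ m) UNIV" for m
        using has_sum_cmult_left[OF has_sum_infsum[OF row[of m]], of "of_real x ^ m"]
        by (simp add: dps_term_def mult_ac)
      ultimately have "((\<lambda>m. (\<Sum>\<^sub>\<infinity>n. cf C m n * of_real y ^ n) * of_real x ^ m) has_sum 0) UNIV"
        by (rule has_sum_SigmaD)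
      then show ?thesis by (rule has_sum_imp_sums)
    qed
    then show "(\<Sum>\<^sub>\<infinity>n. cf C m n * of_real y ^ n) = 0" by (rule powser_zero_right[OF r(1)])
  qed
  have "cf C m n = 0" for m n
  proof (rule powser_zero_right[OF r(1)])
    fix t :: real assume t: "0 < t" "t < r"
    show "(\<lambda>n. cf C m n * of_real t ^ n) sums 0"
      using has_sum_imp_sums[OF has_sum_infsum[OF row[OF t, of m]]] row0[OF t, of m] by simp
  qed
  then show ?thesis by (intro fps_ext) simp
qed

lemma dps_unique:
  assumes "dps C f" "dps D g" "0 < s" "\<And>x y. \<bar>x\<bar> < s \<Longrightarrow> 0 < y \<Longrightarrow> y < s \<Longrightarrow> f x y = g x y"
  shows "C = D"
  using dps_unique_0[OF dps_diff[OF assms(1,2)] assms(3)] assms(4) by simp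

section \<open>Gamma values as exponentials of zeta series, and Bernoulli numbers\<close>

section \<open>The Gamma function and the polynomials \<open>P\<^sub>n\<close>\<close>

definition seq_fps :: "(nat \<Rightarrow> real) \<Rightarrow> complex fps" where
  "seq_fps a = Abs_fps (\<lambda>k. if k = 0 then 0 else of_real (a k))"

definition P_fps :: "(nat \<Rightarrow> real) \<Rightarrow> complex fps" where
  "P_fps a = Abs_fps (\<lambda>n. of_real (P_exp n a))"

lemma P_fps_eq: "P_fps a = fps_exp 1 oo seq_fps a"
proof (rule fps_ext)
  fix n
  let ?A = "Abs_fps (\<lambda>k. if k = 0 then 0 else a k)"
  have p: "fps_nth (seq_fps a ^ i) n = of_real (fps_nth (?A ^ i) n)" for i n
  proof (induction i arbitrary: n)
    case 0 then show ?case by simp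
  next
    case (Suc i)
    then show ?case by (auto simp: fps_mult_nth seq_fps_def intro!: sum.cong)
  qed
  show "fps_nth (P_fps a) n = fps_nth (fps_exp 1 oo seq_fps a) n"
    by (simp add: P_fps_def P_exp_def fps_compose_nth p)
qed

lemma has_fps_expansion_P_fps:
  assumes "h has_fps_expansion seq_fps a"
  shows "(\<lambda>t. exp (h t)) has_fps_expansion P_fps a"
  using has_fps_expansion_compose[OF has_fps_expansion_exp1 assms] unfolding P_fps_eq
  by (simp add: seq_fps_def o_def)

text \<open>A logarithm of Gamma(1 - t) exp(-gamma t), gamma being Euler's constant, with Taylor
  coefficients zeta(k)/k for k >= 2. The value at 0 is set by hand because -t is then a singular
  point of both logarithms.\<close>

definition log_gamma_sum :: "complex \<Rightarrow> complex" where
  "log_gamma_sum t = (if t = 0 then 0 else ln_Gamma (- t) - euler_mascheroni * t + ln (- t))"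

lemma nonpos_Ints_small: "norm (t::complex) < 1 \<Longrightarrow> t \<noteq> 0 \<Longrightarrow> t \<notin> \<int>\<^sub>\<le>\<^sub>0"
proof
  assume t: "norm t < 1" "t \<noteq> 0" "t \<in> \<int>\<^sub>\<le>\<^sub>0"
  then obtain n where "t = - of_nat n" by (auto elim: nonpos_Ints_cases')
  then show False using t by simp
qed

lemma one_plus_small_nonpos_Ints: "norm (t::complex) < 1 \<Longrightarrow> 1 + t \<notin> \<int>\<^sub>\<le>\<^sub>0"
proof
  assume t: "norm t < 1" "1 + t \<in> \<int>\<^sub>\<le>\<^sub>0"
  then obtain n where "1 + t = - of_nat n" by (auto elim: nonpos_Ints_cases')
  moreover have "t = (1 + t) - 1" by simp
  ultimately have "t = - of_nat (Suc n)" by simp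
  then have "norm t = real (Suc n)" by (metis norm_minus_cancel norm_of_nat)
  then show False using t by simp
qed

lemma exp_log_gamma_sum:
  assumes "norm t < 1"
  shows "exp (log_gamma_sum t) = Gamma (1 - t) * exp (- (euler_mascheroni * t))"
proof (cases "t = 0")
  case False
  then have n: "- t \<notin> \<int>\<^sub>\<le>\<^sub>0" using nonpos_Ints_small[of "- t"] assms by simp
  have "exp (ln_Gamma (- t)) = Gamma (- t)" using n by (simp add: Gamma_complex_altdef)
  moreover have "Gamma (1 - t) = - t * Gamma (- t)" using Gamma_plus1[OF n] by simp
  moreover have "exp (log_gamma_sum t) = exp (ln_Gamma (- t)) * exp (- (euler_mascheroni * t)) * exp (ln (- t))"
    using False unfolding log_gamma_sum_def exp_add[symmetric] by simp
  ultimately show ?thesis using False by simp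
qed (simp add: log_gamma_sum_def)

text \<open>The logarithm of the Weierstrass product for the Gamma function.\<close>

lemma log_gamma_sum_sums:
  assumes "norm t < 1"
  shows "(\<lambda>k. - (t / of_nat (Suc k)) - ln (1 - t / of_nat (Suc k))) sums log_gamma_sum t"
proof (cases "t = 0")
  case False
  then have n: "- t \<notin> \<int>\<^sub>\<le>\<^sub>0" using nonpos_Ints_small[of "- t"] assms by simp
  show ?thesis using ln_Gamma_series'_aux[OF n] False by (simp add: log_gamma_sum_def)
qed (simp add: log_gamma_sum_def)

text \<open>Each logarithm is expanded in its Taylor series. Its linear term cancels, so the double
  series starts at j = 2 and is dominated by |t|^j / (k+1)^2; summing over \<open>k\<close> first
  then gives zeta(j) t^j / j.\<close>

lemma zeta_seq_sums:
  assumes t: "norm t < 1"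
  shows "(\<lambda>j. fps_nth (seq_fps zeta_seq) j * t ^ j) sums log_gamma_sum t"
proof -
  define T where "T = (\<lambda>k j. if j \<le> 1 then 0 else (t / of_nat (Suc k)) ^ j / of_nat j)"
  have summ: "(\<lambda>(k, j). T k j) summable_on UNIV \<times> UNIV"
  proof -
    have "summable (\<lambda>k. 1 / real (Suc k) ^ 2)"
      using inverse_power_summable[of 2, where 'a = real] summable_Suc_iff[of "\<lambda>n. inverse (real n ^ 2)"]
      by (simp add: inverse_eq_divide del: of_nat_Suc)
    moreover have "norm (complex_of_real (1 / real (Suc k) ^ 2)) = 1 / real (Suc k) ^ 2" for k
      unfolding norm_of_real by simp
    ultimately have 1: "((\<lambda>k. complex_of_real (1 / real (Suc k) ^ 2)) has_sum (\<Sum>k. complex_of_real (1 / real (Suc k) ^ 2))) UNIV"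
      by (intro norm_summable_imp_has_sum summable_sums summable_of_real) (simp_all only:)
    have 2: "((\<lambda>j. complex_of_real (norm t) ^ j) has_sum (\<Sum>j. complex_of_real (norm t) ^ j)) UNIV"
      using t by (intro norm_summable_imp_has_sum summable_sums summable_geometric) (simp_all add: norm_power summable_geometric)
    have "(\<lambda>p. norm ((\<lambda>(k, j). T k j) p)) summable_on UNIV \<times> UNIV"
    proof (rule Infinite_Sum.abs_summable_on_comparison_test'[OF has_sum_complex_norm_summable[OF has_sum_mult_complex[OF 1 2]]])
      fix p :: "nat \<times> nat" 
      obtain k j where p: "p = (k, j)" by (cases p)
      have "norm (T k j) \<le> 1 / real (Suc k) ^ 2 * norm t ^ j"
      proof (cases "j \<le> 1")
        case False
        have "norm (T k j) = norm t ^ j / (real (Suc k) ^ j * real j)"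
          using False by (simp add: T_def norm_divide norm_mult norm_power power_divide del: of_nat_Suc)
        also have "\<dots> \<le> norm t ^ j / real (Suc k) ^ 2"
        proof (rule divide_left_mono)
          have "real (Suc k) ^ 2 * 1 \<le> real (Suc k) ^ j * real j"
            using False by (intro mult_mono power_increasing) auto
          then show "real (Suc k) ^ 2 \<le> real (Suc k) ^ j * real j" by simp
        qed (use False in auto)
        finally show ?thesis by simp
      qed (simp add: T_def)
      then show "norm ((\<lambda>(k, j). T k j) p) \<le> norm ((\<lambda>(k, j). complex_of_real (1 / real (Suc k) ^ 2) * complex_of_real (norm t) ^ j) p)"
        unfolding p by (simp add: norm_mult norm_power norm_divide del: of_nat_Suc)
    qed
    then show ?thesis by (rule abs_summable_summable)
  qed
  have row: "(\<lambda>j. T k j) sums (- (t / of_nat (Suc k)) - ln (1 - t / of_nat (Suc k)))" for k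
  proof -
    let ?w = "t / of_nat (Suc k)"
    have "norm ?w \<le> norm t" by (simp add: norm_divide divide_le_eq mult_left_le del: of_nat_Suc) (simp add: field_simps)
    then have "norm (- ?w) < 1" using t by simp
    from sums_minus[OF Ln_series'[OF this]] have "(\<lambda>j. ?w ^ j / of_nat j) sums (- ln (1 - ?w))" by simp
    from sums_diff[OF this sums_single[of 1 "\<lambda>_. ?w"]]
    have "(\<lambda>j. ?w ^ j / of_nat j - (if j = 1 then ?w else 0)) sums (- ln (1 - ?w) - ?w)" .
    moreover have "?w ^ j / of_nat j - (if j = 1 then ?w else 0) = T k j" for j
    proof -
      consider "j = 0" | "j = 1" | "j > 1" by linarith
      then show ?thesis by cases (auto simp: T_def)
    qed
    moreover have "- ln (1 - ?w) - ?w = - ?w - ln (1 - ?w)" by (simp only: diff_conv_add_uminus add.commute)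
    ultimately show ?thesis by (simp only:)
  qed
  have col: "(\<lambda>k. T k j) sums (fps_nth (seq_fps zeta_seq) j * t ^ j)" for j
  proof (cases "j \<le> 1")
    case True then show ?thesis by (simp add: T_def seq_fps_def zeta_seq_def)
  next
    case False
    then have "summable (\<lambda>k. 1 / real (Suc k) ^ j)"
      using inverse_power_summable[of j, where 'a = real] summable_Suc_iff[of "\<lambda>n. inverse (real n ^ j)"]
      by (simp add: inverse_eq_divide del: of_nat_Suc)
    then have "(\<lambda>k. 1 / real (Suc k) ^ j) sums zeta_nat j" unfolding zeta_nat_def by (rule summable_sums)
    from sums_mult2[OF sums_of_real[OF this, where 'a = complex], of "t ^ j / of_nat j"]
    have "(\<lambda>k. complex_of_real (1 / real (Suc k) ^ j) * (t ^ j / of_nat j)) sums (of_real (zeta_nat j) * (t ^ j / of_nat j))" .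
    moreover have "complex_of_real (1 / real (Suc k) ^ j) * (t ^ j / of_nat j) = T k j" for k
      using False by (simp add: T_def power_divide del: of_nat_Suc)
    ultimately show ?thesis using False by (simp add: seq_fps_def zeta_seq_def)
  qed
  have rows: "((\<lambda>j. (\<lambda>(k, j). T k j) (k, j)) has_sum (- (t / of_nat (Suc k)) - ln (1 - t / of_nat (Suc k)))) UNIV" for k
  proof -
    have "T k summable_on UNIV" using summable_on_SigmaD1[OF summ] by simp
    then have *: "(T k has_sum infsum (T k) UNIV) UNIV" by simp
    from sums_unique2[OF has_sum_imp_sums[OF this] row] * show ?thesis by simp
  qed
  have summ': "(\<lambda>(j, k). T k j) summable_on UNIV \<times> UNIV"
    using summ unfolding summable_on_def by (subst (asm) has_sum_swap) (auto simp: case_prod_unfold)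
  have cols: "((\<lambda>k. (\<lambda>(j, k). T k j) (j, k)) has_sum (fps_nth (seq_fps zeta_seq) j * t ^ j)) UNIV" for j
  proof -
    have "(\<lambda>k. T k j) summable_on UNIV" using summable_on_SigmaD1[OF summ'] by simp
    then have *: "((\<lambda>k. T k j) has_sum infsum (\<lambda>k. T k j) UNIV) UNIV" by simp
    from sums_unique2[OF has_sum_imp_sums[OF this] col] * show ?thesis by simp
  qed
  obtain S where S: "((\<lambda>(k, j). T k j) has_sum S) (UNIV \<times> UNIV)" using summ by (auto simp: summable_on_def)
  have "((\<lambda>(j, k). T k j) has_sum S) (UNIV \<times> UNIV)"
    using S by (subst (asm) has_sum_swap) (simp add: case_prod_unfold)
  then have "(\<lambda>j. fps_nth (seq_fps zeta_seq) j * t ^ j) sums S"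
    by (rule has_sum_imp_sums[OF has_sum_SigmaD[OF _ cols]])
  moreover have "S = log_gamma_sum t"
    by (rule sums_unique2[OF has_sum_imp_sums[OF has_sum_SigmaD[OF S rows]] log_gamma_sum_sums[OF t]])
  ultimately show ?thesis by simp
qed

lemma has_fps_expansion_zeta: "log_gamma_sum has_fps_expansion seq_fps zeta_seq"
  by (rule has_fps_expansionI, rule eventually_mono[OF eventually_nhds_ball[of 1 0]])
     (use zeta_seq_sums in auto)

lemma has_fps_expansion_eq_near_0:
  assumes "f has_fps_expansion F" "0 < r" "\<And>z. norm z < r \<Longrightarrow> f z = g z"
  shows "g has_fps_expansion F"
proof -
  have "eventually (\<lambda>z. f z = g z) (nhds 0)"
    by (rule eventually_mono[OF eventually_nhds_ball[OF assms(2)]]) (use assms(3) in auto)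
  then show ?thesis using assms(1) by (auto simp: has_fps_expansion_def elim: eventually_elim2)
qed

text \<open>The exponential factor makes the linear term of the logarithm vanish, as in \<open>\<^bold>\<zeta>\<close>; it cancels
  in \<open>\<Gamma>(1 + x - y) \<Gamma>(1 - x) / \<Gamma>(1 - y)\<close>.\<close>

definition gamma_reg :: "complex \<Rightarrow> complex" where
  "gamma_reg t = Gamma (1 - t) * exp (- (euler_mascheroni * t))"

lemma gamma_reg_expansion: "gamma_reg has_fps_expansion P_fps zeta_seq"
  by (rule has_fps_expansion_eq_near_0[OF has_fps_expansion_P_fps[OF has_fps_expansion_zeta], of 1])
     (simp_all add: exp_log_gamma_sum gamma_reg_def)

lemma inverse_gamma_reg_expansion: "(\<lambda>t. inverse (gamma_reg t)) has_fps_expansion P_fps (\<lambda>k. - zeta_seq k)"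
proof -
  have "seq_fps (\<lambda>k. - zeta_seq k) = - seq_fps zeta_seq" by (rule fps_ext) (simp add: seq_fps_def)
  then have "(\<lambda>t. - log_gamma_sum t) has_fps_expansion seq_fps (\<lambda>k. - zeta_seq k)"
    using has_fps_expansion_minus[OF has_fps_expansion_zeta] by simp
  from has_fps_expansion_eq_near_0[OF has_fps_expansion_P_fps[OF this], of 1]
  show ?thesis by (simp add: exp_minus exp_log_gamma_sum gamma_reg_def)
qed

text \<open>The exponential factors at x and -x cancel, which leaves the reflection formula for
  Gamma(1 + x) Gamma(1 - x).\<close>

lemma gamma_reg_reflection:
  assumes "norm x < 1"
  shows "gamma_reg (- x) * gamma_reg x * sin (of_real pi * x) = of_real pi * x"
proof -
  have n: "1 + x \<notin> \<int>\<^sub>\<le>\<^sub>0" "1 - x \<notin> \<int>\<^sub>\<le>\<^sub>0"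
    using one_plus_small_nonpos_Ints[of x] one_plus_small_nonpos_Ints[of "- x"] assms by auto
  then have nz: "Gamma (1 + x) \<noteq> 0" "Gamma (1 - x) \<noteq> 0" by (auto simp: Gamma_eq_zero_iff)
  have "x * rGamma (1 + x) * rGamma (1 - x) = sin (of_real pi * x) / of_real pi"
    using rGamma_reflection_complex[of x] rGamma_plus1[of x] by (simp add: add.commute)
  then have "of_real pi * x = Gamma (1 + x) * Gamma (1 - x) * sin (of_real pi * x)"
    using nz by (simp add: rGamma_inverse_Gamma field_simps)
  moreover have "gamma_reg (- x) * gamma_reg x = Gamma (1 + x) * Gamma (1 - x)"
    by (simp add: gamma_reg_def mult_ac flip: exp_add)
  ultimately show ?thesis by simp
qed

subsection \<open>Bernoulli numbers\<close>

definition P_fps_neg :: "complex fps" where "P_fps_neg = Abs_fps (\<lambda>n. (- 1) ^ n * of_real (P_exp n zeta_seq))"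

lemma P_fps_neg_expansion: "(\<lambda>x. gamma_reg (- x)) has_fps_expansion P_fps_neg"
proof -
  have "(gamma_reg \<circ> (\<lambda>x. - x)) has_fps_expansion (P_fps zeta_seq oo - fps_X)"
    by (intro has_fps_expansion_compose gamma_reg_expansion has_fps_expansion_minus has_fps_expansion_fps_X) simp
  moreover have "P_fps zeta_seq oo - fps_X = P_fps_neg"
    by (simp add: fps_compose_uminus' P_fps_def P_fps_neg_def)
  ultimately show ?thesis by (simp add: o_def)
qed

text \<open>The substitution t = c X in the defining quotient, cleared of its denominator. The
  quotient of formal series is exact because numerator and denominator both have subdegree
  1.\<close>

lemma bernoulli_fps_eq:
  "Abs_fps (\<lambda>m. of_real (bernoulli_num m / fact m) * c ^ m) * (fps_exp c - 1) = fps_const c * fps_X * fps_exp (c::complex)"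
proof -
  let ?B = "fps_X * fps_exp 1 / (fps_exp 1 - 1) :: real fps"
  have sub: "subdegree (fps_exp (1::real) - 1) = 1" by (rule subdegreeI) auto
  have "subdegree (fps_X * fps_exp (1::real)) = 1" by (subst subdegree_mult) auto
  moreover have nz: "fps_exp (1::real) - 1 \<noteq> 0" using sub by auto
  ultimately have "(fps_exp (1::real) - 1) dvd (fps_X * fps_exp 1)" using sub by (subst fps_dvd_iff) auto
  then have B: "?B * (fps_exp 1 - 1) = fps_X * fps_exp 1" by simp
  have Bm: "bernoulli_num m / fact m = fps_nth ?B m" for m by (simp add: bernoulli_num_def)
  show ?thesis
  proof (rule fps_ext)
    fix m
    have "fps_nth (Abs_fps (\<lambda>m. of_real (bernoulli_num m / fact m) * c ^ m) * (fps_exp c - 1)) m =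
        (\<Sum>i=0..m. of_real (fps_nth ?B i) * c ^ i * (c ^ (m - i) / fact (m - i) - (if m - i = 0 then 1 else 0)))"
      unfolding fps_mult_nth Bm by simp
    also have "\<dots> = (\<Sum>i=0..m. c ^ m * of_real (fps_nth ?B i * fps_nth (fps_exp 1 - 1) (m - i)))"
    proof (intro sum.cong refl)
      fix i assume "i \<in> {0..m}"
      then have cm: "c ^ m = c ^ i * c ^ (m - i)" by (simp flip: power_add)
      show "of_real (fps_nth ?B i) * c ^ i * (c ^ (m - i) / fact (m - i) - (if m - i = 0 then 1 else 0)) =
          c ^ m * of_real (fps_nth ?B i * fps_nth (fps_exp 1 - 1) (m - i))"
        unfolding cm by (cases "m - i = 0") (simp_all add: algebra_simps)
    qed
    also have "\<dots> = c ^ m * of_real (fps_nth (?B * (fps_exp 1 - 1)) m)"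
      unfolding fps_mult_nth by (simp add: sum_distrib_left)
    also have "\<dots> = fps_nth (fps_const c * fps_X * fps_exp c) m"
      unfolding B by (cases m) (simp_all add: mult.assoc)
    finally show "fps_nth (Abs_fps (\<lambda>m. of_real (bernoulli_num m / fact m) * c ^ m) * (fps_exp c - 1)) m =
       fps_nth (fps_const c * fps_X * fps_exp c) m" .
  qed
qed

text \<open>By reflection the left side expands pi x e^(-pi i x) / sin(pi x), which is t e^t / (e^t
  - 1) at t = -2 pi i x. The comparison takes place after multiplication by e^t - 1, a nonzero
  series that is then cancelled.\<close>

lemma bernoulli_gamma:
  "P_fps_neg * P_fps zeta_seq * fps_exp (- of_real pi * \<i>) =
     Abs_fps (\<lambda>m. of_real (bernoulli_num m / fact m) * (- 2 * of_real pi * \<i>) ^ m)"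
proof -
  let ?c = "- 2 * of_real pi * \<i>" and ?d = "- of_real pi * \<i>"
  have 1: "(\<lambda>x. gamma_reg (- x) * gamma_reg x * exp (?d * x) * (exp (?c * x) - 1)) has_fps_expansion
      (P_fps_neg * P_fps zeta_seq * fps_exp ?d * (fps_exp ?c - 1))"
    by (intro has_fps_expansion_mult has_fps_expansion_diff P_fps_neg_expansion gamma_reg_expansion
        has_fps_expansion_exp has_fps_expansion_1)
  have 2: "(\<lambda>x. ?c * x * exp (?c * x)) has_fps_expansion (fps_const ?c * fps_X * fps_exp ?c)"
    by (intro has_fps_expansion_mult has_fps_expansion_exp has_fps_expansion_const has_fps_expansion_fps_X)
  have eq: "gamma_reg (- x) * gamma_reg x * exp (?d * x) * (exp (?c * x) - 1) = ?c * x * exp (?c * x)"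
    if "norm x < 1" for x
  proof -
    let ?e = "exp (?d * x)"
    have e: "exp (?c * x) = ?e * ?e" "exp (\<i> * (of_real pi * x)) * ?e = 1" "exp (- (\<i> * (of_real pi * x))) = ?e"
      by (simp_all add: algebra_simps flip: exp_add)
    have "exp (?c * x) - 1 = - 2 * \<i> * sin (of_real pi * x) * ?e"
      unfolding sin_exp_eq e(1,3) using e(2) by (simp add: field_simps)
    then have "gamma_reg (- x) * gamma_reg x * ?e * (exp (?c * x) - 1) =
        - 2 * \<i> * (gamma_reg (- x) * gamma_reg x * sin (of_real pi * x)) * (?e * ?e)" by (simp add: mult_ac)
    then show ?thesis unfolding gamma_reg_reflection[OF that] e(1) by (simp add: mult_ac)
  qed
  have "P_fps_neg * P_fps zeta_seq * fps_exp ?d * (fps_exp ?c - 1) = fps_const ?c * fps_X * fps_exp ?c"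
    by (rule fps_expansion_unique_complex[OF has_fps_expansion_eq_near_0[OF 1, of 1] 2]) (use eq in auto)
  then have "P_fps_neg * P_fps zeta_seq * fps_exp ?d * (fps_exp ?c - 1) =
     Abs_fps (\<lambda>m. of_real (bernoulli_num m / fact m) * ?c ^ m) * (fps_exp ?c - 1)"
    unfolding bernoulli_fps_eq .
  moreover have "fps_exp ?c - 1 \<noteq> 0"
  proof
    assume "fps_exp ?c - 1 = 0"
    then have "fps_nth (fps_exp ?c - 1) 1 = 0" by simp
    then show False by simp
  qed
  ultimately show ?thesis by simp
qed

subsection \<open>The value at the branch point\<close>

text \<open>With Gamma(1+x-y) Gamma(1-x) Gamma(y) taken out, reflection turns the cofactors into
  sines, and what remains is e^(-pi i y) sin(pi x) + sin(pi (y-x)) = e^(-pi i x) sin(pi y). The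
  factors with Euler's constant in \<open>gamma_reg\<close> cancel, as (y - x) + x - y = 0.\<close>

lemma beta_trig_identity:
  fixes x y :: real
  assumes x: "\<bar>x\<bar> < 1/2" and y: "0 < y" "y < 1/2"
  shows "of_real x * exp (- of_real pi * \<i> * of_real y) * of_real (Beta (1 - (y - x)) y)
      + of_real (y - x) * of_real (Beta (1 - x) y)
      = exp (- of_real pi * \<i> * of_real x) * gamma_reg (of_real (y - x)) * gamma_reg (of_real x) * inverse (gamma_reg (of_real y))"
proof -
  define X Y where "X = complex_of_real x" and "Y = complex_of_real y"
  have nX: "norm X < 1/2" and nY: "norm Y < 1/2" using x y by (simp_all add: X_def Y_def)
  have nYX: "norm (Y - X) < 1" using norm_triangle_ineq4[of Y X] nX nY by linarith
  have nXY: "norm (X - Y) < 1" using nYX by (simp add: norm_minus_commute)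
  have nz: "Gamma (1 + X - Y) \<noteq> 0" "Gamma (1 - X) \<noteq> 0" "Gamma (1 - Y) \<noteq> 0" "Gamma (1 + Y - X) \<noteq> 0" "Gamma (1 + X) \<noteq> 0"
    using one_plus_small_nonpos_Ints[of "X - Y"] one_plus_small_nonpos_Ints[of "- X"] one_plus_small_nonpos_Ints[of "- Y"]
      one_plus_small_nonpos_Ints[of "Y - X"] one_plus_small_nonpos_Ints[of X] nX nY nXY nYX
    by (auto simp: Gamma_eq_zero_iff add_diff_eq)
  have Y0: "Y \<noteq> 0" using y by (simp add: Y_def)
  then have nzY: "Gamma Y \<noteq> 0" using nonpos_Ints_small[of Y] nY by (auto simp: Gamma_eq_zero_iff)
  let ?s = "\<lambda>z. sin (of_real pi * z :: complex)"
  have r1: "X * inverse (Gamma (1 + X)) * inverse (Gamma (1 - X)) = ?s X / of_real pi"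
    using rGamma_reflection_complex[of X] rGamma_plus1[of X] by (simp add: add.commute rGamma_inverse_Gamma)
  have r2: "(Y - X) * inverse (Gamma (1 + Y - X)) * inverse (Gamma (1 + X - Y)) = ?s (Y - X) / of_real pi"
    using rGamma_reflection_complex[of "Y - X"] rGamma_plus1[of "Y - X"] by (simp add: algebra_simps rGamma_inverse_Gamma)
  have r3: "inverse (Gamma Y) * inverse (Gamma (1 - Y)) = ?s Y / of_real pi"
    using rGamma_reflection_complex[of Y] by (simp add: rGamma_inverse_Gamma)
  let ?ex = "exp (- of_real pi * \<i> * X)" and ?ey = "exp (- of_real pi * \<i> * Y)"
  have trig: "?ey * ?s X + ?s (Y - X) = ?ex * ?s Y"
  proof -
    have e: "?ex = cos (of_real pi * X) - \<i> * ?s X" "?ey = cos (of_real pi * Y) - \<i> * ?s Y"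
      using exp_Euler[of "- (of_real pi * X)"] exp_Euler[of "- (of_real pi * Y)"] by (simp_all add: mult_ac)
    show ?thesis unfolding e right_diff_distrib sin_diff by (simp add: algebra_simps)
  qed
  have "X * ?ey * (Gamma (1 - (Y - X)) * Gamma Y / Gamma (1 - (Y - X) + Y))
      + (Y - X) * (Gamma (1 - X) * Gamma Y / Gamma (1 - X + Y))
      = Gamma (1 + X - Y) * Gamma (1 - X) * Gamma Y *
        (?ey * (X * inverse (Gamma (1 + X)) * inverse (Gamma (1 - X)))
         + (Y - X) * inverse (Gamma (1 + Y - X)) * inverse (Gamma (1 + X - Y)))"
  proof -
    have "1 - (Y - X) = 1 + X - Y" "1 + X - Y + Y = 1 + X" "1 - X + Y = 1 + Y - X" by simp_all
    then show ?thesis using nz by (simp add: field_simps)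
  qed
  also have "\<dots> = Gamma (1 + X - Y) * Gamma (1 - X) * Gamma Y * ((?ey * ?s X + ?s (Y - X)) / of_real pi)"
    unfolding r1 r2 by (simp add: add_divide_distrib)
  also have "\<dots> = Gamma (1 + X - Y) * Gamma (1 - X) * Gamma Y * (?ex * (inverse (Gamma Y) * inverse (Gamma (1 - Y))))"
    unfolding trig r3 by simp
  also have "\<dots> = ?ex * Gamma (1 + X - Y) * Gamma (1 - X) * inverse (Gamma (1 - Y))"
    using nzY by (simp add: field_simps)
  also have "\<dots> = ?ex * gamma_reg (Y - X) * gamma_reg X * inverse (gamma_reg Y)"
  proof -
    let ?g = "euler_mascheroni :: complex"
    have "exp (- (?g * (Y - X))) * exp (- (?g * X)) * inverse (exp (- (?g * Y))) = 1"
      by (simp add: algebra_simps flip: exp_minus exp_add)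
    moreover have "?ex * gamma_reg (Y - X) * gamma_reg X * inverse (gamma_reg Y) =
        ?ex * Gamma (1 + X - Y) * Gamma (1 - X) * inverse (Gamma (1 - Y)) *
        (exp (- (?g * (Y - X))) * exp (- (?g * X)) * inverse (exp (- (?g * Y))))"
      by (simp add: gamma_reg_def diff_diff_eq2 mult_ac)
    ultimately show ?thesis by simp
  qed
  finally show ?thesis
    unfolding X_def Y_def by (simp add: Beta_def flip: Gamma_complex_of_real)
qed

section \<open>Series, boundary values and continuation of the incomplete beta function\<close>

section \<open>Incomplete beta functions\<close>

text \<open>The coefficient of t^k in (1 - t)^(b-1), which is also the product of 1 - b/i over i =
  1, ..., k.\<close>

definition binom_coeff :: "real \<Rightarrow> nat \<Rightarrow> real" where "binom_coeff b k = pochhammer (1 - b) k / fact k"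

lemma binom_coeff_0 [simp]: "binom_coeff b 0 = 1" by (simp add: binom_coeff_def)

lemma binom_coeff_Suc: "binom_coeff b (Suc k) = binom_coeff b k * (1 - b / real (Suc k))"
proof -
  have "real (Suc k) * (1 - b / real (Suc k)) = 1 - b + real k" by (simp add: field_simps)
  then have "1 - b / real (Suc k) = (1 - b + real k) / real (Suc k)"
    by (simp add: eq_divide_eq mult.commute del: of_nat_Suc)
  then show ?thesis by (simp add: binom_coeff_def pochhammer_Suc del: of_nat_Suc)
qed

lemma binom_coeff_bounds:
  assumes "0 < b" "b < 1" shows "0 \<le> binom_coeff b k \<and> binom_coeff b k \<le> 1"
proof (induction k)
  case (Suc k)
  have "b / real (Suc k) \<le> b / 1" using assms by (intro divide_left_mono) auto
  then have "0 \<le> 1 - b / real (Suc k)" "1 - b / real (Suc k) \<le> 1" using assms by auto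
  then show ?case unfolding binom_coeff_Suc using Suc by (simp add: mult_le_one del: of_nat_Suc)
qed simp

text \<open>The terms telescope: b c_k / (k+1) = c_k - c_(k+1) for c_k =
  \<open>binom_coeff b k\<close>. The resulting bound 1/b is where b > 0 enters the convergence on
  the unit circle.\<close>

lemma summable_binom_coeff:
  assumes b: "0 < b" "b < 1" shows "summable (\<lambda>k. binom_coeff b k / real (Suc k))"
proof (rule summableI_nonneg_bounded)
  show "0 \<le> binom_coeff b k / real (Suc k)" for k using binom_coeff_bounds[OF b] by simp
  fix n
  have "b * (\<Sum>k<n. binom_coeff b k / real (Suc k)) = 1 - binom_coeff b n"
    by (induction n) (simp_all add: binom_coeff_Suc algebra_simps del: of_nat_Suc)
  then have "b * (\<Sum>k<n. binom_coeff b k / real (Suc k)) \<le> 1" using binom_coeff_bounds[OF b, of n] by linarith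
  then show "(\<Sum>k<n. binom_coeff b k / real (Suc k)) \<le> 1 / b" using b by (simp add: field_simps)
qed

lemma gbinomial_binom_coeff: "((b - 1) gchoose k) = (- 1) ^ k * binom_coeff b k"
  by (simp add: gbinomial_pochhammer binom_coeff_def)

lemma binom_coeff_sums_real:
  assumes "\<bar>t\<bar> < 1" shows "(\<lambda>k. binom_coeff b k * t ^ k) sums (1 - t) powr (b - 1)"
proof -
  have "(\<lambda>k. ((b - 1) gchoose k) * (- t) ^ k) sums (1 + - t) powr (b - 1)"
    by (rule gen_binomial_real) (use assms in simp)
  moreover have "((b - 1) gchoose k) * (- t) ^ k = binom_coeff b k * t ^ k" for k
  proof -
    have "((b - 1) gchoose k) * (- t) ^ k = binom_coeff b k * ((- 1) ^ k * (- t) ^ k)"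
      unfolding gbinomial_binom_coeff by (simp only: mult_ac)
    also have "(- 1) ^ k * (- t) ^ k = t ^ k" by (simp flip: power_mult_distrib)
    finally show ?thesis .
  qed
  ultimately show ?thesis by simp
qed

lemma binom_coeff_sums_complex:
  assumes "norm z < 1" shows "(\<lambda>k. complex_of_real (binom_coeff b k) * z ^ k) sums (1 - z) powr (of_real b - 1)"
proof -
  have "(\<lambda>k. ((of_real b - 1) gchoose k) * (- z) ^ k) sums (1 + - z) powr (of_real b - 1)"
    by (rule gen_binomial_complex) (use assms in simp)
  moreover have "((complex_of_real b - 1) gchoose k) * (- z) ^ k = of_real (binom_coeff b k) * z ^ k" for k
  proof -
    have "pochhammer (1 - complex_of_real b) k = of_real (pochhammer (1 - b) k)"
      using pochhammer_of_real[of "1 - b" k] by simp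
    then have "((complex_of_real b - 1) gchoose k) = (- 1) ^ k * of_real (binom_coeff b k)"
      by (simp add: gbinomial_pochhammer binom_coeff_def)
    then have "((complex_of_real b - 1) gchoose k) * (- z) ^ k = of_real (binom_coeff b k) * ((- 1) ^ k * (- z) ^ k)"
      by (simp only: mult_ac)
    also have "(- 1) ^ k * (- z) ^ k = z ^ k" by (simp flip: power_mult_distrib)
    finally show ?thesis .
  qed
  ultimately show ?thesis by simp
qed

text \<open>Integrating c_k t^(k-a) and multiplying by z^a yields c_k z^(k+1) / (k+1-a), whence n =
  k + 1 and no constant term.\<close>

definition ibeta_coeff :: "real \<Rightarrow> real \<Rightarrow> nat \<Rightarrow> real" where
  "ibeta_coeff a b n = (if n = 0 then 0 else binom_coeff b (n - 1) / (real n - a))"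

text \<open>The series of \<open>z\<^sup>a \<integral> t\<^bsup>-a\<^esup> (1 - t)\<^bsup>b-1\<^esup> dt\<close>, integrated from \<open>0\<close> to \<open>z\<close>. Unlike the integrand it is
  free of branches in \<open>z\<close>, and it converges on the whole closed unit disc.\<close>

definition ibeta :: "real \<Rightarrow> real \<Rightarrow> 'a::{real_normed_field, banach} \<Rightarrow> 'a" where
  "ibeta a b z = (\<Sum>n. of_real (ibeta_coeff a b n) * z ^ n)"

lemma summable_ibeta_coeff:
  assumes a: "\<bar>a\<bar> \<le> 1/2" and b: "0 < b" "b < 1"
  shows "summable (\<lambda>n. \<bar>ibeta_coeff a b n\<bar>)"
proof -
  have "summable (\<lambda>k. \<bar>ibeta_coeff a b (Suc k)\<bar>)"
  proof (rule summable_comparison_test')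
    show "summable (\<lambda>k. 2 * (binom_coeff b k / real (Suc k)))" by (intro summable_mult summable_binom_coeff b)
    fix k :: nat
    have "real (Suc k) \<le> 2 * (real (Suc k) - a)" using a by simp
    then have "1 / (real (Suc k) - a) \<le> 2 / real (Suc k)" using a by (simp add: field_simps)
    then have "binom_coeff b k * (1 / (real (Suc k) - a)) \<le> binom_coeff b k * (2 / real (Suc k))"
      using binom_coeff_bounds[OF b, of k] by (intro mult_left_mono) auto
    moreover have "0 < real (Suc k) - a" using a by simp
    ultimately show "norm \<bar>ibeta_coeff a b (Suc k)\<bar> \<le> 2 * (binom_coeff b k / real (Suc k))"
      using binom_coeff_bounds[OF b, of k] by (simp add: ibeta_coeff_def mult.commute del: of_nat_Suc)
  qed
  then show ?thesis by (subst (asm) summable_Suc_iff)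
qed

lemma powser_abs_summable:
  fixes c :: "nat \<Rightarrow> 'a::{real_normed_field, banach}"
  assumes c: "summable (\<lambda>n. norm (c n))" and z: "norm z \<le> 1"
  shows "summable (\<lambda>n. norm (c n * z ^ n))"
proof (rule summable_comparison_test'[OF c])
  fix n :: nat
  have "norm z ^ n \<le> 1" using z by (intro power_le_one) auto
  then show "norm (norm (c n * z ^ n)) \<le> norm (c n)" by (simp add: norm_mult norm_power mult_left_le)
qed

lemma powser_continuous_cball:
  fixes c :: "nat \<Rightarrow> 'a::{real_normed_field, banach}"
  assumes c: "summable (\<lambda>n. norm (c n))"
  shows "continuous_on (cball 0 1) (\<lambda>z. \<Sum>n. c n * z ^ n)"
proof (rule uniform_limit_theorem[OF _ Weierstrass_m_test[OF _ c]])
  show "\<forall>\<^sub>F n in sequentially. continuous_on (cball 0 1) (\<lambda>z. \<Sum>i<n. c i * z ^ i)"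
    by (intro always_eventually allI continuous_intros)
  fix n and z :: 'a assume "z \<in> cball 0 1"
  then have "norm z ^ n \<le> 1" by (intro power_le_one) auto
  then show "norm (c n * z ^ n) \<le> norm (c n)" by (simp add: norm_mult norm_power mult_left_le)
qed simp

text \<open>Carries an identity from the open disc to a boundary point along the radius.\<close>

lemma radial_eq:
  fixes f g :: "complex \<Rightarrow> complex"
  assumes z: "z \<in> A" and t: "\<And>t. 0 < t \<Longrightarrow> t < 1 \<Longrightarrow> of_real t * z \<in> A \<and> f (of_real t * z) = g (of_real t * z)"
    and f: "continuous_on A f" and g: "continuous_on A g"
  shows "f z = g z"
proof -
  have l: "((\<lambda>t. of_real t * z) \<longlongrightarrow> of_real 1 * z) (at_left 1)"
    by (intro tendsto_intros)
  have ev: "\<forall>\<^sub>F t in at_left 1. 0 < t \<and> t < (1::real)"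
    using eventually_at_left_real[of 0 "1::real"] by simp
  have evA: "\<forall>\<^sub>F t in at_left 1. of_real t * z \<in> A" by (rule eventually_mono[OF ev]) (use t in blast)
  have 1: "((\<lambda>t. f (of_real t * z)) \<longlongrightarrow> f (of_real 1 * z)) (at_left 1)"
    using continuous_on_tendsto_compose[OF f l _ evA] z by simp
  have 2: "((\<lambda>t. g (of_real t * z)) \<longlongrightarrow> g (of_real 1 * z)) (at_left 1)"
    using continuous_on_tendsto_compose[OF g l _ evA] z by simp
  have "\<forall>\<^sub>F t in at_left 1. f (of_real t * z) = g (of_real t * z)" by (rule eventually_mono[OF ev]) (use t in blast)
  from Lim_transform_eventually[OF 1 this] have "((\<lambda>t. g (of_real t * z)) \<longlongrightarrow> f (of_real 1 * z)) (at_left 1)" .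
  from tendsto_unique[OF _ this 2] show ?thesis by simp
qed

context
  fixes a b :: real
  assumes a: "\<bar>a\<bar> \<le> 1/2" and b: "0 < b" "b < 1"
begin

lemma summable_ibeta_coeff_norm: "summable (\<lambda>n. norm (of_real (ibeta_coeff a b n) :: 'a::{real_normed_field, banach}))"
  using summable_ibeta_coeff[OF a b] by simp

lemma ibeta_continuous: "continuous_on (cball 0 1) (ibeta a b :: 'a::{real_normed_field, banach} \<Rightarrow> 'a)"
  unfolding ibeta_def[abs_def] by (rule powser_continuous_cball[OF summable_ibeta_coeff_norm])

text \<open>The operator z d/dz - a multiplies the n-th coefficient by n - a and so cancels the
  denominator. The binomial sum \<open>B\<close> is left abstract to serve both real and complex
  arguments.\<close>

lemma ibeta_deriv:
  fixes z :: "'a::{real_normed_field, banach}"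
  assumes z: "norm z < 1" and s: "(\<lambda>k. of_real (binom_coeff b k) * z ^ k) sums B"
  obtains D where "(ibeta a b has_field_derivative D) (at z)" "z * D - of_real a * ibeta a b z = z * B"
proof -
  let ?c = "\<lambda>n. of_real (ibeta_coeff a b n) :: 'a"
  define D where "D = (\<Sum>n. diffs ?c n * z ^ n)"
  have s1: "summable (\<lambda>n. ?c n * 1 ^ n)" using summable_norm_cancel[OF powser_abs_summable[OF summable_ibeta_coeff_norm, of 1]] by simp
  have 1: "(ibeta a b has_field_derivative D) (at z)"
    unfolding ibeta_def[abs_def] D_def by (rule termdiffs_strong[OF s1]) (use z in simp)
  obtain K where K: "norm z < K" "K < 1" using z dense by blast
  have "0 < K" using K(1) norm_ge_zero[of z] by linarith
  have "summable (\<lambda>n. diffs ?c n * z ^ n)"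
  proof (rule termdiff_converges[where K = 1])
    show "norm z < 1" by (rule z)
    show "summable (\<lambda>n. ?c n * x ^ n)" if "norm x < 1" for x :: 'a
      using summable_norm_cancel[OF powser_abs_summable[OF summable_ibeta_coeff_norm, of x]] that by simp
  qed
  then have "(\<lambda>n. z * (diffs ?c n * z ^ n)) sums (z * D)" unfolding D_def by (intro sums_mult summable_sums)
  then have "(\<lambda>n. of_nat (Suc n) * ?c (Suc n) * z ^ Suc n) sums (z * D)" by (simp add: diffs_def mult_ac del: of_nat_Suc)
  then have zD: "(\<lambda>n. of_nat n * ?c n * z ^ n) sums (z * D)" by (subst (asm) sums_Suc_iff) simp
  have "(\<lambda>n. ?c n * z ^ n) sums ibeta a b z"
    unfolding ibeta_def using summable_norm_cancel[OF powser_abs_summable[OF summable_ibeta_coeff_norm, of z]] z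
    by (intro summable_sums) simp
  from sums_diff[OF zD sums_mult[OF this, of "of_real a"]]
  have L: "(\<lambda>n. of_nat n * ?c n * z ^ n - of_real a * (?c n * z ^ n)) sums (z * D - of_real a * ibeta a b z)" .
  have e: "of_nat (Suc n) * ?c (Suc n) * z ^ Suc n - of_real a * (?c (Suc n) * z ^ Suc n) = z * (of_real (binom_coeff b n) * z ^ n)" for n
  proof -
    have "(real (Suc n) - a) * ibeta_coeff a b (Suc n) = binom_coeff b n" using a by (simp add: ibeta_coeff_def)
    then have "of_real (real (Suc n) - a) * ?c (Suc n) = (of_real (binom_coeff b n) :: 'a)" by (metis of_real_mult)
    then have "(of_nat (Suc n) - of_real a) * ?c (Suc n) = (of_real (binom_coeff b n) :: 'a)" by (simp del: of_nat_Suc)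
    moreover have "of_nat (Suc n) * ?c (Suc n) * z ^ Suc n - of_real a * (?c (Suc n) * z ^ Suc n)
        = ((of_nat (Suc n) - of_real a) * ?c (Suc n)) * z ^ Suc n"
      by (simp only: left_diff_distrib mult.assoc)
    ultimately have "of_nat (Suc n) * ?c (Suc n) * z ^ Suc n - of_real a * (?c (Suc n) * z ^ Suc n) = of_real (binom_coeff b n) * z ^ Suc n"
      by (simp only:)
    then show ?thesis by (simp only: power_Suc mult.left_commute)
  qed
  let ?F = "\<lambda>n. of_nat n * ?c n * z ^ n - of_real a * (?c n * z ^ n)"
  have "?F 0 = 0" by (simp add: ibeta_coeff_def)
  then have "?F sums (z * D - of_real a * ibeta a b z + ?F 0)" using L by (simp only: add_0_right)
  then have "(\<lambda>n. ?F (Suc n)) sums (z * D - of_real a * ibeta a b z)" using sums_Suc_iff[of ?F] by blast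
  then have "(\<lambda>n. z * (of_real (binom_coeff b n) * z ^ n)) sums (z * D - of_real a * ibeta a b z)" by (simp only: e)
  then have "z * D - of_real a * ibeta a b z = z * B" using sums_mult[OF s, of z] sums_unique2 by blast
  then show ?thesis using that[OF 1] by blast
qed

lemma ibeta_1_real: "ibeta a b (1::real) = Beta (1 - a) b"
proof -
  \<comment> \<open>\<open>J t\<close> is the integral from 0 to t itself. As a series with
    exponents n - a > 0 it is continuous on the closed interval, so differentiability inside
    suffices for the fundamental theorem.\<close>
  define J where "J = (\<lambda>t::real. \<Sum>n. ibeta_coeff a b n * t powr (real n - a))"
  have Jeq: "J t = t powr (- a) * ibeta a b t" if "0 < t" "t \<le> 1" for t
  proof -
    have "summable (\<lambda>n. ibeta_coeff a b n * t ^ n)"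
      using summable_norm_cancel[OF powser_abs_summable[OF summable_ibeta_coeff_norm, of t]] that by simp
    then have "t powr (- a) * ibeta a b t = (\<Sum>n. t powr (- a) * (ibeta_coeff a b n * t ^ n))"
      unfolding ibeta_def by (simp add: suminf_mult)
    also have "\<dots> = J t" unfolding J_def
      using that by (intro suminf_cong) (simp add: powr_diff powr_minus powr_realpow field_simps)
    finally show ?thesis by simp
  qed
  have cont: "continuous_on {0..1} J"
    unfolding J_def
  proof (rule uniform_limit_theorem[OF _ Weierstrass_m_test[OF _ summable_ibeta_coeff[OF a b]]])
    have t: "continuous_on {0..1} (\<lambda>t. ibeta_coeff a b n * t powr (real n - a))" for n
    proof (cases "n = 0")
      case False
      then have "0 < real n - a" using a by (cases n) auto
      then show ?thesis by (intro continuous_intros continuous_on_powr') auto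
    qed (simp add: ibeta_coeff_def)
    then show "\<forall>\<^sub>F n in sequentially. continuous_on {0..1} (\<lambda>t. \<Sum>i<n. ibeta_coeff a b i * t powr (real i - a))"
      by (intro always_eventually allI continuous_on_sum) auto
    fix n and t :: real assume t: "t \<in> {0..1}"
    show "norm (ibeta_coeff a b n * t powr (real n - a)) \<le> \<bar>ibeta_coeff a b n\<bar>"
    proof (cases "n = 0")
      case False
      then have "0 < real n - a" using a by (cases n) auto
      then have "t powr (real n - a) \<le> 1" using t powr_mono2[of "real n - a" t 1] by simp
      then show ?thesis by (simp add: abs_mult mult_left_le)
    qed (simp add: ibeta_coeff_def)
  qed simp
  have deriv: "(J has_vector_derivative t powr (1 - a - 1) * (1 - t) powr (b - 1)) (at t)" if t: "t \<in> {0<..<1}" for t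
  proof -
    have tt: "0 < t" "t < 1" "norm t < 1" using t by auto
    obtain D where D: "(ibeta a b has_field_derivative D) (at t)" "t * D - of_real a * ibeta a b t = t * (1 - t) powr (b - 1)"
      using ibeta_deriv[OF tt(3), of "(1 - t) powr (b - 1)"] binom_coeff_sums_real[of t b] tt by auto
    have "((\<lambda>t. t powr (- a) * ibeta a b t) has_field_derivative
       (- a * t powr (- a - 1)) * ibeta a b t + D * t powr (- a)) (at t)"
      by (rule DERIV_mult[OF _ D(1)]) (use tt in \<open>auto intro!: derivative_eq_intros\<close>)
    also have "(- a * t powr (- a - 1)) * ibeta a b t + D * t powr (- a) = t powr (- a - 1) * (t * D - a * ibeta a b t)"
      using tt by (simp add: powr_diff field_simps)
    also have "\<dots> = (t powr (- a - 1) * t) * (1 - t) powr (b - 1)" using D(2) by simp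
    also have "t powr (- a - 1) * t = t powr (- a)" using tt by (simp add: powr_diff)
    finally have "((\<lambda>t. t powr (- a) * ibeta a b t) has_field_derivative t powr (- a) * (1 - t) powr (b - 1)) (at t)" .
    then have "(J has_field_derivative t powr (- a) * (1 - t) powr (b - 1)) (at t)"
      by (rule has_field_derivative_transform_within_open[of _ _ _ "{0<..<1}"]) (use t Jeq in auto)
    then show ?thesis by (simp add: has_real_derivative_iff_has_vector_derivative)
  qed
  have "((\<lambda>t. t powr (1 - a - 1) * (1 - t) powr (b - 1)) has_integral (J 1 - J 0)) {0..1}"
    by (rule fundamental_theorem_of_calculus_interior[OF _ cont deriv]) auto
  moreover have "((\<lambda>t. t powr (1 - a - 1) * (1 - t) powr (b - 1)) has_integral Beta (1 - a) b) {0..1}"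
    by (rule has_integral_Beta_real) (use a b in auto)
  ultimately have "J 1 - J 0 = Beta (1 - a) b" by (rule has_integral_unique)
  moreover have "J 0 = 0" by (simp add: J_def)
  moreover have "J 1 = ibeta a b 1" using Jeq[of 1] by simp
  ultimately show ?thesis by simp
qed

lemma ibeta_1_complex: "ibeta a b (1::complex) = of_real (Beta (1 - a) b)"
proof -
  have "summable (\<lambda>n. ibeta_coeff a b n)"
    using summable_norm_cancel[OF summable_ibeta_coeff_norm[where 'a = real]] by simp
  then have "ibeta a b (1::complex) = of_real (ibeta a b (1::real))"
    unfolding ibeta_def by (simp add: suminf_of_real)
  then show ?thesis by (simp add: ibeta_1_real)
qed

text \<open>Outside the disc the series is replaced by a primitive of t^(-a) (1 - t)^(b-1), which
  exists by convexity. The additive constant is found in the open disc; as \<open>S\<close> is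
  closed under positive scaling, radii stay inside \<open>S\<close> and carry the equality to the
  circle.\<close>

lemma ibeta_half_plane:
  assumes S: "open S" "convex S" "\<And>z. z \<in> S \<Longrightarrow> Im z \<noteq> 0" "\<And>z t. z \<in> S \<Longrightarrow> 0 < t \<Longrightarrow> of_real t * z \<in> S"
  obtains Q where "\<And>z. z \<in> S \<Longrightarrow> (Q has_field_derivative exp (- (of_real a * Ln z)) * (1 - z) powr (of_real b - 1)) (at z)"
    "\<And>z. z \<in> S \<Longrightarrow> norm z \<le> 1 \<Longrightarrow> Q z = exp (- (of_real a * Ln z)) * ibeta a b z"
proof -
  let ?h = "\<lambda>z. exp (- (of_real a * Ln z)) * (1 - z) powr (of_real b - 1)"
  let ?g = "\<lambda>z. exp (- (of_real a * Ln z)) * ibeta a b z"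
  have np: "z \<notin> \<real>\<^sub>\<le>\<^sub>0" "1 - z \<notin> \<real>\<^sub>\<le>\<^sub>0" "z \<noteq> 0" if "z \<in> S" for z
    using S(3)[OF that] by (auto simp: complex_nonpos_Reals_iff)
  have hol: "?h holomorphic_on S" by (intro holomorphic_intros) (use np in auto)
  have "\<exists>Q0. \<forall>z\<in>S. (Q0 has_field_derivative ?h z) (at z within S)"
    by (rule holomorphic_convex_primitive'[OF S(2,1) hol]) blast
  then obtain Q0 where Q0: "\<And>z. z \<in> S \<Longrightarrow> (Q0 has_field_derivative ?h z) (at z within S)" by blast
  have Q0': "(Q0 has_field_derivative ?h z) (at z)" if "z \<in> S" for z
    using Q0[OF that] at_within_open[OF that S(1)] by simp
  have g: "(?g has_field_derivative ?h z) (at z)" if z: "z \<in> S" "norm z < 1" for z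
  proof -
    obtain D where D: "(ibeta a b has_field_derivative D) (at z)" "z * D - of_real a * ibeta a b z = z * (1 - z) powr (of_real b - 1)"
      using ibeta_deriv[OF z(2) binom_coeff_sums_complex[OF z(2)]] by metis
    let ?e = "exp (- (of_real a * Ln z))"
    have "((\<lambda>z. exp (- (of_real a * Ln z))) has_field_derivative - (of_real a / z) * ?e) (at z)"
      using np[OF z(1)] by (auto intro!: derivative_eq_intros simp: field_simps)
    from DERIV_mult[OF this D(1)]
    have "(?g has_field_derivative (- (of_real a / z) * ?e) * ibeta a b z + D * ?e) (at z)" .
    moreover have "(- (of_real a / z) * ?e) * ibeta a b z + D * ?e = ?e * ((z * D - of_real a * ibeta a b z) / z)"
      using np[OF z(1)] by (simp add: field_simps)
    ultimately show ?thesis unfolding D(2) using np[OF z(1)] by simp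
  qed
  have "convex (S \<inter> ball 0 1)" by (intro convex_Int S convex_ball)
  moreover have "((\<lambda>z. Q0 z - ?g z) has_field_derivative 0) (at z within S \<inter> ball 0 1)" if "z \<in> S \<inter> ball 0 1" for z
    using DERIV_diff[OF Q0' g, of z] that by (auto intro: has_field_derivative_at_within)
  ultimately have "\<exists>c. \<forall>z\<in>S \<inter> ball 0 1. Q0 z - ?g z = c"
    by (rule has_field_derivative_zero_constant)
  then obtain c where c: "\<And>z. z \<in> S \<Longrightarrow> norm z < 1 \<Longrightarrow> Q0 z - ?g z = c" by auto
  define Q where "Q = (\<lambda>z. Q0 z - c)"
  have Q: "(Q has_field_derivative ?h z) (at z)" if "z \<in> S" for z
    using DERIV_diff[OF Q0'[OF that] DERIV_const[of c]] by (simp add: Q_def)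
  have "Q z = ?g z" if z: "z \<in> S" "norm z \<le> 1" for z
  proof (rule radial_eq[where A = "S \<inter> cball 0 1" and f = Q and g = ?g])
    show "continuous_on (S \<inter> cball 0 1) Q"
      using Q by (meson DERIV_isCont IntD1 continuous_at_imp_continuous_on)
    have "continuous_on (S \<inter> cball 0 1) (\<lambda>z. exp (- (of_real a * Ln z)))"
      by (intro continuous_intros) (use np in auto)
    moreover have "continuous_on (S \<inter> cball 0 1) (ibeta a b :: complex \<Rightarrow> complex)"
      by (rule continuous_on_subset[OF ibeta_continuous]) simp
    ultimately show "continuous_on (S \<inter> cball 0 1) ?g" by (rule continuous_on_mult)
    fix t :: real assume t: "0 < t" "t < 1"
    have "norm (of_real t * z) < 1"
    proof -
      have "t * norm z \<le> t" using t z(2) by (simp add: mult_left_le)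
      then have "t * norm z < 1" using t by linarith
      then show ?thesis using t by (simp add: norm_mult)
    qed
    then show "of_real t * z \<in> S \<inter> cball 0 1 \<and> Q (of_real t * z) = ?g (of_real t * z)"
      using S(4)[OF z(1) t(1)] c[of "of_real t * z"] by (auto simp: Q_def algebra_simps)
  qed (use z in auto)
  then show ?thesis using that[OF Q] by blast
qed

end

text \<open>For a = 0 the integral is elementary. On the unit circle this closed form stands in for
  the series of \<open>Li_hook 0 n\<close>, which do not converge absolutely there.\<close>

lemma ibeta_0:
  assumes b: "0 < b" "b < 1" and z: "norm z \<le> 1" "z \<noteq> 1"
  shows "ibeta 0 b z = (1 - exp (of_real b * Ln (1 - z))) / of_real b"
proof -
  let ?g = "\<lambda>z. (1 - exp (of_real b * Ln (1 - z))) / complex_of_real b"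
  have np: "1 - w \<notin> \<real>\<^sub>\<le>\<^sub>0" if "norm w \<le> 1" "w \<noteq> 1" for w :: complex
  proof
    assume "1 - w \<in> \<real>\<^sub>\<le>\<^sub>0"
    then have "Im w = 0" "1 \<le> Re w" by (auto simp: complex_nonpos_Reals_iff)
    moreover have "Re w \<le> 1" using complex_Re_le_cmod[of w] that by linarith
    ultimately show False using that(2) by (simp add: complex_eq_iff)
  qed
  have g: "(?g has_field_derivative (1 - w) powr (of_real b - 1)) (at w)" if w: "norm w < 1" for w
  proof -
    have w1: "1 - w \<notin> \<real>\<^sub>\<le>\<^sub>0" "1 - w \<noteq> 0" using np[of w] w by force+
    have "(?g has_field_derivative exp (of_real b * Ln (1 - w)) / (1 - w)) (at w)"
      using w1 b by (auto intro!: derivative_eq_intros simp: field_simps)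
    moreover have "exp (of_real b * Ln (1 - w)) / (1 - w) = (1 - w) powr (of_real b - 1)"
      using w1 by (simp add: powr_def left_diff_distrib exp_diff)
    ultimately show ?thesis by simp
  qed
  have ball: "ibeta 0 b w = ?g w" if w: "norm w < 1" for w :: complex
  proof -
    have I: "\<exists>D. (ibeta 0 b has_field_derivative D) (at x) \<and> x * D = x * (1 - x) powr (of_real b - 1)"
      if "norm x < 1" for x :: complex
      using ibeta_deriv[OF _ b that binom_coeff_sums_complex[OF that], of 0] by auto
    obtain c where c: "\<And>x. x \<in> ball 0 1 \<Longrightarrow> ibeta 0 b x - ?g x = c"
    proof (rule DERIV_zero_connected_constant[of "ball 0 1" "{0}" "\<lambda>x. ibeta 0 b x - ?g x"])
      have "isCont (\<lambda>x. ibeta 0 b x - ?g x) x" if x: "norm x < 1" for x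
      proof -
        obtain D where "(ibeta 0 b has_field_derivative D) (at x)" using I[OF x] by blast
        from DERIV_isCont[OF DERIV_diff[OF this g[OF x]]] show ?thesis .
      qed
      then show "continuous_on (ball 0 1) (\<lambda>x. ibeta 0 b x - ?g x)" by (auto intro!: continuous_at_imp_continuous_on)
      show "\<forall>x\<in>ball 0 1 - {0}. ((\<lambda>x. ibeta 0 b x - ?g x) has_field_derivative 0) (at x)"
      proof
        fix x :: complex assume x: "x \<in> ball 0 1 - {0}"
        then obtain D where D: "(ibeta 0 b has_field_derivative D) (at x)" "x * D = x * (1 - x) powr (of_real b - 1)"
          using I[of x] by auto
        then have "D = (1 - x) powr (of_real b - 1)" using x by simp
        then show "((\<lambda>x. ibeta 0 b x - ?g x) has_field_derivative 0) (at x)"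
          using DERIV_diff[OF D(1) g[of x]] x by simp
      qed
    qed auto
    have "ibeta 0 b w - ?g w = ibeta 0 b 0 - ?g 0" using c[of w] c[of 0] w by simp
    moreover have "ibeta 0 b (0::complex) = 0"
    proof -
      have "(\<lambda>n. of_real (ibeta_coeff 0 b n) * (0::complex) ^ n) = (\<lambda>n. 0)" by (auto simp: ibeta_coeff_def power_0_left)
      then show ?thesis by (simp add: ibeta_def)
    qed
    ultimately show ?thesis by simp
  qed
  show ?thesis
  proof (rule radial_eq[where A = "cball 0 1 - {1}" and f = "ibeta 0 b" and g = ?g])
    show "continuous_on (cball 0 1 - {1}) (ibeta 0 b :: complex \<Rightarrow> complex)"
      by (rule continuous_on_subset[OF ibeta_continuous]) (use b in auto)
    show "continuous_on (cball 0 1 - {1}) ?g" by (intro continuous_intros) (use np b in auto)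
    fix t :: real assume t: "0 < t" "t < 1"
    have n: "norm (of_real t * z) < 1"
    proof -
      have "t * norm z \<le> t" using t z(1) by (simp add: mult_left_le)
      then have "t * norm z < 1" using t by linarith
      then show ?thesis using t by (simp add: norm_mult)
    qed
    then have "of_real t * z \<noteq> 1" by auto
    then show "of_real t * z \<in> cball 0 1 - {1} \<and> ibeta 0 b (of_real t * z) = ?g (of_real t * z)"
      using n ball[OF n] by simp
  qed (use z in auto)
qed

section \<open>Polylogarithms as coefficients of the beta series\<close>

section \<open>Double series of the incomplete beta function on the unit circle\<close>

text \<open>The n-th elementary symmetric polynomial of 1, 1/2, ..., 1/(m-1), for m >= 1.\<close>

definition esym :: "nat \<Rightarrow> nat \<Rightarrow> real" where
  "esym n m = (\<Sum>j<m. mpl_coeff (replicate n 1) j)"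

lemma mpl_coeff_hook: "mpl_coeff (Suc q # replicate n 1) m = (if m = 0 then 0 else esym n m / real m ^ Suc q)"
  by (simp add: esym_def)

lemma esym_nonneg: "0 \<le> esym n m"
  unfolding esym_def by (intro sum_nonneg mpl_coeff_nonneg)

lemma esym_0: "esym 0 m = (if m = 0 then 0 else 1)"
proof (induction m)
  case (Suc m) then show ?case by (simp add: esym_def)
qed (simp add: esym_def)

lemma esym_Suc_Suc: "esym (Suc n) (Suc m) = esym (Suc n) m + esym n m / real m"
  by (simp add: esym_def)

text \<open>At t = -b the product is \<open>binom_coeff b m\<close>, which links the polylogarithms
  of index (q+1, 1, ..., 1) with the beta series.\<close>

lemma esym_has_sum: "((\<lambda>n. of_real (esym n (Suc m)) * t ^ n) has_sum (\<Prod>i<m. 1 + t / of_nat (Suc i))) UNIV"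
  for t :: complex
proof (induction m)
  case 0
  have "esym n (Suc 0) = (if n = 0 then 1 else 0)" for n
    by (cases n) (simp_all add: esym_0 esym_Suc_Suc, simp add: esym_def)
  then have "((\<lambda>n. of_real (esym n (Suc 0)) * t ^ n) has_sum 1) UNIV \<longleftrightarrow> ((\<lambda>n. of_real (esym n (Suc 0)) * t ^ n) has_sum 1) {0}"
    by (intro has_sum_cong_neutral) auto
  moreover have "((\<lambda>n. of_real (esym n (Suc 0)) * t ^ n) has_sum 1) {0}"
    by (rule has_sum_finiteI) (simp_all add: esym_0)
  ultimately show ?case by simp
next
  case (Suc m)
  let ?P = "\<Prod>i<m. 1 + t / of_nat (Suc i)"
  let ?f = "\<lambda>n. of_real (esym n (Suc m)) * t ^ n"
  have "((\<lambda>n. t / of_nat (Suc m) * ?f n) has_sum t / of_nat (Suc m) * ?P) UNIV"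
    by (rule has_sum_cmult_right[OF Suc])
  also have "?this \<longleftrightarrow> ((\<lambda>n. t / of_nat (Suc m) * ?f (n - 1)) has_sum t / of_nat (Suc m) * ?P) {1..}"
    by (rule has_sum_reindex_bij_witness[where i = "\<lambda>n. n - 1" and j = Suc]) auto
  also have "\<dots> \<longleftrightarrow> ((\<lambda>n. if n = 0 then 0 else t / of_nat (Suc m) * ?f (n - 1)) has_sum t / of_nat (Suc m) * ?P) UNIV"
    by (rule has_sum_cong_neutral) auto
  finally have "((\<lambda>n. if n = 0 then 0 else t / of_nat (Suc m) * ?f (n - 1)) has_sum t / of_nat (Suc m) * ?P) UNIV" .
  from has_sum_add[OF Suc this]
  have "((\<lambda>n. ?f n + (if n = 0 then 0 else t / of_nat (Suc m) * ?f (n - 1))) has_sum ?P + t / of_nat (Suc m) * ?P) UNIV" .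
  moreover have "?f n + (if n = 0 then 0 else t / of_nat (Suc m) * ?f (n - 1)) = of_real (esym n (Suc (Suc m))) * t ^ n" for n
  proof (cases n)
    case 0 then show ?thesis by (simp add: esym_0)
  next
    case (Suc k)
    show ?thesis unfolding Suc esym_Suc_Suc[of k "Suc m"] by (simp add: algebra_simps del: of_nat_Suc)
  qed
  moreover have "?P + t / of_nat (Suc m) * ?P = (\<Prod>i<Suc m. 1 + t / of_nat (Suc i))"
    by (simp add: algebra_simps del: of_nat_Suc)
  ultimately show ?case by simp
qed

lemma prod_binom_coeff: "(\<Prod>i<m. 1 + of_real (- b) / of_nat (Suc i)) = complex_of_real (binom_coeff b m)"
  by (induction m) (simp_all add: binom_coeff_Suc del: of_nat_Suc)

text \<open>The product is compared with the telescoping product of sqrt(1 + 1/i); for s <= 1/3 each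
  factor is smaller because (1 + u/3)^2 <= 1 + u on [0,1]. Growth of order sqrt(m) is harmless
  against 1/m^2.\<close>

lemma prod_le_sqrt:
  assumes "0 \<le> s" "s \<le> 1/3"
  shows "(\<Prod>i<m. 1 + s / real (Suc i)) \<le> sqrt (real (Suc m))"
proof (induction m)
  case (Suc m)
  let ?k = "real (Suc m)"
  have k: "1 \<le> ?k" by simp
  define u where "u = 1 / ?k"
  have u: "0 \<le> u" "u \<le> 1" using k by (auto simp: u_def)
  have "s * u \<le> (1/3) * u" using assms u by (intro mult_right_mono) auto
  then have "1 + s / ?k \<le> 1 + u / 3" by (simp add: u_def mult.commute del: of_nat_Suc)
  also have "\<dots> \<le> sqrt (1 + 1 / ?k)"
  proof (rule real_le_rsqrt)
    have "u * u \<le> 1 * u" using u by (intro mult_right_mono) auto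
    moreover have "(1 + u / 3)\<^sup>2 = 1 + 2 / 3 * u + u * u / 9" by (simp add: power2_eq_square algebra_simps)
    ultimately show "(1 + u / 3)\<^sup>2 \<le> 1 + 1 / ?k" unfolding u_def[symmetric] using u by linarith
  qed
  finally have 1: "1 + s / ?k \<le> sqrt (1 + 1 / ?k)" .
  have "(\<Prod>i<Suc m. 1 + s / real (Suc i)) \<le> sqrt ?k * sqrt (1 + 1 / ?k)"
    unfolding prod.lessThan_Suc
    by (intro mult_mono Suc 1) (use assms in \<open>auto intro!: add_nonneg_nonneg\<close>)
  also have "\<dots> = sqrt (real (Suc (Suc m)))" by (simp add: field_simps flip: real_sqrt_mult)
  finally show ?case .
qed simp

text \<open>A single nonnegative term of the generating series at t = 1/3 is bounded by the
  sum.\<close>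

lemma esym_le: "esym n (Suc m) \<le> 3 ^ n * sqrt (real (Suc m))"
proof -
  have "((\<lambda>n. of_real (esym n (Suc m)) * of_real (1/3) ^ n) has_sum complex_of_real (\<Prod>i<m. 1 + (1/3) / real (Suc i))) UNIV"
    using esym_has_sum[of m "of_real (1/3)"] by simp
  then have "((\<lambda>n. complex_of_real (esym n (Suc m) * (1/3) ^ n)) has_sum complex_of_real (\<Prod>i<m. 1 + (1/3) / real (Suc i))) UNIV"
    by (simp only: of_real_mult of_real_power)
  then have "((\<lambda>n. esym n (Suc m) * (1/3) ^ n) has_sum (\<Prod>i<m. 1 + (1/3) / real (Suc i))) UNIV"
    by (subst (asm) has_sum_of_real_iff)
  from finite_sum_le_has_sum[OF this, of "{n}"] have "esym n (Suc m) * (1/3) ^ n \<le> (\<Prod>i<m. 1 + (1/3) / real (Suc i))"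
    using esym_nonneg by simp
  also have "\<dots> \<le> sqrt (real (Suc m))" by (rule prod_le_sqrt) auto
  finally show ?thesis by (simp add: field_simps)
qed

lemma summable_three_halves: "summable (\<lambda>k. sqrt (real (Suc k)) / real (Suc k) ^ 2)"
proof -
  have "summable (\<lambda>k. real (Suc k) powr (- 3 / 2))"
    by (subst summable_Suc_iff) (simp add: summable_real_powr_iff)
  moreover have "real (Suc k) powr (- 3 / 2) = sqrt (real (Suc k)) / real (Suc k) ^ 2" for k
  proof -
    have "real (Suc k) powr (- 3 / 2) = real (Suc k) powr (1 / 2 - 2)" by simp
    also have "\<dots> = real (Suc k) powr (1 / 2) / real (Suc k) powr 2" by (rule powr_diff)
    finally show ?thesis by (simp add: powr_half_sqrt del: of_nat_Suc)
  qed
  ultimately show ?thesis by simp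
qed

text \<open>A first entry of at least 2 leaves terms of order m^(-3/2), so these series converge
  absolutely on the closed disc.\<close>

lemma summable_hook_coeff: "summable (\<lambda>m. norm (complex_of_real (mpl_coeff (Suc (Suc q) # replicate n 1) m)))"
proof -
  have "summable (\<lambda>k. norm (complex_of_real (mpl_coeff (Suc (Suc q) # replicate n 1) (Suc k))))"
  proof (rule summable_comparison_test')
    show "summable (\<lambda>k. 3 ^ n * (sqrt (real (Suc k)) / real (Suc k) ^ 2))"
      by (intro summable_mult summable_three_halves)
    fix k :: nat
    have "esym n (Suc k) / real (Suc k) ^ Suc (Suc q) \<le> esym n (Suc k) / real (Suc k) ^ 2"
      by (intro divide_left_mono power_increasing esym_nonneg) auto
    also have "\<dots> \<le> 3 ^ n * sqrt (real (Suc k)) / real (Suc k) ^ 2"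
      by (intro divide_right_mono esym_le) auto
    finally show "norm (norm (complex_of_real (mpl_coeff (Suc (Suc q) # replicate n 1) (Suc k)))) \<le> 3 ^ n * (sqrt (real (Suc k)) / real (Suc k) ^ 2)"
      unfolding mpl_coeff_hook norm_of_real using esym_nonneg[of n "Suc k"] by (simp add: abs_mult del: of_nat_Suc power_Suc)
  qed
  then show ?thesis by (subst (asm) summable_Suc_iff)
qed

lemma Li_hook_sums:
  assumes z: "norm z \<le> 1" "z \<in> slit"
  shows "(\<lambda>m. of_real (mpl_coeff (Suc (Suc q) # replicate n 1) m) * z ^ m) sums Li_hook (Suc q) n z"
proof -
  let ?c = "\<lambda>m. complex_of_real (mpl_coeff (Suc (Suc q) # replicate n 1) m)"
  have "Li_hook (Suc q) n z = (\<Sum>m. ?c m * z ^ m)"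
  proof (rule radial_eq[where A = "cball 0 1 \<inter> slit" and f = "Li_hook (Suc q) n"])
    show "continuous_on (cball 0 1 \<inter> slit) (Li_hook (Suc q) n)"
      by (rule continuous_on_subset[OF holomorphic_on_imp_continuous_on[OF Li_hook_holomorphic]]) auto
    show "continuous_on (cball 0 1 \<inter> slit) (\<lambda>z. \<Sum>m. ?c m * z ^ m)"
      by (rule continuous_on_subset[OF powser_continuous_cball[OF summable_hook_coeff]]) auto
    fix t :: real assume t: "0 < t" "t < 1"
    have "t * norm z \<le> t" using t z(1) by (simp add: mult_left_le)
    then have "t * norm z < 1" using t by linarith
    then have n: "norm (of_real t * z) < 1" using t by (simp add: norm_mult)
    then have "of_real t * z \<in> cball 0 1 \<inter> slit" using ball_slit by auto
    moreover have "Li_hook (Suc q) n (of_real t * z) = (\<Sum>m. ?c m * (of_real t * z) ^ m)"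
      unfolding Li_hook_def using Li_principal_ball[where ks = "Suc (Suc q) # replicate n 1", OF _ n]
        sums_unique[OF Li_series_sums[where ks = "Suc (Suc q) # replicate n 1", OF _ n]] by simp
    ultimately show "of_real t * z \<in> cball 0 1 \<inter> slit \<and> Li_hook (Suc q) n (of_real t * z) = (\<Sum>m. ?c m * (of_real t * z) ^ m)" by simp
  qed (use z in auto)
  then show ?thesis
    using summable_sums[OF summable_norm_cancel[OF powser_abs_summable[OF summable_hook_coeff z(1)]]] by simp
qed

definition hook_fps :: "complex \<Rightarrow> complex fps fps" where
  "hook_fps z = Abs_fps (\<lambda>q. Abs_fps (\<lambda>n. (- 1) ^ n * Li_hook q n z))"

text \<open>The rows q >= 1 of \<open>hook_fps\<close>, shifted by one: those whose series converge
  absolutely on the unit circle.\<close>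

definition hook_tail_fps :: "complex \<Rightarrow> complex fps fps" where
  "hook_tail_fps z = Abs_fps (\<lambda>q. Abs_fps (\<lambda>n. (- 1) ^ n * Li_hook (Suc q) n z))"

lemma cf_hook_fps: "cf (hook_fps z) q n = (- 1) ^ n * Li_hook q n z"
  by (simp add: hook_fps_def)

text \<open>All contributions of the leading summation index k + 1: a geometric series in
  \<open>A\<close> and the product formula in \<open>B\<close>.\<close>

lemma hook_row:
  fixes A B w :: complex
  assumes A: "norm A < 1"
  shows "((\<lambda>(q, n). A ^ q / of_nat (Suc k) ^ (q + 2) * w * (of_real (esym n (Suc k)) * B ^ n)) has_sum
     (w / (of_nat (Suc k) * (of_nat (Suc k) - A)) * (\<Prod>i<k. 1 + B / of_nat (Suc i)))) UNIV"
proof -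
  let ?k = "of_nat (Suc k) :: complex"
  have k: "1 \<le> norm ?k" unfolding norm_of_nat by simp
  have "norm (A / ?k) = norm A / norm ?k" by (rule norm_divide)
  also have "\<dots> \<le> norm A / 1" using k by (intro frac_le) auto
  finally have n: "norm (A / ?k) < 1" using A by linarith
  have "?k - A \<noteq> 0" using A k by auto
  have "((\<lambda>q. (A / ?k) ^ q) has_sum (1 / (1 - A / ?k))) UNIV"
    by (rule norm_summable_imp_has_sum) (use n in \<open>auto simp: norm_power intro!: geometric_sums summable_geometric\<close>)
  then have "((\<lambda>q. w / ?k\<^sup>2 * (A / ?k) ^ q) has_sum w / ?k\<^sup>2 * (1 / (1 - A / ?k))) UNIV"
    by (rule has_sum_cmult_right)
  from has_sum_mult_complex[OF this esym_has_sum[of k B]]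
  have "((\<lambda>(q, n). w / ?k\<^sup>2 * (A / ?k) ^ q * (of_real (esym n (Suc k)) * B ^ n)) has_sum
     (w / ?k\<^sup>2 * (1 / (1 - A / ?k)) * (\<Prod>i<k. 1 + B / of_nat (Suc i)))) UNIV" by simp
  moreover have "w / ?k\<^sup>2 * (1 / (1 - A / ?k)) = w / (?k * (?k - A))"
    using \<open>?k - A \<noteq> 0\<close> by (simp add: field_simps power2_eq_square del: of_nat_Suc)
  moreover have "w / ?k\<^sup>2 * (A / ?k) ^ q = A ^ q / ?k ^ (q + 2) * w" for q
    by (simp add: power_divide power_add power2_eq_square mult_ac del: of_nat_Suc)
  ultimately show ?thesis by (simp only:)
qed

text \<open>Up to the factor \<open>a\<close>, the difference of the terms of
  \<open>ibeta a b z\<close> and \<open>ibeta 0 b z\<close>, by 1/(n-a) - 1/n = a/(n(n-a)) with n =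
  k + 1.\<close>

definition ibeta_tail :: "real \<Rightarrow> real \<Rightarrow> complex \<Rightarrow> nat \<Rightarrow> complex" where
  "ibeta_tail a b z k = z ^ Suc k / (of_nat (Suc k) * (of_nat (Suc k) - of_real a)) * of_real (binom_coeff b k)"

text \<open>A triple series in k, q, n: summed over (q, n) first it gives the beta tail, summed over
  k first the polylogarithms. Absolute convergence follows from the same closed form with |a|, b and
  |z| in place of a, -b and z, which is of order at most k^(-3/2).\<close>

lemma dps_hook_tail_fps_has_sum:
  assumes a: "\<bar>a\<bar> < 1/3" and b: "0 < b" "b < 1/3" and z: "norm z \<le> 1" "z \<in> slit"
  shows "summable (ibeta_tail a b z)" "(dps_term (hook_tail_fps z) a b has_sum (\<Sum>k. ibeta_tail a b z k)) UNIV"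
proof -
  define g where "g = (\<lambda>(k, (q, n)). of_real a ^ q / of_nat (Suc k) ^ (q + 2) * z ^ Suc k * (of_real (esym n (Suc k)) * of_real (- b) ^ n))"
  have row: "((\<lambda>p. g (k, p)) has_sum ibeta_tail a b z k) UNIV" for k
    using hook_row[of "of_real a" k "z ^ Suc k" "of_real (- b)"] a
    unfolding g_def ibeta_tail_def prod_binom_coeff by (simp add: case_prod_unfold del: of_nat_Suc power_Suc)
  define N where "N = (\<lambda>k. norm z ^ Suc k / (real (Suc k) * (real (Suc k) - \<bar>a\<bar>)) * (\<Prod>i<k. 1 + b / real (Suc i)))"
  have nrow: "((\<lambda>p. norm (g (k, p))) has_sum N k) UNIV" for k
  proof -
    have "((\<lambda>(q, n). complex_of_real \<bar>a\<bar> ^ q / of_nat (Suc k) ^ (q + 2) * of_real (norm z ^ Suc k) * (of_real (esym n (Suc k)) * of_real b ^ n)) has_sum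
      (of_real (norm z ^ Suc k) / (of_nat (Suc k) * (of_nat (Suc k) - of_real \<bar>a\<bar>)) * (\<Prod>i<k. 1 + of_real b / of_nat (Suc i)))) (UNIV :: (nat \<times> nat) set)"
      by (rule hook_row) (use a in simp)
    also have "(\<lambda>(q, n). of_real \<bar>a\<bar> ^ q / of_nat (Suc k) ^ (q + 2) * of_real (norm z ^ Suc k) * (of_real (esym n (Suc k)) * of_real b ^ n))
       = (\<lambda>p. complex_of_real (norm (g (k, p))))"
      using b esym_nonneg[of _ "Suc k"]
      by (auto simp: g_def norm_mult norm_divide norm_power fun_eq_iff simp del: of_nat_Suc power_Suc)
    also have "of_real (norm z ^ Suc k) / (of_nat (Suc k) * (of_nat (Suc k) - of_real \<bar>a\<bar>)) * (\<Prod>i<k. 1 + of_real b / of_nat (Suc i)) = complex_of_real (N k)"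
      by (simp add: N_def)
    finally show ?thesis by (subst (asm) has_sum_of_real_iff)
  qed
  have N_le: "N k \<le> 2 * (sqrt (real (Suc k)) / real (Suc k) ^ 2)" and N_nonneg: "0 \<le> N k" for k
  proof -
    have p: "(\<Prod>i<k. 1 + b / real (Suc i)) \<le> sqrt (real (Suc k))" "0 \<le> (\<Prod>i<k. 1 + b / real (Suc i))"
      using prod_le_sqrt[of b k] b by (auto intro!: prod_nonneg add_nonneg_nonneg)
    have k: "real (Suc k) / 2 \<le> real (Suc k) - \<bar>a\<bar>" "0 < real (Suc k) - \<bar>a\<bar>" using a by auto
    show "0 \<le> N k" unfolding N_def using p(2) k by (intro mult_nonneg_nonneg divide_nonneg_nonneg) auto
    have "norm z ^ Suc k / (real (Suc k) * (real (Suc k) - \<bar>a\<bar>)) \<le> 1 / (real (Suc k) * (real (Suc k) / 2))"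
      using k z(1) by (intro frac_le mult_left_mono power_le_one mult_pos_pos) auto
    also have "\<dots> = 2 / real (Suc k) ^ 2" by (simp add: power2_eq_square)
    finally have "N k \<le> 2 / real (Suc k) ^ 2 * sqrt (real (Suc k))"
      unfolding N_def using p by (intro mult_mono) auto
    then show "N k \<le> 2 * (sqrt (real (Suc k)) / real (Suc k) ^ 2)" by simp
  qed
  have N_sum: "summable N"
    by (rule summable_comparison_test'[OF summable_mult[OF summable_three_halves, of 2]]) (use N_le N_nonneg in auto)
  have "(\<lambda>p. norm (g p)) summable_on UNIV \<times> UNIV"
    by (rule summable_on_SigmaI[OF nrow summable_nonneg_imp_summable_on[OF N_sum N_nonneg]]) auto
  then have gs: "g summable_on UNIV \<times> UNIV" by (rule abs_summable_summable)
  have nI: "norm (ibeta_tail a b z k) \<le> N k" for k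
    by (rule norm_has_sum_bound[OF nrow row])
  have sI: "summable (\<lambda>k. norm (ibeta_tail a b z k))"
    by (rule summable_comparison_test'[OF N_sum]) (use nI in auto)
  then show sum: "summable (ibeta_tail a b z)" by (rule summable_norm_cancel)
  have "(ibeta_tail a b z has_sum (\<Sum>k. ibeta_tail a b z k)) UNIV"
    by (rule norm_summable_imp_has_sum[OF sI summable_sums[OF sum]])
  then have "(g has_sum (\<Sum>k. ibeta_tail a b z k)) (UNIV \<times> UNIV)"
    by (intro has_sum_SigmaI[OF row _ gs])
  then have sw: "((\<lambda>(p, k). g (k, p)) has_sum (\<Sum>k. ibeta_tail a b z k)) (UNIV \<times> UNIV)"
    by (subst (asm) has_sum_swap) (simp add: case_prod_unfold)
  have col: "((\<lambda>k. (\<lambda>(p, k). g (k, p)) (p, k)) has_sum dps_term (hook_tail_fps z) a b p) UNIV" for p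
  proof -
    obtain q n where p: "p = (q, n)" by (cases p)
    have "(\<lambda>k. g (k, p)) summable_on UNIV"
      using summable_on_SigmaD1[of "\<lambda>p k. g (k, p)" UNIV "\<lambda>_. UNIV" p] sw by (auto simp: summable_on_def case_prod_unfold)
    then have *: "((\<lambda>k. g (k, p)) has_sum infsum (\<lambda>k. g (k, p)) UNIV) UNIV" by simp
    have "(\<lambda>k. of_real (mpl_coeff (Suc (Suc q) # replicate n 1) (Suc k)) * z ^ Suc k) sums Li_hook (Suc q) n z"
      using Li_hook_sums[OF z, of q n] by (subst sums_Suc_iff) simp
    from sums_mult[OF this, of "of_real a ^ q * of_real (- b) ^ n"]
    moreover have "of_real a ^ q * of_real (- b) ^ n * (of_real (mpl_coeff (Suc (Suc q) # replicate n 1) (Suc k)) * z ^ Suc k) = g (k, p)" for k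
      unfolding mpl_coeff_hook p g_def by (simp add: divide_inverse mult_ac del: of_nat_Suc power_Suc) (simp add: mult_ac)?
    moreover have "of_real a ^ q * of_real (- b) ^ n * Li_hook (Suc q) n z = dps_term (hook_tail_fps z) a b p"
    proof -
      have "(- complex_of_real b) ^ n = (- 1) ^ n * of_real b ^ n" by (rule power_minus)
      then show ?thesis unfolding p by (simp add: dps_term_def hook_tail_fps_def mult_ac)
    qed
    ultimately have "(\<lambda>k. g (k, p)) sums dps_term (hook_tail_fps z) a b p" by simp
    then have "dps_term (hook_tail_fps z) a b p = infsum (\<lambda>k. g (k, p)) UNIV" using sums_unique2[OF has_sum_imp_sums[OF *]] by metis
    then show ?thesis using * by simp
  qed
  show "(dps_term (hook_tail_fps z) a b has_sum (\<Sum>k. ibeta_tail a b z k)) UNIV"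
    by (rule has_sum_SigmaD[OF sw col])
qed

lemma ibeta_split:
  assumes a: "\<bar>a\<bar> < 1/3" and b: "0 < b" "b < 1/3" and z: "norm z \<le> 1" "z \<in> slit"
  shows "ibeta a b z = ibeta 0 b z + of_real a * (\<Sum>k. ibeta_tail a b z k)"
proof -
  have S: "(\<lambda>k. of_real (ibeta_coeff a b (Suc k)) * z ^ Suc k) sums ibeta a b z" if "\<bar>a\<bar> < 1/3" for a
  proof -
    have "(\<lambda>n. of_real (ibeta_coeff a b n) * z ^ n) sums ibeta a b z"
      unfolding ibeta_def using that b z(1)
      by (intro summable_sums summable_norm_cancel[OF powser_abs_summable[OF summable_ibeta_coeff_norm]]) auto
    then show ?thesis by (subst sums_Suc_iff) (simp add: ibeta_coeff_def)
  qed
  have "(\<lambda>k. of_real (ibeta_coeff 0 b (Suc k)) * z ^ Suc k + of_real a * ibeta_tail a b z k) sums (ibeta 0 b z + of_real a * (\<Sum>k. ibeta_tail a b z k))"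
    by (intro sums_add S sums_mult summable_sums dps_hook_tail_fps_has_sum(1)) (use a b z in auto)
  moreover have "of_real (ibeta_coeff 0 b (Suc k)) * z ^ Suc k + of_real a * ibeta_tail a b z k = of_real (ibeta_coeff a b (Suc k)) * z ^ Suc k" for k
  proof -
    let ?k = "real (Suc k)"
    have nz: "?k - a \<noteq> 0" using a by auto
    have "ibeta_coeff 0 b (Suc k) + a * (binom_coeff b k / (?k * (?k - a))) = ibeta_coeff a b (Suc k)"
      using nz by (simp add: ibeta_coeff_def field_simps del: of_nat_Suc)
    then have "complex_of_real (ibeta_coeff a b (Suc k)) = complex_of_real (ibeta_coeff 0 b (Suc k) + a * (binom_coeff b k / (?k * (?k - a))))"
      by (simp only:)
    also have "\<dots> = of_real (ibeta_coeff 0 b (Suc k)) + of_real a * (of_real (binom_coeff b k) / (of_nat (Suc k) * (of_nat (Suc k) - of_real a)))"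
      by (simp del: of_nat_Suc)
    finally have e: "complex_of_real (ibeta_coeff a b (Suc k)) = of_real (ibeta_coeff 0 b (Suc k)) + of_real a * (of_real (binom_coeff b k) / (of_nat (Suc k) * (of_nat (Suc k) - of_real a)))" .
    show ?thesis unfolding e ibeta_tail_def by (simp add: distrib_right distrib_left mult_ac del: of_nat_Suc power_Suc)
  qed
  ultimately show ?thesis using S[OF a] sums_unique2 by simp
qed

lemma dps_fps_X: "dps fps_X (\<lambda>x y. of_real x)"
proof -
  have "Xs fps_X = fps_X" by (intro fps_ext) (simp add: cf_Xs)
  then show ?thesis using dps_Xs[OF has_fps_expansion_fps_X] by simp
qed

lemma dps_hook_fps:
  assumes z: "norm z = 1" "z \<noteq> 1" "z \<in> slit"
  shows "dps (hook_fps z) (\<lambda>a b. ibeta a b z)"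
proof -
  \<comment> \<open>The expansion of (1 - (1 - z)^t)/t, which is \<open>ibeta 0 t z\<close>; the
    shift removes the singularity at t = 0.\<close>
  define F where "F = fps_shift 1 (1 - fps_exp (Ln (1 - z)))"
  have "(\<lambda>t. if t = 0 then fps_nth (1 - fps_exp (Ln (1 - z))) 1 else (1 - exp (Ln (1 - z) * t)) / t ^ 1) has_fps_expansion F"
    unfolding F_def
  proof (rule has_fps_expansion_shift)
    show "(\<lambda>t. 1 - exp (Ln (1 - z) * t)) has_fps_expansion 1 - fps_exp (Ln (1 - z))"
      by (intro has_fps_expansion_diff has_fps_expansion_1 has_fps_expansion_exp)
    show "1 \<le> subdegree (1 - fps_exp (Ln (1 - z)))"
    proof -
      \<comment> \<open>The zero series has subdegree 0 by convention and has to be excluded: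
        \<open>Ln (1 - z) = 0\<close> would force z = 0, which is not on the circle.\<close>
      have "1 - fps_exp (Ln (1 - z)) \<noteq> 0"
      proof
        assume "1 - fps_exp (Ln (1 - z)) = 0"
        then have "fps_nth (1 - fps_exp (Ln (1 - z))) 1 = 0" by simp
        then have "Ln (1 - z) = 0" by simp
        then have "1 - z = 1" using z(2) by (metis exp_Ln exp_zero right_minus_eq)
        then show False using z(1) by simp
      qed
      then show ?thesis by (intro subdegree_geI) auto
    qed
  qed simp
  from dps_Ys[OF this] have Y: "dps (Ys F) (\<lambda>x y. ibeta 0 y z)"
  proof (rule dps_cong[where s = "1/3"])
    fix x y :: real assume "0 < y" "y < 1/3"
    then show "(if complex_of_real y = 0 then fps_nth (1 - fps_exp (Ln (1 - z))) 1 else (1 - exp (Ln (1 - z) * of_real y)) / of_real y ^ 1) = ibeta 0 y z"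
      using ibeta_0[of y z] z by (simp add: mult.commute)
  qed simp
  have "dps (hook_tail_fps z) (\<lambda>a b. \<Sum>k. ibeta_tail a b z k)"
    by (rule dpsI[of "1/3"]) (use z in \<open>auto intro!: dps_hook_tail_fps_has_sum(2)\<close>)
  from dps_add[OF Y dps_mult[OF dps_fps_X this]]
  have "dps (Ys F + fps_X * hook_tail_fps z) (\<lambda>a b. ibeta 0 b z + of_real a * (\<Sum>k. ibeta_tail a b z k))" .
  moreover have "Ys F + fps_X * hook_tail_fps z = hook_fps z"
  proof (intro fps_ext)
    fix q n
    show "cf (Ys F + fps_X * hook_tail_fps z) q n = cf (hook_fps z) q n"
    proof (cases q)
      case 0
      let ?l = "Ln (1 - z)"
      have "fps_nth F n = - (?l ^ Suc n / fact (Suc n))" by (simp add: F_def del: fact_Suc power_Suc)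
      also have "\<dots> = (- 1) ^ n * ((- ?l) ^ Suc n / fact (Suc n))"
        unfolding power_minus[of ?l "Suc n"] by (simp add: mult.assoc[symmetric] del: fact_Suc flip: power_mult_distrib)
      also have "\<dots> = (- 1) ^ n * Li_hook 0 n z" unfolding Li_hook_0[OF z(3)] log_pow_def ..
      finally show ?thesis using 0 by (simp add: cf_Ys cf_hook_fps)
    next
      case (Suc j)
      then show ?thesis by (simp add: cf_Ys cf_hook_fps hook_tail_fps_def)
    qed
  qed
  ultimately have "dps (hook_fps z) (\<lambda>a b. ibeta 0 b z + of_real a * (\<Sum>k. ibeta_tail a b z k))" by simp
  then show ?thesis
  proof (rule dps_cong[where s = "1/3"])
    fix x y :: real assume "\<bar>x\<bar> < 1/3" "0 < y" "y < 1/3"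
    then show "ibeta 0 y z + of_real x * (\<Sum>k. ibeta_tail x y z k) = ibeta x y z"
      using z by (intro ibeta_split[symmetric]) simp_all
  qed simp
qed

section \<open>The invariant and its value at z = 1\<close>

section \<open>A generating function that does not depend on \<open>z\<close>\<close>

text \<open>Exponentiating determines the right side up to multiples of 2 pi i. For Im z < 0 the
  imaginary part of Ln(1-z) lies in (0, pi) and that of Ln z in (-pi, 0), so subtracting pi lands in
  the principal strip.\<close>

lemma Ln_one_minus_inverse:
  assumes z: "Im z < 0"
  shows "Ln (1 - 1 / z) = Ln (1 - z) - Ln z - of_real pi * \<i>"
proof (rule Ln_unique)
  have nz: "z \<noteq> 0" "1 - z \<noteq> 0" using z by auto
  have "exp (Ln (1 - z) - Ln z - of_real pi * \<i>) = (1 - z) / z / exp (of_real pi * \<i>)"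
    using nz by (simp add: exp_diff)
  also have "exp (of_real pi * \<i>) = -1" by (simp add: exp_pi_i)
  also have "(1 - z) / z / - 1 = 1 - 1 / z" using nz by (simp add: field_simps)
  finally show "exp (Ln (1 - z) - Ln z - of_real pi * \<i>) = 1 - 1 / z" .
  have 1: "0 < Im (Ln (1 - z))" "Im (Ln (1 - z)) < pi"
    using Im_Ln_pos_lt_imp[of "1 - z"] z by auto
  have 2: "Im (Ln z) < 0" "- pi < Im (Ln z)"
  proof -
    have "z \<notin> \<real>\<^sub>\<le>\<^sub>0" using z by (simp add: complex_nonpos_Reals_iff)
    then have "Ln (cnj z) = cnj (Ln z)" by (rule cnj_Ln[symmetric])
    then have "Im (Ln (cnj z)) = - Im (Ln z)" by simp
    then show "Im (Ln z) < 0" "- pi < Im (Ln z)" using Im_Ln_pos_lt_imp[of "cnj z"] z by auto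
  qed
  show "- pi < Im (Ln (1 - z) - Ln z - of_real pi * \<i>)" "Im (Ln (1 - z) - Ln z - of_real pi * \<i>) \<le> pi"
    using 1 2 by simp_all
qed

text \<open>The exponential factors are kept apart to match those of \<open>gen_fps\<close>.\<close>

definition gen_fun :: "real \<Rightarrow> real \<Rightarrow> complex \<Rightarrow> complex" where
  "gen_fun x y z = of_real x * exp (Ln z * of_real x) * exp (Ln (1 - 1 / z) * of_real y) * exp (- Ln (1 - z) * of_real y) * ibeta (y - x) y z
     + exp (Ln z * of_real x) * of_real (y - x) * ibeta x y (1 / z)
     + exp (Ln z * of_real x) * exp (Ln (1 - 1 / z) * of_real y)"

text \<open>\<open>M\<close> continues the expression from the arc to the half-plane and has
  derivative 0. As z tends to 1 the term with (1 - 1/z)^y tends to 0 because y > 0, and both beta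
  series tend to complete Beta values, which evaluates the constant.\<close>

lemma gen_fun_const:
  assumes x: "\<bar>x\<bar> < 1/4" and y: "0 < y" "y < 1/4" and z: "Im z < 0" "norm z = 1"
  shows "gen_fun x y z = of_real x * exp (- of_real pi * \<i> * of_real y) * of_real (Beta (1 - (y - x)) y)
      + of_real (y - x) * of_real (Beta (1 - x) y)"
proof -
  define X Y where "X = complex_of_real x" and "Y = complex_of_real y"
  have YX: "complex_of_real (y - x) = Y - X" by (simp add: X_def Y_def)
  have a1: "\<bar>y - x\<bar> \<le> 1/2" and a2: "\<bar>x\<bar> \<le> 1/2" and y1: "y < 1" using x y by linarith+
  let ?S1 = "{z :: complex. Im z < 0}" and ?S2 = "{z :: complex. Im z > 0}"
  obtain Q1 where Q1: "\<And>z. z \<in> ?S1 \<Longrightarrow> (Q1 has_field_derivative exp (- (of_real (y - x) * Ln z)) * (1 - z) powr (of_real y - 1)) (at z)"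
    "\<And>z. z \<in> ?S1 \<Longrightarrow> norm z \<le> 1 \<Longrightarrow> Q1 z = exp (- (of_real (y - x) * Ln z)) * ibeta (y - x) y z"
    by (rule ibeta_half_plane[OF a1 y(1) y1, of ?S1])
       (auto simp: open_halfspace_Im_lt convex_halfspace_Im_lt mult_pos_neg)
  obtain Q2 where Q2: "\<And>z. z \<in> ?S2 \<Longrightarrow> (Q2 has_field_derivative exp (- (of_real x * Ln z)) * (1 - z) powr (of_real y - 1)) (at z)"
    "\<And>z. z \<in> ?S2 \<Longrightarrow> norm z \<le> 1 \<Longrightarrow> Q2 z = exp (- (of_real x * Ln z)) * ibeta x y z"
    by (rule ibeta_half_plane[OF a2 y(1) y1, of ?S2])
       (auto simp: open_halfspace_Im_gt convex_halfspace_Im_gt)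
  let ?E = "\<lambda>z. exp (X * Ln z + Y * Ln (1 - 1 / z))"
  let ?c = "exp (- of_real pi * \<i> * Y)"
  \<comment> \<open>By the logarithm relation z^x (1 - 1/z)^y (1 - z)^(-y) = e^(-pi i y) z^(x-y), so
    the first term of \<open>gen_fun\<close> is a constant multiple of the primitive
    \<open>Q1\<close>.\<close>
  define M where "M = (\<lambda>z. X * ?c * Q1 z + (Y - X) * Q2 (1 / z) + ?E z)"
  have Mz: "(M has_field_derivative 0) (at z)" if z: "Im z < 0" for z
  proof -
    have nz: "z \<noteq> 0" "1 - z \<noteq> 0" "z \<noteq> 1" using z by auto
    have np: "z \<notin> \<real>\<^sub>\<le>\<^sub>0" using z by (simp add: complex_nonpos_Reals_iff)
    have iz: "Im (1 / z) > 0" using z by (simp add: Im_complex_div_gt_0)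
    then have np1: "1 - 1 / z \<notin> \<real>\<^sub>\<le>\<^sub>0" "1 - 1 / z \<noteq> 0" by (auto simp: complex_nonpos_Reals_iff)
    have d1: "(Q1 has_field_derivative exp (- ((Y - X) * Ln z)) * (1 - z) powr (Y - 1)) (at z)"
      using Q1(1)[of z] z unfolding YX Y_def[symmetric] by simp
    have d2: "(Q2 has_field_derivative exp (- (X * Ln (1 / z))) * (1 - 1 / z) powr (Y - 1)) (at (1 / z))"
      using Q2(1)[of "1 / z"] iz unfolding X_def Y_def by simp
    have di: "((\<lambda>z. 1 / z) has_field_derivative - (1 / (z * z))) (at z)"
      using nz by (auto intro!: derivative_eq_intros simp: power2_eq_square)
    have dL: "(Ln has_field_derivative 1 / z) (at z)"
      using np by (auto intro!: derivative_eq_intros simp: divide_inverse)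
    have dL1: "((\<lambda>z. Ln (1 - 1 / z)) has_field_derivative 1 / (1 - 1 / z) * (1 / (z * z))) (at z)"
    proof -
      have "((\<lambda>z. 1 - 1 / z) has_field_derivative 1 / (z * z)) (at z)"
        using DERIV_diff[OF DERIV_const[of 1] di] by simp
      from DERIV_chain2[OF has_field_derivative_Ln[OF np1(1)] this] show ?thesis by (simp add: divide_inverse)
    qed
    have dE: "(?E has_field_derivative ?E z * (X * (1 / z) + Y * (1 / (1 - 1 / z) * (1 / (z * z))))) (at z)"
      by (rule DERIV_fun_exp[OF DERIV_add[OF DERIV_cmult[OF dL] DERIV_cmult[OF dL1]]])
    have D: "(M has_field_derivative X * ?c * (exp (- ((Y - X) * Ln z)) * (1 - z) powr (Y - 1))
       + (Y - X) * ((exp (- (X * Ln (1 / z))) * (1 - 1 / z) powr (Y - 1)) * - (1 / (z * z)))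
       + ?E z * (X * (1 / z) + Y * (1 / (1 - 1 / z) * (1 / (z * z))))) (at z)"
      unfolding M_def by (intro DERIV_add DERIV_cmult d1 DERIV_chain2[OF d2 di] dE)
    have Lni: "Ln (1 / z) = - Ln z" using Ln_inverse[OF np] by (simp add: inverse_eq_divide)
    have e2: "exp (- (X * Ln (1 / z))) * (1 - 1 / z) powr (Y - 1) = ?E z / (1 - 1 / z)"
      using np1(2) by (simp add: powr_def left_diff_distrib exp_diff exp_add Lni)
    have e1: "?c * (exp (- ((Y - X) * Ln z)) * (1 - z) powr (Y - 1)) = ?E z / (1 - z)"
    proof -
      have "?E z = exp (- of_real pi * \<i> * Y + - ((Y - X) * Ln z) + Y * Ln (1 - z))"
        unfolding Ln_one_minus_inverse[OF z] by (simp add: algebra_simps)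
      also have "\<dots> = ?c * (exp (- ((Y - X) * Ln z)) * exp (Y * Ln (1 - z)))" by (simp only: exp_add mult.assoc)
      finally show ?thesis using nz by (simp add: powr_def left_diff_distrib[of Y 1] exp_diff)
    qed
    have eq: "X * (?c * (exp (- ((Y - X) * Ln z)) * (1 - z) powr (Y - 1)))
       + (Y - X) * ((exp (- (X * Ln (1 / z))) * (1 - 1 / z) powr (Y - 1)) * - (1 / (z * z)))
       + ?E z * (X * (1 / z) + Y * (1 / (1 - 1 / z) * (1 / (z * z)))) =
       ?E z * (X / (1 - z) - (Y - X) * (1 / (1 - 1 / z) * (1 / (z * z))) + X / z + Y * (1 / (1 - 1 / z) * (1 / (z * z))))"
      unfolding e1 e2 by (simp add: algebra_simps)
    have k1: "1 / (1 - 1 / z) * (1 / (z * z)) = - (1 / (z * (1 - z)))"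
      using nz by (simp add: field_simps)
    have k2: "X / (1 - z) - (Y - X) * - (1 / (z * (1 - z))) + X / z + Y * - (1 / (z * (1 - z))) = 0"
    proof -
      have "1 / (z * (1 - z)) = 1 / z + 1 / (1 - z)" using nz by (simp add: field_simps)
      then show ?thesis by (simp only:) (simp add: algebra_simps divide_inverse)
    qed
    show ?thesis by (rule DERIV_cong[OF D]) (simp only: mult.assoc[of X ?c] eq[unfolded k1 k2] k1 mult_zero_right)
  qed
  have "\<exists>c. \<forall>z\<in>?S1. M z = c"
    by (rule has_field_derivative_zero_constant[OF convex_halfspace_Im_lt])
       (auto intro: has_field_derivative_at_within Mz)
  then obtain c where c: "\<And>z. Im z < 0 \<Longrightarrow> M z = c" by auto
  have arc: "M z = gen_fun x y z" if z: "Im z < 0" "norm z = 1" for z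
  proof -
    have nz: "z \<noteq> 0" using z by auto
    have np: "z \<notin> \<real>\<^sub>\<le>\<^sub>0" using z by (simp add: complex_nonpos_Reals_iff)
    have Lni: "Ln (1 / z) = - Ln z" using Ln_inverse[OF np] by (simp add: inverse_eq_divide)
    have "1 / z = cnj z" using z nz by (simp add: divide_eq_eq complex_norm_square[symmetric] mult.commute)
    then have iz: "Im (1 / z) > 0" "norm (1 / z) \<le> 1" using z by auto
    have q1: "Q1 z = exp (- ((Y - X) * Ln z)) * ibeta (y - x) y z" using Q1(2)[of z] z unfolding YX by simp
    have q2: "Q2 (1 / z) = exp (X * Ln z) * ibeta x y (1 / z)" using Q2(2)[of "1 / z"] iz by (simp add: Lni X_def)
    have "?c * exp (- ((Y - X) * Ln z)) = exp (Ln z * X) * exp (Ln (1 - 1 / z) * Y) * exp (- Ln (1 - z) * Y)"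
      unfolding exp_add[symmetric] Ln_one_minus_inverse[OF z(1)] by (simp add: algebra_simps)
    then show ?thesis
      unfolding M_def gen_fun_def q1 q2 YX X_def[symmetric] Y_def[symmetric]
      by (simp add: exp_add mult_ac)
  qed
  \<comment> \<open>Points of the arc that approach 1 from the lower half-plane.\<close>
  define w where "w = (\<lambda>n::nat. cis (- (1 / real (Suc n))))"
  have w: "Im (w n) < 0" "norm (w n) = 1" for n
  proof -
    have "1 / real (Suc n) \<le> 1" by (simp add: divide_le_eq)
    then have "1 / real (Suc n) < pi" using pi_gt3 by linarith
    then have "0 < sin (1 / real (Suc n))" by (intro sin_gt_zero) auto
    then show "Im (w n) < 0" by (simp add: w_def)
  qed (simp add: w_def)
  have iw: "1 / w n = cnj (w n)" for n by (simp add: w_def cis_cnj cis_inverse inverse_eq_divide[symmetric])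
  have lw: "w \<longlonglongrightarrow> 1"
  proof -
    have "(\<lambda>n. exp (\<i> * of_real (- (1 / real (Suc n))))) \<longlonglongrightarrow> exp (\<i> * of_real (- 0))"
      by (intro tendsto_intros LIMSEQ_Suc[OF lim_1_over_n])
    then show ?thesis by (simp add: w_def[abs_def] cis_conv_exp)
  qed
  have liw: "(\<lambda>n. 1 / w n) \<longlonglongrightarrow> 1" using tendsto_divide[OF tendsto_const[of 1] lw] by simp
  have lLn: "(\<lambda>n. Ln (w n)) \<longlonglongrightarrow> 0" using tendsto_Ln[OF lw] by simp
  have lI: "(\<lambda>n. ibeta a y (v n)) \<longlonglongrightarrow> of_real (Beta (1 - a) y)"
    if v: "v \<longlonglongrightarrow> 1" "\<And>n. norm (v n) = 1" and a: "\<bar>a\<bar> \<le> 1/2" for a and v :: "nat \<Rightarrow> complex"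
    using continuous_on_tendsto_compose[OF ibeta_continuous[OF a y(1) y1] v(1)] v(2) ibeta_1_complex[OF a y(1) y1] by simp
  have lE: "(\<lambda>n. exp (Ln (1 - 1 / w n) * Y)) \<longlonglongrightarrow> 0"
  proof (rule tendsto_norm_zero_cancel)
    have "(\<lambda>n. norm (1 - 1 / w n)) \<longlonglongrightarrow> norm (1 - 1 :: complex)" by (intro tendsto_intros liw)
    then have "(\<lambda>n. norm (1 - 1 / w n) powr y) \<longlonglongrightarrow> 0 powr y"
      using y by (intro tendsto_powr') auto
    moreover have "norm (exp (Ln (1 - 1 / w n) * Y)) = norm (1 - 1 / w n) powr y" for n
    proof -
      have "Im (1 - 1 / w n) \<noteq> 0" using w[of n] unfolding iw by simp
      then have "1 - 1 / w n \<noteq> 0" by auto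
      then show ?thesis by (simp add: norm_exp_eq_Re powr_def Y_def mult.commute)
    qed
    ultimately show "(\<lambda>n. norm (exp (Ln (1 - 1 / w n) * Y))) \<longlonglongrightarrow> 0" using y by simp
  qed
  have "(\<lambda>n. X * ?c * (exp (- ((Y - X) * Ln (w n))) * ibeta (y - x) y (w n)) + (Y - X) * (exp (X * Ln (w n)) * ibeta x y (1 / w n))
      + exp (X * Ln (w n)) * exp (Ln (1 - 1 / w n) * Y))
     \<longlonglongrightarrow> X * ?c * (exp (- ((Y - X) * 0)) * of_real (Beta (1 - (y - x)) y)) + (Y - X) * (exp (X * 0) * of_real (Beta (1 - x) y)) + exp (X * 0) * 0"
    by (intro tendsto_intros lLn lE lI a1 a2 lw liw) (use w in \<open>auto simp: norm_divide\<close>)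
  moreover have "X * ?c * (exp (- ((Y - X) * Ln (w n))) * ibeta (y - x) y (w n)) + (Y - X) * (exp (X * Ln (w n)) * ibeta x y (1 / w n))
      + exp (X * Ln (w n)) * exp (Ln (1 - 1 / w n) * Y) = c" for n
  proof -
    have np: "w n \<notin> \<real>\<^sub>\<le>\<^sub>0" using w[of n] by (simp add: complex_nonpos_Reals_iff)
    have Lni: "Ln (1 / w n) = - Ln (w n)" using Ln_inverse[OF np] by (simp add: inverse_eq_divide)
    have iz: "Im (1 / w n) > 0" "norm (1 / w n) \<le> 1" using w[of n] unfolding iw by auto
    have q1: "Q1 (w n) = exp (- ((Y - X) * Ln (w n))) * ibeta (y - x) y (w n)" using Q1(2)[of "w n"] w[of n] unfolding YX by simp
    have q2: "Q2 (1 / w n) = exp (X * Ln (w n)) * ibeta x y (1 / w n)" using Q2(2)[of "1 / w n"] iz by (simp add: Lni X_def)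
    show ?thesis using c[OF w(1)[of n]] unfolding M_def q1 q2 by (simp add: exp_add mult.commute)
  qed
  ultimately have "c = X * ?c * of_real (Beta (1 - (y - x)) y) + (Y - X) * of_real (Beta (1 - x) y)"
    by (simp add: LIMSEQ_const_iff)
  then show ?thesis using arc[OF z] c[OF z(1)] by (simp add: X_def Y_def)
qed

lemma gen_fun_eq:
  assumes x: "\<bar>x\<bar> < 1/4" and y: "0 < y" "y < 1/4" and z: "Im z < 0" "norm z = 1"
  shows "gen_fun x y z = exp (- of_real pi * \<i> * of_real x) * gamma_reg (of_real (y - x)) * gamma_reg (of_real x) * inverse (gamma_reg (of_real y))"
  unfolding gen_fun_const[OF assms] by (rule beta_trig_identity) (use x y in auto)

definition gen_fps :: "complex \<Rightarrow> complex fps fps" where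
  "gen_fps z = fps_X * Xs (fps_exp (Ln z)) * Ys (fps_exp (Ln (1 - 1 / z))) * subst_diff (Ys (fps_exp (- Ln (1 - z))) * hook_fps z)
     + Xs (fps_exp (Ln z)) * (Ys fps_X - fps_X) * hook_fps (1 / z)
     + Xs (fps_exp (Ln z)) * Ys (fps_exp (Ln (1 - 1 / z)))"

definition gamma_fps :: "complex fps fps" where
  "gamma_fps = Xs (fps_exp (- of_real pi * \<i>)) * subst_diff (Xs (P_fps zeta_seq)) * Xs (P_fps zeta_seq) * Ys (P_fps (\<lambda>k. - zeta_seq k))"

text \<open>For |z| = 1 the reciprocal is the conjugate, so z and 1/z both lie on the circle, away
  from 1, and both beta series expand. The functions agree for small |x| and small y > 0, hence so
  do the coefficients.\<close>

lemma gen_fps_arc: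
  assumes z: "Im z < 0" "norm z = 1"
  shows "gen_fps z = gamma_fps"
proof (rule dps_unique[where s = "1/4"])
  have nz: "z \<noteq> 0" using z by auto
  have "1 / z = cnj z" using z nz by (simp add: divide_eq_eq complex_norm_square[symmetric] mult.commute)
  then have iz: "Im (1 / z) > 0" "norm (1 / z) = 1" using z by auto
  have H1: "dps (hook_fps z) (\<lambda>a b. ibeta a b z)"
    by (rule dps_hook_fps) (use z in \<open>auto simp: slit_iff\<close>)
  have H2: "dps (hook_fps (1 / z)) (\<lambda>a b. ibeta a b (1 / z))"
    by (rule dps_hook_fps) (use iz in \<open>auto simp: slit_iff\<close>)
  have eX: "dps (Xs (fps_exp c)) (\<lambda>x y. exp (c * of_real x))" and eY: "dps (Ys (fps_exp c)) (\<lambda>x y. exp (c * of_real y))" for c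
    by (intro dps_Xs dps_Ys has_fps_expansion_exp)+
  have Y: "dps (Ys fps_X) (\<lambda>x y. of_real y)" by (rule dps_Ys[OF has_fps_expansion_fps_X])
  have S: "dps (subst_diff (Ys (fps_exp (- Ln (1 - z))) * hook_fps z)) (\<lambda>x y. exp (- Ln (1 - z) * of_real y) * ibeta (y - x) y z)"
    by (rule dps_subst_diff[OF dps_mult[OF eY H1]])
  have "dps (gen_fps z) (\<lambda>x y. of_real x * exp (Ln z * of_real x) * exp (Ln (1 - 1 / z) * of_real y) * (exp (- Ln (1 - z) * of_real y) * ibeta (y - x) y z)
     + exp (Ln z * of_real x) * (of_real y - of_real x) * ibeta x y (1 / z)
     + exp (Ln z * of_real x) * exp (Ln (1 - 1 / z) * of_real y))"
    unfolding gen_fps_def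
    by (intro dps_add dps_mult dps_diff dps_fps_X eX eY S H2 Y)
  then show "dps (gen_fps z) (\<lambda>x y. gen_fun x y z)"
    by (rule dps_cong[where s = 1]) (simp_all add: gen_fun_def mult.assoc)
  have SX: "dps (subst_diff (Xs (P_fps zeta_seq))) (\<lambda>x y. gamma_reg (of_real (y - x)))"
    by (rule dps_subst_diff[OF dps_Xs[OF gamma_reg_expansion]])
  show "dps gamma_fps (\<lambda>x y. exp (- of_real pi * \<i> * of_real x) * gamma_reg (of_real (y - x)) * gamma_reg (of_real x) * inverse (gamma_reg (of_real y)))"
    unfolding gamma_fps_def
    by (intro dps_mult eX SX dps_Xs[OF gamma_reg_expansion] dps_Ys[OF inverse_gamma_reg_expansion])
  show "gen_fun x y z = exp (- of_real pi * \<i> * of_real x) * gamma_reg (of_real (y - x)) * gamma_reg (of_real x) * inverse (gamma_reg (of_real y))"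
    if "\<bar>x\<bar> < 1/4" "0 < y" "y < 1/4" for x y
    by (rule gen_fun_eq[OF that z])
qed simp

section \<open>Coefficients of the two generating functions\<close>

section \<open>Extracting coefficients\<close>

lemma cf_Xs_mult: "cf (Xs A * C) m n = (\<Sum>i=0..m. fps_nth A i * cf C (m - i) n)"
  by (simp add: fps_mult_nth fps_sum_nth Xs_def if_distrib[of "\<lambda>x. x * c" for c] if_distrib[of "times c" for c] cong: if_cong)

lemma cf_mult_Xs: "cf (C * Xs A) m n = (\<Sum>i=0..m. cf C i n * fps_nth A (m - i))"
  by (simp add: fps_mult_nth fps_sum_nth Xs_def if_distrib[of "\<lambda>x. x * c" for c] if_distrib[of "times c" for c] cong: if_cong)

lemma cf_mult_Ys: "cf (C * Ys B) m n = (\<Sum>j=0..n. cf C m j * fps_nth B (n - j))"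
  by (simp add: fps_mult_nth Ys_def if_distrib[of "\<lambda>x. x * c" for c] if_distrib[of "times c" for c] cong: if_cong)

lemma cf_Ys_mult: "cf (Ys B * C) m n = (\<Sum>j=0..n. fps_nth B j * cf C m (n - j))"
  by (simp add: fps_mult_nth Ys_def if_distrib[of "\<lambda>x. x * c" for c] if_distrib[of "times c" for c] cong: if_cong)

lemma cf_fps_X_mult: "cf (fps_X * C) m n = (if m = 0 then 0 else cf C (m - 1) n)"
  by simp

lemma cf_Ys_X_mult: "cf (Ys fps_X * C) m n = (if n = 0 then 0 else cf C m (n - 1))"
  by (simp add: Ys_def)

text \<open>The factor (1 - z)^(-y) turns indices of the form (q+1, 1, ..., 1) into full sums over
  indices of depth N + 1 and weight e + N + 1.\<close>

lemma cf_hook_mpl: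
  assumes "z \<in> slit"
  shows "cf (Ys (fps_exp (- Ln (1 - z))) * hook_fps z) e N = mpl_sum e (Suc N) z"
  unfolding mpl_sum_eq_hook_sum[OF assms] hook_sum_def cf_Ys_mult
  by (simp add: cf_hook_fps log_pow_def atLeast0AtMost lessThan_Suc_atMost mult_ac)

lemma sign_parity: "even (a + b) \<Longrightarrow> (- 1 :: complex) ^ a = (- 1) ^ b"
  by (simp add: minus_one_power_iff)

context
  fixes z :: complex
  assumes z: "Im z < 0"
begin

lemma z_slit: "z \<in> slit" and iz_slit: "1 / z \<in> slit"
proof -
  show "z \<in> slit" using z by (simp add: slit_iff)
  have "0 < Im (1 / z)" using z by (simp add: Im_complex_div_gt_0)
  then show "1 / z \<in> slit" by (simp add: slit_iff)
qed

lemma cf_words_part: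
  assumes m: "0 < m"
  shows "cf (fps_X * Xs (fps_exp (Ln z)) * Ys (fps_exp (Ln (1 - 1 / z))) * subst_diff (Ys (fps_exp (- Ln (1 - z))) * hook_fps z)) m n =
    (\<Sum>i<m. \<Sum>j = 0..n.
          (- 1) ^ (m + n - j - 1) * Li_principal (replicate (n - j) 1) (1 / z)
          * (\<Sum>k = 0..j. of_nat ((m - i - 1 + j - k) choose (m - i - 1))
                         * (\<Sum>ks\<in>comps (m - i + j) (k + 1). Li_principal ks z))
          * ((- Ln z) ^ i / fact i))"
proof -
  let ?W = "subst_diff (Ys (fps_exp (- Ln (1 - z))) * hook_fps z)"
  have W: "cf ?W (m - i - 1) j = (- 1) ^ (m - i - 1) * (\<Sum>k = 0..j. of_nat ((m - i - 1 + j - k) choose (m - i - 1))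
                         * (\<Sum>ks\<in>comps (m - i + j) (k + 1). Li_principal ks z))" if i: "i < m" for i j
  proof -
    define q where "q = m - i - 1"
    have mi: "m - i = Suc q" using i by (simp add: q_def)
    have "cf ?W q j = (\<Sum>j'=0..j. of_nat ((q + j') choose q) * (- 1) ^ q * mpl_sum (q + j') (Suc (j - j')) z)"
      unfolding cf_subst_diff cf_hook_mpl[OF z_slit] ..
    \<comment> \<open>Reversing the order makes k + 1 the depth of the indices.\<close>
    also have "\<dots> = (\<Sum>k=0..j. of_nat ((q + (j - k)) choose q) * (- 1) ^ q * mpl_sum (q + (j - k)) (Suc (j - (j - k))) z)"
      by (subst sum.atLeastAtMost_rev) simp
    also have "\<dots> = (\<Sum>k=0..j. (- 1) ^ q * (of_nat ((q + j - k) choose q) * (\<Sum>ks\<in>comps (Suc q + j) (k + 1). Li_principal ks z)))"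
      by (intro sum.cong refl) (simp add: mpl_sum_def mult_ac)
    finally show ?thesis unfolding mi by (simp add: sum_distrib_left)
  qed
  have "cf (fps_X * Xs (fps_exp (Ln z)) * Ys (fps_exp (Ln (1 - 1 / z))) * ?W) m n =
      cf (fps_X * (Xs (fps_exp (Ln z)) * (?W * Ys (fps_exp (Ln (1 - 1 / z)))))) m n" by (simp only: mult_ac)
  also have "\<dots> = (\<Sum>i=0..m - 1. \<Sum>j=0..n. (Ln z) ^ i / fact i * (cf ?W (m - 1 - i) j * ((Ln (1 - 1 / z)) ^ (n - j) / fact (n - j))))"
    using m unfolding cf_fps_X_mult cf_Xs_mult cf_mult_Ys by (simp add: sum_distrib_left)
  also have "{0..m - 1} = {..<m}" using m by auto
  also have "(\<Sum>i<m. \<Sum>j=0..n. (Ln z) ^ i / fact i * (cf ?W (m - 1 - i) j * ((Ln (1 - 1 / z)) ^ (n - j) / fact (n - j)))) =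
    (\<Sum>i<m. \<Sum>j = 0..n.
          (- 1) ^ (m + n - j - 1) * Li_principal (replicate (n - j) 1) (1 / z)
          * (\<Sum>k = 0..j. of_nat ((m - i - 1 + j - k) choose (m - i - 1))
                         * (\<Sum>ks\<in>comps (m - i + j) (k + 1). Li_principal ks z))
          * ((- Ln z) ^ i / fact i))"
  proof (intro sum.cong refl)
    fix i j assume ij: "i \<in> {..<m}" "j \<in> {0..n}"
    let ?S = "\<Sum>k = 0..j. of_nat ((m - i - 1 + j - k) choose (m - i - 1)) * (\<Sum>ks\<in>comps (m - i + j) (k + 1). Li_principal ks z)"
    let ?l = "Ln (1 - 1 / z)"
    \<comment> \<open>The sign (-1)^(m-i-1) stems from (y - x)^e; on the right, (-1)^(n-j) is
      absorbed by Ln(1 - 1/z) = -Li_1(1/z) and (-1)^i by log(1/z) = -Ln z.\<close>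
    have s: "(- 1 :: complex) ^ (m - i - 1) = (- 1) ^ (m + n - j - 1) * (- 1) ^ (n - j) * (- 1) ^ i"
      unfolding power_add[symmetric] by (rule sign_parity) (use ij m in auto)
    have L: "Li_principal (replicate (n - j) 1) (1 / z) = (- 1) ^ (n - j) * (?l ^ (n - j) / fact (n - j))"
      using Li_principal_ones[OF iz_slit] by (simp add: power_minus[of ?l])
    have e: "m - 1 - i = m - i - 1" by simp
    have sq: "(- 1 :: complex) ^ k * ((- 1) ^ k * x) = x" for k x
      by (simp add: mult.assoc[symmetric] flip: power_mult_distrib)
    show "(Ln z) ^ i / fact i * (cf ?W (m - 1 - i) j * (?l ^ (n - j) / fact (n - j))) =
          (- 1) ^ (m + n - j - 1) * Li_principal (replicate (n - j) 1) (1 / z) * ?S * ((- Ln z) ^ i / fact i)"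
      unfolding e W[OF ij(1)[unfolded lessThan_iff]] s L power_minus[of "Ln z" i] by (simp only: mult_ac times_divide_eq_left times_divide_eq_right)
  qed
  finally show ?thesis .
qed

lemma cf_hooks_part:
  "cf (Xs (fps_exp (Ln z)) * (Ys fps_X - fps_X) * hook_fps (1 / z) + Xs (fps_exp (Ln z)) * Ys (fps_exp (Ln (1 - 1 / z)))) m n =
   (\<Sum>i=0..m. (Ln z) ^ i / fact i * ((if n = 0 then 0 else (- 1) ^ (n - 1) * Li_hook (m - i) (n - 1) (1 / z))
      - (if m - i = 0 then 0 else (- 1) ^ n * Li_hook (m - i - 1) n (1 / z)) + (if m - i = 0 then (Ln (1 - 1 / z)) ^ n / fact n else 0)))"
proof -
  have "Xs (fps_exp (Ln z)) * (Ys fps_X - fps_X) * hook_fps (1 / z) + Xs (fps_exp (Ln z)) * Ys (fps_exp (Ln (1 - 1 / z))) =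
     Xs (fps_exp (Ln z)) * (Ys fps_X * hook_fps (1 / z) - fps_X * hook_fps (1 / z) + Ys (fps_exp (Ln (1 - 1 / z))))"
    by (simp add: algebra_simps)
  then show ?thesis
    unfolding cf_Xs_mult
    by (simp only: cf_Xs_mult fps_add_nth fps_sub_nth cf_fps_X_mult cf_Ys_X_mult cf_hook_fps cf_Ys fps_exp_nth of_nat_fact)
qed

lemma cf_gen_fps:
  assumes m: "0 < m" and n: "0 < n"
  shows "cf (gen_fps z) m n =
     (\<Sum>i<m. (- 1) ^ (n + i + 1) * Li_principal ((m - i) # replicate n 1) (1 / z) * ((- Ln z) ^ i / fact i))
     + (\<Sum>i<m. (- 1) ^ (n + i + 1) * Li_principal ((m - i + 1) # replicate (n - 1) 1) (1 / z) * ((- Ln z) ^ i / fact i))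
     + (\<Sum>i<m. \<Sum>j = 0..n.
          (- 1) ^ (m + n - j - 1) * Li_principal (replicate (n - j) 1) (1 / z)
          * (\<Sum>k = 0..j. of_nat ((m - i - 1 + j - k) choose (m - i - 1))
                         * (\<Sum>ks\<in>comps (m - i + j) (k + 1). Li_principal ks z))
          * ((- Ln z) ^ i / fact i))"
proof -
  let ?l = "Ln (1 - 1 / z)" and ?w = "1 / z"
  let ?T = "\<lambda>i. (Ln z) ^ i / fact i * ((if n = 0 then 0 else (- 1) ^ (n - 1) * Li_hook (m - i) (n - 1) ?w)
      - (if m - i = 0 then 0 else (- 1) ^ n * Li_hook (m - i - 1) n ?w) + (if m - i = 0 then ?l ^ n / fact n else 0))"
  \<comment> \<open>For i = m the polylogarithm has q = 0 and is a power of the logarithm; as n > 0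
    it cancels the pure power of Ln(1 - 1/z).\<close>
  have T0: "?T m = 0"
  proof -
    obtain k where k: "n = Suc k" using n by (cases n) auto
    have "(- 1) ^ k * Li_hook 0 k ?w = (- 1) ^ k * ((- 1) ^ Suc k * (?l ^ Suc k / fact (Suc k)))"
      unfolding Li_hook_0[OF iz_slit] log_pow_def by (simp only: power_minus[of ?l] times_divide_eq_right)
    also have "\<dots> = - (?l ^ Suc k / fact (Suc k))"
      by (simp add: mult.assoc[symmetric] del: fact_Suc flip: power_mult_distrib)
    finally show ?thesis using k by (simp del: fact_Suc power_Suc)
  qed
  have Ti: "?T i = (- 1) ^ (n + i + 1) * Li_principal ((m - i) # replicate n 1) ?w * ((- Ln z) ^ i / fact i)
      + (- 1) ^ (n + i + 1) * Li_principal ((m - i + 1) # replicate (n - 1) 1) ?w * ((- Ln z) ^ i / fact i)" if i: "i < m" for i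
  proof -
    obtain q where q: "m - i = Suc q" using i by (metis Suc_diff_Suc)
    have s1: "(- 1 :: complex) ^ (n - 1) = (- 1) ^ (n + i + 1) * (- 1) ^ i"
      "- ((- 1 :: complex) ^ n) = (- 1) ^ (n + i + 1) * (- 1) ^ i"
      unfolding power_add[symmetric]
      by (rule sign_parity, use n in auto) (simp add: minus_one_power_iff)
    have "?T i = (Ln z) ^ i / fact i * ((- 1) ^ (n - 1) * Li_hook (Suc q) (n - 1) ?w + (- ((- 1) ^ n)) * Li_hook q n ?w)"
      using n unfolding q by simp
    also have "\<dots> = (- 1) ^ (n + i + 1) * Li_hook q n ?w * ((- Ln z) ^ i / fact i)
      + (- 1) ^ (n + i + 1) * Li_hook (Suc q) (n - 1) ?w * ((- Ln z) ^ i / fact i)"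
      unfolding s1 power_minus[of "Ln z" i]
      by (simp only: distrib_left mult_ac times_divide_eq_left times_divide_eq_right add_divide_distrib add_ac)
    finally show ?thesis unfolding q Li_hook_def by simp
  qed
  have s: "{0..m} = insert m {..<m}" by auto
  have "(\<Sum>i=0..m. ?T i) = (\<Sum>i<m. ?T i)" unfolding s using T0 by simp
  also have "\<dots> = (\<Sum>i<m. (- 1) ^ (n + i + 1) * Li_principal ((m - i) # replicate n 1) ?w * ((- Ln z) ^ i / fact i)
      + (- 1) ^ (n + i + 1) * Li_principal ((m - i + 1) # replicate (n - 1) 1) ?w * ((- Ln z) ^ i / fact i))"
    by (intro sum.cong refl Ti) simp
  finally have "(\<Sum>i=0..m. ?T i) = \<dots>" .
  moreover have "cf (gen_fps z) m n = (\<Sum>i=0..m. ?T i) +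
     cf (fps_X * Xs (fps_exp (Ln z)) * Ys (fps_exp ?l) * subst_diff (Ys (fps_exp (- Ln (1 - z))) * hook_fps z)) m n"
    unfolding cf_hooks_part[symmetric] gen_fps_def by simp
  ultimately show ?thesis unfolding cf_words_part[OF m] sum.distrib by simp
qed

text \<open>For n = 0 the term i = m has nothing to cancel with and supplies log^m(1/z)/m!. The
  factor (-1)^m converts powers of Ln z into powers of log(1/z).\<close>

lemma cf_gen_fps_0:
  assumes m: "0 < m"
  shows "(- 1) ^ m * cf (gen_fps z) m 0 = (- Ln z) ^ m / fact m
      - (\<Sum>i<m. (Li_principal [m - i] z + (- 1) ^ (m - i) * Li_principal [m - i] (1 / z)) * ((- Ln z) ^ i / fact i))"
proof -
  let ?l = "Ln (1 - 1 / z)" and ?w = "1 / z"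
  let ?T = "\<lambda>i. (Ln z) ^ i / fact i * ((if 0 = (0::nat) then 0 else (- 1) ^ (0 - 1) * Li_hook (m - i) (0 - 1) ?w)
      - (if m - i = 0 then 0 else (- 1) ^ 0 * Li_hook (m - i - 1) 0 ?w) + (if m - i = 0 then ?l ^ 0 / fact 0 else 0))"
  have s: "{0..m} = insert m {..<m}" by auto
  have A: "(\<Sum>i=0..m. ?T i) = (Ln z) ^ m / fact m - (\<Sum>i<m. (Ln z) ^ i / fact i * Li_principal [m - i] ?w)"
  proof -
    have "(\<Sum>i<m. ?T i) = (\<Sum>i<m. - ((Ln z) ^ i / fact i * Li_principal [m - i] ?w))"
    proof (intro sum.cong refl)
      fix i assume "i \<in> {..<m}"
      then obtain q where q: "m - i = Suc q" by (metis Suc_diff_Suc lessThan_iff)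
      show "?T i = - ((Ln z) ^ i / fact i * Li_principal [m - i] ?w)" unfolding q by (simp add: Li_hook_def)
    qed
    then show ?thesis unfolding s by (simp add: sum_negf)
  qed
  have B: "cf (fps_X * Xs (fps_exp (Ln z)) * Ys (fps_exp ?l) * subst_diff (Ys (fps_exp (- Ln (1 - z))) * hook_fps z)) m 0
      = (\<Sum>i<m. (- 1) ^ (m - 1) * Li_principal [m - i] z * ((- Ln z) ^ i / fact i))"
    unfolding cf_words_part[OF m]
  proof (intro sum.cong refl)
    fix i assume "i \<in> {..<m}"
    then obtain q where q: "m - i = Suc q" by (metis Suc_diff_Suc lessThan_iff)
    have "(\<Sum>ks\<in>comps (Suc q) 1. Li_principal ks z) = Li_principal [Suc q] z"
      using mpl_sum_eq_hook_sum[OF z_slit, of q 0] by (simp add: mpl_sum_def hook_sum_def Li_hook_def log_pow_0)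
    then show "(\<Sum>j = 0..0. (- 1) ^ (m + 0 - j - 1) * Li_principal (replicate (0 - j) 1) (1 / z)
          * (\<Sum>k = 0..j. of_nat ((m - i - 1 + j - k) choose (m - i - 1)) * (\<Sum>ks\<in>comps (m - i + j) (k + 1). Li_principal ks z))
          * ((- Ln z) ^ i / fact i)) = (- 1) ^ (m - 1) * Li_principal [m - i] z * ((- Ln z) ^ i / fact i)"
      unfolding q using Li_principal_Nil[OF iz_slit] by simp
  qed
  have "cf (gen_fps z) m 0 = (\<Sum>i=0..m. ?T i) +
     cf (fps_X * Xs (fps_exp (Ln z)) * Ys (fps_exp ?l) * subst_diff (Ys (fps_exp (- Ln (1 - z))) * hook_fps z)) m 0"
    unfolding cf_hooks_part[symmetric] gen_fps_def by simp
  also have "\<dots> = (Ln z) ^ m / fact m - (\<Sum>i<m. (Ln z) ^ i / fact i * Li_principal [m - i] ?w)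
      + (\<Sum>i<m. (- 1) ^ (m - 1) * Li_principal [m - i] z * ((- Ln z) ^ i / fact i))" unfolding A B ..
  finally have E: "cf (gen_fps z) m 0 = \<dots>" .
  have "(- 1) ^ m * cf (gen_fps z) m 0 = (- 1) ^ m * ((Ln z) ^ m / fact m)
      - ((\<Sum>i<m. (- 1) ^ m * ((Ln z) ^ i / fact i * Li_principal [m - i] ?w))
         - (\<Sum>i<m. (- 1) ^ m * ((- 1) ^ (m - 1) * Li_principal [m - i] z * ((- Ln z) ^ i / fact i))))"
    unfolding E by (simp only: right_diff_distrib distrib_left sum_distrib_left diff_diff_eq2 diff_add_eq)
  also have "(- 1) ^ m * ((Ln z) ^ m / fact m) = (- Ln z) ^ m / fact m" by (simp add: power_minus[of "Ln z"])
  also have "(\<Sum>i<m. (- 1) ^ m * ((Ln z) ^ i / fact i * Li_principal [m - i] ?w))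
         - (\<Sum>i<m. (- 1) ^ m * ((- 1) ^ (m - 1) * Li_principal [m - i] z * ((- Ln z) ^ i / fact i)))
     = (\<Sum>i<m. (Li_principal [m - i] z + (- 1) ^ (m - i) * Li_principal [m - i] (1 / z)) * ((- Ln z) ^ i / fact i))"
    unfolding sum_subtractf[symmetric]
  proof (intro sum.cong refl)
    fix i assume i: "i \<in> {..<m}"
    have s1: "(- 1 :: complex) ^ m = (- 1) ^ (m - i) * (- 1) ^ i" using i by (simp flip: power_add)
    have s2: "(- 1 :: complex) ^ m * (- 1) ^ (m - 1) = - 1"
      using m by (cases m) (simp_all flip: power_mult_distrib)
    have "(- 1) ^ m * ((- 1) ^ (m - 1) * Li_principal [m - i] z * ((- Ln z) ^ i / fact i))
      = ((- 1) ^ m * (- 1) ^ (m - 1)) * (Li_principal [m - i] z * ((- Ln z) ^ i / fact i))" by (simp only: mult.assoc)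
    then have e2: "(- 1) ^ m * ((- 1) ^ (m - 1) * Li_principal [m - i] z * ((- Ln z) ^ i / fact i))
      = - (Li_principal [m - i] z * ((- Ln z) ^ i / fact i))" unfolding s2 by simp
    have e1: "(- 1) ^ m * ((Ln z) ^ i / fact i * Li_principal [m - i] ?w) = (- 1) ^ (m - i) * Li_principal [m - i] ?w * ((- Ln z) ^ i / fact i)"
      unfolding s1 power_minus[of "Ln z" i] by (simp add: mult_ac)
    show "(- 1) ^ m * ((Ln z) ^ i / fact i * Li_principal [m - i] ?w) - (- 1) ^ m * ((- 1) ^ (m - 1) * Li_principal [m - i] z * ((- Ln z) ^ i / fact i))
       = (Li_principal [m - i] z + (- 1) ^ (m - i) * Li_principal [m - i] (1 / z)) * ((- Ln z) ^ i / fact i)"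
      unfolding e1 e2 by (simp only: distrib_right diff_minus_eq_add add.commute)
  qed
  finally show ?thesis .
qed

end

text \<open>Setting y = 0 turns y - x into -x, so e^(-pi i x) is multiplied by the regularised Gamma
  values at x and -x: the Bernoulli series in -2 pi i x. The sign (-1)^m changes this to 2 pi
  i.\<close>

lemma cf_gamma_fps_0: "(- 1) ^ m * cf gamma_fps m 0 = of_real (bernoulli_num m) * ((2 * of_real pi * \<i>) ^ m / fact m)"
proof -
  have c0: "cf (C * D) i 0 = fps_nth (A * B) i" if "\<And>i. cf C i 0 = fps_nth A i" "\<And>i. cf D i 0 = fps_nth B i" for A B C D i
    unfolding cf_mult by (simp add: that fps_mult_nth)
  have P0: "P_exp 0 a = 1" for a by (simp add: P_exp_def)
  have Y: "cf (Ys (P_fps a)) i 0 = fps_nth 1 i" for a i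
    by (simp add: cf_Ys P_fps_def P0)
  have S: "cf (subst_diff (Xs (P_fps zeta_seq))) i 0 = fps_nth P_fps_neg i" for i
    by (simp add: cf_subst_diff cf_Xs P_fps_neg_def P_fps_def)
  have X: "cf (Xs A) i 0 = fps_nth A i" for A i by (simp add: cf_Xs)
  have "cf gamma_fps m 0 = fps_nth (fps_exp (- of_real pi * \<i>) * P_fps_neg * P_fps zeta_seq * 1) m"
    unfolding gamma_fps_def by (intro c0 X S Y)
  also have "fps_exp (- of_real pi * \<i>) * P_fps_neg * P_fps zeta_seq * 1 = P_fps_neg * P_fps zeta_seq * fps_exp (- of_real pi * \<i>)"
    by (simp only: mult_ac mult_1_right mult_1_left)
  also have "fps_nth \<dots> m = of_real (bernoulli_num m / fact m) * (- 2 * of_real pi * \<i>) ^ m"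
    unfolding bernoulli_gamma by simp
  also have "(- 2 * of_real pi * \<i>) ^ m = (- 1) ^ m * (2 * of_real pi * \<i>) ^ m"
    using power_minus[of "2 * of_real pi * \<i>" m] by simp
  finally have "(- 1) ^ m * cf gamma_fps m 0 = ((- 1) ^ m * (- 1) ^ m) * (of_real (bernoulli_num m / fact m) * (2 * of_real pi * \<i>) ^ m)"
    by (simp only: mult_ac)
  then show ?thesis by (simp flip: power_mult_distrib)
qed

lemma sum_pairs_eq: "(\<Sum>(a, b)\<in>{(a, b). a + b = n}. f a b) = (\<Sum>a=0..n. f a (n - a))" for n :: nat
  by (rule sum.reindex_bij_witness[where i = "\<lambda>a. (a, n - a)" and j = fst]) auto

lemma sum_triples_eq:
  "(\<Sum>(a, b, c)\<in>{(a, b, c). a + b + c = m}. f a b c) = (\<Sum>k=0..m. \<Sum>a=0..k. f a (k - a) (m - k))" for m :: nat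
  unfolding sum.Sigma[of "{0..m}" "\<lambda>k. {0..k}", OF finite_atLeastAtMost ballI[OF finite_atLeastAtMost]]
  by (rule sum.reindex_bij_witness[where i = "\<lambda>(k, a). (a, k - a, m - k)" and j = "\<lambda>(a, b, c). (a + b, a)"]) auto

lemma cf_gamma_fps:
  "cf gamma_fps m n = (\<Sum>(m1, m2, m3)\<in>{(m1, m2, m3). m1 + m2 + m3 = m}. \<Sum>(n1, n2)\<in>{(n1, n2). n1 + n2 = n}.
          of_nat ((m1 + n1) choose m1) * (- 1) ^ m1 * of_real (P_exp (m1 + n1) zeta_seq)
          * of_real (P_exp m2 zeta_seq) * ((- of_real pi * \<i>) ^ m3 / fact m3)
          * of_real (P_exp n2 (\<lambda>k. - zeta_seq k)))"
proof -
  let ?P = "\<lambda>k. complex_of_real (P_exp k zeta_seq)" and ?N = "\<lambda>k. complex_of_real (P_exp k (\<lambda>k. - zeta_seq k))"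
  \<comment> \<open>\<open>Xs\<close> has no powers of y, so in the expansion of (y - x)^(a+b) only
    the term with x^a y^b contributes.\<close>
  have S: "cf (subst_diff (Xs (P_fps zeta_seq))) a b = of_nat ((a + b) choose a) * (- 1) ^ a * ?P (a + b)" for a b
  proof -
    have "cf (subst_diff (Xs (P_fps zeta_seq))) a b = (\<Sum>j=0..b. if j = b then of_nat ((a + b) choose a) * (- 1) ^ a * ?P (a + b) else 0)"
      unfolding cf_subst_diff by (intro sum.cong refl) (auto simp: cf_Xs P_fps_def)
    then show ?thesis by simp
  qed
  have R: "gamma_fps = subst_diff (Xs (P_fps zeta_seq)) * Xs (P_fps zeta_seq) * Xs (fps_exp (- of_real pi * \<i>)) * Ys (P_fps (\<lambda>k. - zeta_seq k))"
    unfolding gamma_fps_def by (simp only: mult_ac)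
  have "cf gamma_fps m n = (\<Sum>j=0..n. (\<Sum>k=0..m. (\<Sum>a=0..k. of_nat ((a + j) choose a) * (- 1) ^ a * ?P (a + j) * ?P (k - a))
      * ((- of_real pi * \<i>) ^ (m - k) / fact (m - k))) * ?N (n - j))"
    unfolding R cf_mult_Ys cf_mult_Xs S by (simp add: P_fps_def)
  also have "\<dots> = (\<Sum>j=0..n. \<Sum>k=0..m. \<Sum>a=0..k. of_nat ((a + j) choose a) * (- 1) ^ a * ?P (a + j) * ?P (k - a)
      * ((- of_real pi * \<i>) ^ (m - k) / fact (m - k)) * ?N (n - j))"
    by (simp only: sum_distrib_right)
  also have "\<dots> = (\<Sum>k=0..m. \<Sum>a=0..k. \<Sum>j=0..n. of_nat ((a + j) choose a) * (- 1) ^ a * ?P (a + j) * ?P (k - a)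
      * ((- of_real pi * \<i>) ^ (m - k) / fact (m - k)) * ?N (n - j))"
    by (subst sum.swap) (intro sum.cong refl sum.swap)
  finally show ?thesis unfolding sum_triples_eq sum_pairs_eq .
qed

section \<open>Identity theorem from the arc to the half-plane\<close>

section \<open>From the arc to the half plane\<close>

text \<open>The open lower unit semicircle is connected with more than one point, hence each of its
  points is a limit point of it, as the identity theorem requires.\<close>

lemma half_plane_identity:
  assumes f: "f holomorphic_on {z. Im z < 0}" and arc: "\<And>z. Im z < 0 \<Longrightarrow> norm z = 1 \<Longrightarrow> f z = c" and z: "Im z < 0"
  shows "f z = c"
proof -
  let ?S = "{z :: complex. Im z < 0}" and ?A = "cis ` {- pi <..< 0}"
  have sub: "Im w < 0" "norm w = 1" if "w \<in> ?A" for w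
  proof -
    obtain t where t: "w = cis t" "- pi < t" "t < 0" using \<open>w \<in> ?A\<close> by auto
    have "0 < sin (- t)" using t by (intro sin_gt_zero) auto
    then show "Im w < 0" "norm w = 1" using t by simp_all
  qed
  have "continuous_on {- pi <..< 0} cis" by (simp add: cis_conv_exp[abs_def] continuous_intros)
  then have conn: "connected ?A" by (intro connected_continuous_image) auto
  have pts: "cis (- (pi / 2)) \<in> ?A" "cis (- (pi / 3)) \<in> ?A"
    by (rule imageI, use pi_gt_zero in simp)+
  have ne: "?A \<noteq> {x}" for x
  proof
    assume "?A = {x}"
    then have "cis (- (pi / 2)) = cis (- (pi / 3))" using pts by simp
    then have "Re (cis (- (pi / 2))) = Re (cis (- (pi / 3)))" by simp
    then show False by (simp add: cos_60)
  qed
  have lim: "cis (- (pi / 2)) islimpt ?A" by (rule connected_imp_perfect[OF conn]) (use ne pts in auto)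
  have "f z - c = 0"
  proof (rule analytic_continuation[of "\<lambda>z. f z - c" ?S ?A "cis (- (pi / 2))"])
    show "(\<lambda>z. f z - c) holomorphic_on ?S" by (intro holomorphic_intros f)
    show "connected ?S" by (intro convex_connected convex_halfspace_Im_lt)
    show "cis (- (pi / 2)) \<in> ?S" using sub[OF pts(1)] by simp
  qed (use sub arc z lim in \<open>auto simp: open_halfspace_Im_lt\<close>)
  then show ?thesis by simp
qed

lemma principal_half_plane_holomorphic:
  assumes "\<forall>k\<in>set ks. 0 < k"
  shows "Li_principal ks holomorphic_on {z. Im z < 0}" "(\<lambda>z. Li_principal ks (1 / z)) holomorphic_on {z. Im z < 0}"
proof -
  note h = Li_principal_holomorphic[OF assms]
  show "Li_principal ks holomorphic_on {z. Im z < 0}" by (rule holomorphic_on_subset[OF h]) (auto intro: z_slit)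
  have "(Li_principal ks \<circ> (\<lambda>z. 1 / z)) holomorphic_on {z. Im z < 0}"
    by (rule holomorphic_on_compose_gen[OF _ h]) (auto intro!: holomorphic_intros iz_slit)
  then show "(\<lambda>z. Li_principal ks (1 / z)) holomorphic_on {z. Im z < 0}" by (simp add: o_def)
qed

lemma Ln_half_plane_holomorphic: "Ln holomorphic_on {z. Im z < 0}"
  by (intro holomorphic_on_Ln) (auto simp: complex_nonpos_Reals_iff)

lemma half_plane_first:
  assumes m: "0 < m" and z: "Im z < 0"
  shows "(- Ln z) ^ m / fact m
      - (\<Sum>i<m. (Li_principal [m - i] z + (- 1) ^ (m - i) * Li_principal [m - i] (1 / z)) * ((- Ln z) ^ i / fact i))
     = of_real (bernoulli_num m) * ((2 * of_real pi * \<i>) ^ m / fact m)"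
proof (rule half_plane_identity[OF _ _ z])
  show "(\<lambda>z. (- Ln z) ^ m / fact m
      - (\<Sum>i<m. (Li_principal [m - i] z + (- 1) ^ (m - i) * Li_principal [m - i] (1 / z)) * ((- Ln z) ^ i / fact i)))
    holomorphic_on {z. Im z < 0}"
    by (intro holomorphic_on_diff holomorphic_on_divide holomorphic_on_power holomorphic_on_minus holomorphic_on_sum
        holomorphic_on_mult holomorphic_on_add holomorphic_on_const Ln_half_plane_holomorphic principal_half_plane_holomorphic) auto
  fix z :: complex assume z: "Im z < 0" "norm z = 1"
  show "(- Ln z) ^ m / fact m
      - (\<Sum>i<m. (Li_principal [m - i] z + (- 1) ^ (m - i) * Li_principal [m - i] (1 / z)) * ((- Ln z) ^ i / fact i))
     = of_real (bernoulli_num m) * ((2 * of_real pi * \<i>) ^ m / fact m)"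
    unfolding cf_gen_fps_0[OF z(1) m, symmetric] gen_fps_arc[OF z] by (rule cf_gamma_fps_0)
qed

lemma half_plane_second:
  assumes m: "0 < m" and n: "0 < n" and z: "Im z < 0"
  shows "(\<Sum>i<m. (- 1) ^ (n + i + 1) * Li_principal ((m - i) # replicate n 1) (1 / z) * ((- Ln z) ^ i / fact i))
     + (\<Sum>i<m. (- 1) ^ (n + i + 1) * Li_principal ((m - i + 1) # replicate (n - 1) 1) (1 / z) * ((- Ln z) ^ i / fact i))
     + (\<Sum>i<m. \<Sum>j = 0..n.
          (- 1) ^ (m + n - j - 1) * Li_principal (replicate (n - j) 1) (1 / z)
          * (\<Sum>k = 0..j. of_nat ((m - i - 1 + j - k) choose (m - i - 1))
                         * (\<Sum>ks\<in>comps (m - i + j) (k + 1). Li_principal ks z))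
          * ((- Ln z) ^ i / fact i)) = cf gamma_fps m n" (is "?F z = _")
proof (rule half_plane_identity[OF _ _ z])
  show "?F holomorphic_on {z. Im z < 0}"
    by (intro holomorphic_on_divide holomorphic_on_power holomorphic_on_minus holomorphic_on_sum
        holomorphic_on_mult holomorphic_on_add holomorphic_on_const Ln_half_plane_holomorphic principal_half_plane_holomorphic)
       (auto dest: comps_pos)
  fix z :: complex assume z: "Im z < 0" "norm z = 1"
  show "?F z = cf gamma_fps m n"
    unfolding cf_gen_fps[OF z(1) m n, symmetric] gen_fps_arc[OF z] ..
qed

section \<open>Lifting the functions and the identities to the covering\<close>

section \<open>Continuation to the universal cover\<close>

context
  fixes U :: "'a::topological_space set" and p :: "'a \<Rightarrow> complex" and H :: "'a set"
  assumes univ: "universal_cover U p" and lift: "is_lift U p {w. Im w < 0} H"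
begin

lemma p_half_plane: "u \<in> H \<Longrightarrow> Im (p u) < 0"
  using lift_image[OF univ lift] by blast

text \<open>Induction on the weight: the derivative of either function is a function of the same
  kind and smaller weight times a rational function with poles in {0, 1}, which is pulled back along
  \<open>p\<close>; \<open>extends_primitive\<close> then integrates the product.\<close>

lemma extends_Li_principal:
  "\<forall>k\<in>set ks. 0 < k \<Longrightarrow> (\<exists>F. extends U p H (Li_principal ks) F) \<and> (\<exists>F. extends U p H (\<lambda>z. Li_principal ks (1 / z)) F)"
proof (induction "sum_list ks" arbitrary: ks rule: less_induct)
  case less
  show ?case
  proof (cases ks)
    case Nil
    have "Li_principal ks (p u) = 1" "Li_principal ks (1 / p u) = 1" if "u \<in> H" for u
      unfolding Nil by (intro Li_principal_Nil z_slit iz_slit p_half_plane that)+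
    then have "extends U p H (Li_principal ks) (\<lambda>_. 1)" "extends U p H (\<lambda>z. Li_principal ks (1 / z)) (\<lambda>_. 1)"
      by (simp_all add: extends_def[OF univ lift] holomorphic_on_cover_const)
    then show ?thesis by (intro conjI exI)
  next
    case (Cons k ks')
    \<comment> \<open>\<open>js\<close> removes a leading 1 or lowers the leading entry. For the
      argument 1/z the chain rule changes the rational factor to 1/(z (1 - z)) or to -1/z.\<close>
    obtain js where js: "\<forall>k\<in>set js. 0 < k" "sum_list js < sum_list ks"
      and d: "\<exists>h. h holomorphic_on - {0, 1} \<and> (\<forall>z. z \<in> slit \<longrightarrow> z \<noteq> 0 \<longrightarrow> (Li_principal ks has_field_derivative h z * Li_principal js z) (at z))"
      and d': "\<exists>h. h holomorphic_on - {0, 1} \<and> (\<forall>z. Im z < 0 \<longrightarrow> ((\<lambda>z. Li_principal ks (1 / z)) has_field_derivative h z * Li_principal js (1 / z)) (at z))"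
    proof -
      have inv: "((\<lambda>z. 1 / z) has_field_derivative - (1 / (z * z))) (at z)" if "Im z < 0" for z :: complex
      proof -
        have "z \<noteq> 0" using that by auto
        then show ?thesis by (auto intro!: derivative_eq_intros simp: power2_eq_square)
      qed
      show ?thesis
      proof (cases "k = 1")
        case True
        have js: "\<forall>k\<in>set ks'. 0 < k" "sum_list ks' < sum_list ks" using less.prems Cons True by auto
        have D: "(Li_principal ks has_field_derivative 1 / (1 - z) * Li_principal ks' z) (at z)" if "z \<in> slit" for z
          using Li_principal_deriv_1[OF js(1) that] Cons True by simp
        have D': "((\<lambda>z. Li_principal ks (1 / z)) has_field_derivative 1 / (z * (1 - z)) * Li_principal ks' (1 / z)) (at z)" if "Im z < 0" for z
        proof -
          have nz: "z \<noteq> 0" "1 - z \<noteq> 0" "1 - 1 / z \<noteq> 0" using that iz_slit[OF that] by (auto simp: slit_iff)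
          have "1 / (1 - 1 / z) * Li_principal ks' (1 / z) * - (1 / (z * z)) = 1 / (z * (1 - z)) * Li_principal ks' (1 / z)"
          proof -
            have "1 / (1 - 1 / z) * - (1 / (z * z)) = 1 / (z * (1 - z))" using nz by (simp add: field_simps)
            moreover have "1 / (1 - 1 / z) * Li_principal ks' (1 / z) * - (1 / (z * z)) = (1 / (1 - 1 / z) * - (1 / (z * z))) * Li_principal ks' (1 / z)"
              by (simp only: mult_ac)
            ultimately show ?thesis by (simp only:)
          qed
          then show ?thesis using DERIV_chain2[OF D[OF iz_slit[OF that]] inv[OF that]] by simp
        qed
        show ?thesis
        proof (rule that[OF js])
          show "\<exists>h. h holomorphic_on - {0, 1} \<and> (\<forall>z. z \<in> slit \<longrightarrow> z \<noteq> 0 \<longrightarrow> (Li_principal ks has_field_derivative h z * Li_principal ks' z) (at z))"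
            by (intro exI[of _ "\<lambda>z. 1 / (1 - z)"] conjI allI impI D; auto intro!: holomorphic_intros)
          show "\<exists>h. h holomorphic_on - {0, 1} \<and> (\<forall>z. Im z < 0 \<longrightarrow> ((\<lambda>z. Li_principal ks (1 / z)) has_field_derivative h z * Li_principal ks' (1 / z)) (at z))"
            by (intro exI[of _ "\<lambda>z. 1 / (z * (1 - z))"] conjI allI impI D'; auto intro!: holomorphic_intros)
        qed
      next
        case False
        then obtain j where j: "k = Suc j" "0 < j" using less.prems Cons by (cases k) auto
        have js: "\<forall>k\<in>set (j # ks'). 0 < k" "sum_list (j # ks') < sum_list ks" using less.prems Cons j by auto
        have D: "(Li_principal ks has_field_derivative 1 / z * Li_principal (j # ks') z) (at z)" if "z \<in> slit" "z \<noteq> 0" for z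
          using Li_principal_deriv_ge2[OF _ j(2) that, of ks'] js Cons j by simp
        have D': "((\<lambda>z. Li_principal ks (1 / z)) has_field_derivative - (1 / z) * Li_principal (j # ks') (1 / z)) (at z)" if "Im z < 0" for z
        proof -
          have nz: "z \<noteq> 0" "1 / z \<noteq> 0" using that by auto
          have "1 / (1 / z) * Li_principal (j # ks') (1 / z) * - (1 / (z * z)) = - (1 / z) * Li_principal (j # ks') (1 / z)"
            using nz by (simp add: field_simps)
          then show ?thesis using DERIV_chain2[OF D[OF iz_slit[OF that] nz(2)] inv[OF that]] by simp
        qed
        show ?thesis
        proof (rule that[OF js])
          show "\<exists>h. h holomorphic_on - {0, 1} \<and> (\<forall>z. z \<in> slit \<longrightarrow> z \<noteq> 0 \<longrightarrow> (Li_principal ks has_field_derivative h z * Li_principal (j # ks') z) (at z))"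
            by (intro exI[of _ "\<lambda>z. 1 / z"] conjI allI impI D; auto intro!: holomorphic_intros)
          show "\<exists>h. h holomorphic_on - {0, 1} \<and> (\<forall>z. Im z < 0 \<longrightarrow> ((\<lambda>z. Li_principal ks (1 / z)) has_field_derivative h z * Li_principal (j # ks') (1 / z)) (at z))"
            by (intro exI[of _ "\<lambda>z. - (1 / z)"] conjI allI impI D'; auto intro!: holomorphic_intros)
        qed
      qed
    qed
    obtain h where h: "h holomorphic_on - {0, 1}" "\<And>z. z \<in> slit \<Longrightarrow> z \<noteq> 0 \<Longrightarrow> (Li_principal ks has_field_derivative h z * Li_principal js z) (at z)"
      using d by blast
    obtain h' where h': "h' holomorphic_on - {0, 1}" "\<And>z. Im z < 0 \<Longrightarrow> ((\<lambda>z. Li_principal ks (1 / z)) has_field_derivative h' z * Li_principal js (1 / z)) (at z)"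
      using d' by blast
    obtain F F' where F: "extends U p H (Li_principal js) F" "extends U p H (\<lambda>z. Li_principal js (1 / z)) F'"
      using less.hyps[OF js(2,1)] by blast
    have 1: "extends U p H (\<lambda>z. h z * Li_principal js z) (\<lambda>u. h (p u) * F u)"
      and 2: "extends U p H (\<lambda>z. h' z * Li_principal js (1 / z)) (\<lambda>u. h' (p u) * F' u)"
      using extends_mult[OF univ lift extends_compose[OF univ lift h(1)] F(1)] extends_mult[OF univ lift extends_compose[OF univ lift h'(1)] F(2)] by auto
    have "\<exists>F. extends U p H (Li_principal ks) F"
    proof (rule extends_primitive[OF univ lift 1])
      fix z :: complex assume "Im z < 0"
      then show "(Li_principal ks has_field_derivative h z * Li_principal js z) (at z)"
        by (intro h(2) z_slit) auto
    qed
    moreover have "\<exists>F. extends U p H (\<lambda>z. Li_principal ks (1 / z)) F"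
      by (rule extends_primitive[OF univ lift 2 h'(2)])
    ultimately show ?thesis by (rule conjI)
  qed
qed

lemma extends_Li: "\<forall>k\<in>set ks. 0 < k \<Longrightarrow> extends U p H (Li_principal ks) (Li U p H ks)"
proof -
  assume "\<forall>k\<in>set ks. 0 < k"
  from extends_Li_principal[OF this] obtain F where "extends U p H (Li_principal ks) F" by (elim conjE exE)
  from continuation_extends[OF univ lift this] show ?thesis unfolding Li_def .
qed

lemma extends_Li_inv: "\<forall>k\<in>set ks. 0 < k \<Longrightarrow> extends U p H (\<lambda>z. Li_principal ks (1 / z)) (Li_inv U p H ks)"
proof -
  assume "\<forall>k\<in>set ks. 0 < k"
  from extends_Li_principal[OF this] obtain F where "extends U p H (\<lambda>z. Li_principal ks (1 / z)) F" by (elim conjE exE)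
  from continuation_extends[OF univ lift this] show ?thesis unfolding Li_inv_def .
qed

lemma extends_log: "extends U p H Ln (log_cover U p H)"
proof -
  have "extends U p H (\<lambda>z. 1 / z) (\<lambda>u. 1 / p u)"
    by (rule extends_compose[OF univ lift]) (auto intro!: holomorphic_intros)
  then have "\<exists>F. extends U p H Ln F"
  proof (rule extends_primitive[OF univ lift])
    fix z :: complex assume "Im z < 0"
    then have "z \<notin> \<real>\<^sub>\<le>\<^sub>0" by (simp add: complex_nonpos_Reals_iff)
    then show "(Ln has_field_derivative 1 / z) (at z)" by (auto intro!: derivative_eq_intros simp: divide_inverse)
  qed
  then obtain F where "extends U p H Ln F" by (elim exE)
  from continuation_extends[OF univ lift this] show ?thesis unfolding log_cover_def .
qed

lemma Li_hol: "\<forall>k\<in>set ks. 0 < k \<Longrightarrow> holomorphic_on_cover U p (Li U p H ks)"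
  and Li_inv_hol: "\<forall>k\<in>set ks. 0 < k \<Longrightarrow> holomorphic_on_cover U p (Li_inv U p H ks)"
  and Li_eq: "\<forall>k\<in>set ks. 0 < k \<Longrightarrow> u \<in> H \<Longrightarrow> Li U p H ks u = Li_principal ks (p u)"
  and Li_inv_eq: "\<forall>k\<in>set ks. 0 < k \<Longrightarrow> u \<in> H \<Longrightarrow> Li_inv U p H ks u = Li_principal ks (1 / p u)"
  using extends_Li[of ks] extends_Li_inv[of ks] by (simp_all add: extends_def[OF univ lift])

lemma log_inv_hol: "holomorphic_on_cover U p (log_inv U p H)"
  unfolding log_inv_def[abs_def]
  by (rule holomorphic_on_cover_minus) (use extends_log in \<open>simp add: extends_def[OF univ lift]\<close>)

lemma log_inv_eq: "u \<in> H \<Longrightarrow> log_inv U p H u = - Ln (p u)"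
  using extends_log unfolding extends_def[OF univ lift] log_inv_def by simp

lemma constant_on_cover:
  assumes "holomorphic_on_cover U p F" "\<And>u. u \<in> H \<Longrightarrow> F u = c" "z \<in> U"
  shows "F z = c"
proof -
  have "F z - c = 0"
  proof (rule identity_on_cover[OF univ _ lift_open[OF univ lift] lift_nonempty[OF univ lift] _ assms(3)])
    show "holomorphic_on_cover U p (\<lambda>u. F u - c)"
      by (intro holomorphic_on_cover_diff assms(1) holomorphic_on_cover_const)
  qed (use assms(2) in simp)
  then show ?thesis by simp
qed

end

theorem proposition19:
  fixes U :: "'a::topological_space set" and p :: "'a \<Rightarrow> complex" and H :: "'a set"
    and m n :: nat and z :: 'a
  assumes cover: "universal_cover U p"
    and lift: "is_lift U p {w. Im w < 0} H"
    and m: "0 < m" and n: "0 < n"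
    and z: "z \<in> U"
  shows
    "log_inv U p H z ^ m / fact m
      - (\<Sum>i<m. (Li U p H [m - i] z + (- 1) ^ (m - i) * Li_inv U p H [m - i] z)
                         * (log_inv U p H z ^ i / fact i))
     = of_real (bernoulli_num m) * ((2 * of_real pi * \<i>) ^ m / fact m)
     \<and>
     (\<Sum>i<m. (- 1) ^ (n + i + 1) * Li_inv U p H ((m - i) # replicate n 1) z
                        * (log_inv U p H z ^ i / fact i))
     + (\<Sum>i<m. (- 1) ^ (n + i + 1) * Li_inv U p H ((m - i + 1) # replicate (n - 1) 1) z
                        * (log_inv U p H z ^ i / fact i))
     + (\<Sum>i<m. \<Sum>j = 0..n.
          (- 1) ^ (m + n - j - 1) * Li_inv U p H (replicate (n - j) 1) z
          * (\<Sum>k = 0..j. of_nat ((m - i - 1 + j - k) choose (m - i - 1))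
                         * (\<Sum>\<^sub>\<infinity>s\<in>{1..}. G1 U p H (m - i + j) (k + 1) s z))
          * (log_inv U p H z ^ i / fact i))
     = (\<Sum>(m1, m2, m3)\<in>{(m1, m2, m3). m1 + m2 + m3 = m}. \<Sum>(n1, n2)\<in>{(n1, n2). n1 + n2 = n}.
          of_nat ((m1 + n1) choose m1) * (- 1) ^ m1 * of_real (P_exp (m1 + n1) zeta_seq)
          * of_real (P_exp m2 zeta_seq) * ((- of_real pi * \<i>) ^ m3 / fact m3)
          * of_real (P_exp n2 (\<lambda>k. - zeta_seq k)))"
proof
  note hol = holomorphic_on_cover_add holomorphic_on_cover_diff holomorphic_on_cover_mult
    holomorphic_on_cover_divide_const holomorphic_on_cover_power holomorphic_on_cover_sum
    holomorphic_on_cover_const log_inv_hol[OF cover lift] Li_hol[OF cover lift] Li_inv_hol[OF cover lift]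
  note on_H = log_inv_eq[OF cover lift] Li_eq[OF cover lift] Li_inv_eq[OF cover lift]
  let ?F = "\<lambda>z. log_inv U p H z ^ m / fact m
      - (\<Sum>i<m. (Li U p H [m - i] z + (- 1) ^ (m - i) * Li_inv U p H [m - i] z) * (log_inv U p H z ^ i / fact i))"
  show "?F z = of_real (bernoulli_num m) * ((2 * of_real pi * \<i>) ^ m / fact m)"
  proof (rule constant_on_cover[OF cover lift _ _ z])
    show "holomorphic_on_cover U p ?F" by (intro hol) auto
    fix u assume u: "u \<in> H"
    have "?F u = (- Ln (p u)) ^ m / fact m
      - (\<Sum>i<m. (Li_principal [m - i] (p u) + (- 1) ^ (m - i) * Li_principal [m - i] (1 / p u)) * ((- Ln (p u)) ^ i / fact i))"
      using u by (simp add: on_H)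
    also have "\<dots> = of_real (bernoulli_num m) * ((2 * of_real pi * \<i>) ^ m / fact m)"
      by (rule half_plane_first[OF m p_half_plane[OF cover lift u]])
    finally show "?F u = of_real (bernoulli_num m) * ((2 * of_real pi * \<i>) ^ m / fact m)" .
  qed
  \<comment> \<open>Only sums over all heights enter, so words can be replaced by
    compositions.\<close>
  have S: "(\<Sum>\<^sub>\<infinity>s\<in>{1..}. G1 U p H k (l + 1) s z) = (\<Sum>ks\<in>comps k (l + 1). Li U p H ks z)" for k l
    by (rule sum_G1) simp
  let ?G = "\<lambda>z. (\<Sum>i<m. (- 1) ^ (n + i + 1) * Li_inv U p H ((m - i) # replicate n 1) z * (log_inv U p H z ^ i / fact i))
     + (\<Sum>i<m. (- 1) ^ (n + i + 1) * Li_inv U p H ((m - i + 1) # replicate (n - 1) 1) z * (log_inv U p H z ^ i / fact i))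
     + (\<Sum>i<m. \<Sum>j = 0..n.
          (- 1) ^ (m + n - j - 1) * Li_inv U p H (replicate (n - j) 1) z
          * (\<Sum>k = 0..j. of_nat ((m - i - 1 + j - k) choose (m - i - 1))
                         * (\<Sum>ks\<in>comps (m - i + j) (k + 1). Li U p H ks z))
          * (log_inv U p H z ^ i / fact i))"
  \<comment> \<open>With the right side written as one coefficient of \<open>gamma_fps\<close>, the
    claim is that a holomorphic function on the cover is constant, which is checked on the
    lift.\<close>
  have "?G z = cf gamma_fps m n"
  proof (rule constant_on_cover[OF cover lift _ _ z])
    show "holomorphic_on_cover U p ?G" by (intro hol) (auto dest: comps_pos)
    fix u assume u: "u \<in> H"
    \<comment> \<open>\<open>i < m\<close> makes the leading entry positive, so that the index is
      admissible.\<close>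
    have G1: "Li_inv U p H ((m - i) # replicate n 1) u = Li_principal ((m - i) # replicate n 1) (1 / p u)" if "i < m" for i
      using u that by (intro on_H(3)) auto
    have G2: "Li_inv U p H ((m - i + 1) # replicate (n - 1) 1) u = Li_principal ((m - i + 1) # replicate (n - 1) 1) (1 / p u)" for i
      using u by (intro on_H(3)) auto
    have G3: "Li_inv U p H (replicate (n - j) 1) u = Li_principal (replicate (n - j) 1) (1 / p u)" for j
      using u by (intro on_H(3)) auto
    have G4: "(\<Sum>ks\<in>comps k l. Li U p H ks u) = (\<Sum>ks\<in>comps k l. Li_principal ks (p u))" for k l
      using u by (intro sum.cong refl on_H(2) comps_pos)
    have "?G u = (\<Sum>i<m. (- 1) ^ (n + i + 1) * Li_principal ((m - i) # replicate n 1) (1 / p u) * ((- Ln (p u)) ^ i / fact i))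
     + (\<Sum>i<m. (- 1) ^ (n + i + 1) * Li_principal ((m - i + 1) # replicate (n - 1) 1) (1 / p u) * ((- Ln (p u)) ^ i / fact i))
     + (\<Sum>i<m. \<Sum>j = 0..n.
          (- 1) ^ (m + n - j - 1) * Li_principal (replicate (n - j) 1) (1 / p u)
          * (\<Sum>k = 0..j. of_nat ((m - i - 1 + j - k) choose (m - i - 1))
                         * (\<Sum>ks\<in>comps (m - i + j) (k + 1). Li_principal ks (p u)))
          * ((- Ln (p u)) ^ i / fact i))"
      unfolding log_inv_eq[OF cover lift u] G2 G3 G4 by (intro arg_cong2[of _ _ _ _ "(+)"] sum.cong refl) (simp only: G1 lessThan_iff)
    also have "\<dots> = cf gamma_fps m n" by (rule half_plane_second[OF m n p_half_plane[OF cover lift u]])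
    finally show "?G u = cf gamma_fps m n" .
  qed
  then show "(\<Sum>i<m. (- 1) ^ (n + i + 1) * Li_inv U p H ((m - i) # replicate n 1) z
                        * (log_inv U p H z ^ i / fact i))
     + (\<Sum>i<m. (- 1) ^ (n + i + 1) * Li_inv U p H ((m - i + 1) # replicate (n - 1) 1) z
                        * (log_inv U p H z ^ i / fact i))
     + (\<Sum>i<m. \<Sum>j = 0..n.
          (- 1) ^ (m + n - j - 1) * Li_inv U p H (replicate (n - j) 1) z
          * (\<Sum>k = 0..j. of_nat ((m - i - 1 + j - k) choose (m - i - 1))
                         * (\<Sum>\<^sub>\<infinity>s\<in>{1..}. G1 U p H (m - i + j) (k + 1) s z))
          * (log_inv U p H z ^ i / fact i))
     = (\<Sum>(m1, m2, m3)\<in>{(m1, m2, m3). m1 + m2 + m3 = m}. \<Sum>(n1, n2)\<in>{(n1, n2). n1 + n2 = n}.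
          of_nat ((m1 + n1) choose m1) * (- 1) ^ m1 * of_real (P_exp (m1 + n1) zeta_seq)
          * of_real (P_exp m2 zeta_seq) * ((- of_real pi * \<i>) ^ m3 / fact m3)
          * of_real (P_exp n2 (\<lambda>k. - zeta_seq k)))"
    unfolding S cf_gamma_fps .
qed

end
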